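(* Let $d\ge2$, $1\le k\le d+1$, and $\gamma=(\gamma_1,\dots,\gamma_{d+1-k})$ with $\gamma_j>-1$ (no $\gamma$ if $k=d+1$). Then: (i) $\langle\cdot,\cdot\rangle_{\gamma,-\mathbf 1_k}$ is an inner product on polynomials if all $\lambda,\lambda_i,\lambda_I$ occurring in it are positive, for $1\le k\le d$; for $k=d+1$ it is an inner product if all $\lambda_I>0$ and at least one $\lambda_{j,0}$ is positive. (ii) Under the conditions of (i), for each $n\ge0$, $\mathcal U_n^d(W_{\gamma,-\mathbf 1_k})$ is the space of orthogonal polynomials of degree $n$ with respect to $\langle\cdot,\cdot\rangle_{\gamma,-\mathbf 1_k}$ (i.e. the orthogonal complement of $\Pi_{n-1}^d$ in $\Pi_n^d$), where for $k=d+1$ one takes $\mathcal U_1^d(W_{-\mathbf 1})=\mathrm{span}\{x_1+c_1,\dots,x_d+c_d\}$ with $c_j=-\lambda_{j,0}/(\lambda_{0,0}+\lambda_{1,0}+\dots+\lambda_{d,0})$. (iii) For $k=1$ the sum $\mathcal U_n^d(W_{\gamma,-1})=x_{d+1}\mathcal V_{n-1}^d(W_{\gamma,1})+H^d_{n,\{d+1\}}(W_{(\gamma,0)})$ is orthogonal with respect to $\langle\cdot,\cdot\rangle_{\gamma,-1}$.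
   Context: Notation: $|x|=x_1+\dots+x_d$, $x_{d+1}:=1-|x|$, $T^d=\{x\in\mathbb R^d:x_i\ge0,1-|x|\ge0\}$, $\Pi_m^d$ polynomials of degree $\le m$, $e_0=0$, $e_i$ standard basis vectors; for $I\subset\{1,\dots,d+1\}$, $T_I=\{x\in T^d:x_i=0\ \forall i\in I\}$ with its Lebesgue measure in the remaining free coordinates; $\partial^I=\prod_{i\in I}\partial/\partial x_i$; $x^\gamma:=\prod_{i\le d+1-k}x_i^{\gamma_i}$; $x_J=\prod_{i\in J}x_i$. For parameters $>-1$, $\mathcal V_m^d(W_{\boldsymbol\varepsilon})$ is the space of polynomials of degree $m$ orthogonal in $L^2(\prod_{i=1}^{d+1}x_i^{\varepsilon_i},T^d)$ to $\Pi^d_{m-1}$; negative-index spaces are $\{0\}$. Face spaces $H_{m,S}^d(W_{\boldsymbol\varepsilon})$: choose $r\notin S$ ($r=d+1$ if $d+1\notin S$, else fixed in $\{1,..,d\}\setminus S$), $A=\{1,..,d+1\}\setminus(S\cup\{r\})$, $D_i=\partial_i-\partial_r$ ($\partial_{d+1}:=0$), $R_{\mathbf m}=\big(\prod_{i\in A\cup\{r\}}x_i^{-\varepsilon_i}\big)\prod_{i\in A}D_i^{m_i}\big[\big(\prod_{i\in A}x_i^{\varepsilon_i+m_i}\big)x_r^{\varepsilon_r+|\mathbf m|}\big]$, $H_{m,S}^d=\mathrm{span}\{R_{\mathbf m}:\mathbf m\in\mathbb N_0^A,|\mathbf m|=m\}$, and $H_{m,S}^d=\{0\}$ if $|S|\ge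 d$. Spaces $\mathcal U$: with $B=\{d-k+2,\dots,d+1\}$ and $\varepsilon^J$ ($J\subset B$) given by $\varepsilon^J_i=\gamma_i$ ($i\le d-k+1$), $1$ ($i\in J$), $0$ ($i\in B\setminus J$): $\mathcal U_0^d=\mathrm{span}\{1\}$; for $k\le d$, $n\ge1$: $\mathcal U_n^d(W_{\gamma,-\mathbf 1_k})=x_B\mathcal V_{n-k}^d(W_{\gamma,\mathbf 1_k})+\sum_{j=1}^{k-1}\sum_{J\subset B,|J|=j}x_JH^d_{n-j,B\setminus J}(W_{\varepsilon^J})+H^d_{n,B}(W_{(\gamma,\mathbf 0_k)})$; for $k=d+1$, $n\ge2$: $\mathcal U_n^d(W_{-\mathbf 1})=x_1\cdots x_{d+1}\mathcal V_{n-d-1}^d(W_{\mathbf 1})+\sum_{j=2}^d\sum_{|J|=j}x_JH^d_{n-j,\{1..d+1\}\setminus J}(W_{\varepsilon^J})$. Inner products ($\lambda$'s $\ge0$): for $k=1$: $\langle f,g\rangle_{\gamma,-1}=\sum_{i=1}^d\int_{T^d}x_i\partial_if\,\partial_ig\,x^\gamma dx+\lambda\int_{T_{\{d+1\}}}fg\,x_1^{\gamma_1}\cdots x_d^{\gamma_d}$, the last integral over $\{x_1+\dots+x_d=1\}$ in coordinates $(x_1,..,x_{d-1})$. For $2\le k\le d$, with $\mathbf m_k=\{d-k+2,\dots,d\}$: $\langle f,g\rangle_{\gamma,-\mathbf 1_k}=\int_{T^d}\partial^{\mathbf m_k}f\,\partial^{\mathbf m_k}g\,(1-|x|)^{k-2}x^\gamma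 dx+\sum_{i=1}^{k-2}\sum_{I\subset\mathbf m_k,|I|=i}\lambda_I\int_{T_{\mathbf m_k\setminus I}}\partial^If\,\partial^Ig\,(1-|x|)^{i-1}x^\gamma+\sum_{i=1}^{d-k+1}\lambda_i\int_{T_{\mathbf m_k}}x_i\partial_if\,\partial_ig\,x^\gamma+\lambda\int_{T_{\mathbf m_k\cup\{d+1\}}}fg\,x^\gamma$, where for $k=d$ the last term is replaced by $\lambda f(e_1)g(e_1)$. For $k=d+1$: $\langle f,g\rangle_{-\mathbf 1}=\int_{T^d}\partial^{\{1..d\}}f\,\partial^{\{1..d\}}g\,(1-|x|)^{d-1}dx+\sum_{i=1}^{d-1}\sum_{I\subset\{1..d\},|I|=i}\lambda_I\int_{T_{\{1..d\}\setminus I}}\partial^If\,\partial^Ig\,(1-|x|)^{i-1}+\sum_{j=0}^d\lambda_{j,0}f(e_j)g(e_j)$. *)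

theory Defs
  imports "HOL-Analysis.Analysis"
begin

text \<open>Points of R^d are represented as functions x :: nat => real, only the
coordinates x 1, ..., x d being relevant.  Functions on R^d are of type
(nat => real) => real.\<close>

type_synonym pt = "nat \<Rightarrow> real"
type_synonym fn = "pt \<Rightarrow> real"

definition xx :: "nat \<Rightarrow> pt \<Rightarrow> nat \<Rightarrow> real" where
  "xx d x i = (if i = d + 1 then 1 - (\<Sum>j\<in>{1..d}. x j) else x i)"

definition xprod :: "nat \<Rightarrow> nat set \<Rightarrow> fn" where
  "xprod d J x = (\<Prod>i\<in>J. xx d x i)"

text \<open>e_0 = 0, e_j standard basis vectors\<close>
definition ebas :: "nat \<Rightarrow> pt" where
  "ebas j = (\<lambda>i. if i = j then 1 else 0)"

definition tsimplex :: "nat \<Rightarrow> pt set" where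
  "tsimplex d = {x. (\<forall>i\<in>{1..d}. 0 \<le> x i) \<and> (\<Sum>i\<in>{1..d}. x i) \<le> 1}"

definition tsimplex_int :: "nat \<Rightarrow> pt set" where
  "tsimplex_int d = {x. (\<forall>i\<in>{1..d}. 0 < x i) \<and> (\<Sum>i\<in>{1..d}. x i) < 1}"

definition mindex :: "nat \<Rightarrow> nat \<Rightarrow> (nat \<Rightarrow> nat) set" where
  "mindex d m = {\<alpha>. (\<forall>i. i \<notin> {1..d} \<longrightarrow> \<alpha> i = 0) \<and> (\<Sum>i\<in>{1..d}. \<alpha> i) \<le> m}"

definition polys_deg :: "nat \<Rightarrow> int \<Rightarrow> fn set" where
  "polys_deg d m = (if m < 0 then {\<lambda>x. 0} else
     {f. \<exists>c :: (nat \<Rightarrow> nat) \<Rightarrow> real.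
           f = (\<lambda>x. \<Sum>\<alpha>\<in>mindex d (nat m). c \<alpha> * (\<Prod>i\<in>{1..d}. x i ^ \<alpha> i))})"

definition polys :: "nat \<Rightarrow> fn set" where
  "polys d = (\<Union>m::nat. polys_deg d (int m))"

definition pd :: "nat \<Rightarrow> fn \<Rightarrow> fn" where
  "pd i f = (\<lambda>x. deriv (\<lambda>t. f (x(i := t))) (x i))"

definition pdset :: "nat set \<Rightarrow> fn \<Rightarrow> fn" where
  "pdset I f = foldr pd (sorted_list_of_set I) f"

definition simp_int :: "nat \<Rightarrow> fn \<Rightarrow> real" where
  "simp_int d h = integral\<^sup>L (PiM {1..d} (\<lambda>_. lborel))
      (\<lambda>y. indicator (tsimplex d) y * h y)"

definition reg :: "nat set \<Rightarrow> pt set" where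
  "reg F = {y. (\<forall>i\<in>F. 0 \<le> y i) \<and> (\<Sum>i\<in>F. y i) \<le> 1}"

text \<open>Integral over the face T_I = {x in T^d : x_i = 0 for i in I}
  (I a subset of {1..d+1}) w.r.t. Lebesgue measure in the free coordinates.
  If d+1 \<notin> I the free coordinates are {1..d} - I.  If d+1 \<in> I, the largest
  remaining coordinate m is eliminated via x_m = 1 - (sum of the other free
  coordinates), and one integrates over the others.\<close>
definition face_int :: "nat \<Rightarrow> nat set \<Rightarrow> fn \<Rightarrow> real" where
  "face_int d I h =
    (let F = {1..d} - I in
     if d + 1 \<notin> I then
       integral\<^sup>L (PiM F (\<lambda>_. lborel))
         (\<lambda>y. indicator (reg F) y * h (\<lambda>i. if i \<in> F then y i else 0))
     else if F = {} then 0
     else (let m = Max F; G = F - {m} in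
       integral\<^sup>L (PiM G (\<lambda>_. lborel))
         (\<lambda>y. indicator (reg G) y *
              h (\<lambda>i. if i \<in> G then y i else if i = m then 1 - (\<Sum>j\<in>G. y j) else 0))))"

definition jac_ip :: "nat \<Rightarrow> (nat \<Rightarrow> real) \<Rightarrow> fn \<Rightarrow> fn \<Rightarrow> real" where
  "jac_ip d \<epsilon> f g = simp_int d (\<lambda>x. f x * g x * (\<Prod>i\<in>{1..d+1}. xx d x i powr \<epsilon> i))"

definition Vsp :: "nat \<Rightarrow> (nat \<Rightarrow> real) \<Rightarrow> int \<Rightarrow> fn set" where
  "Vsp d \<epsilon> m = (if m < 0 then {\<lambda>x. 0} else
     {p \<in> polys_deg d m. \<forall>q \<in> polys_deg d (m - 1). jac_ip d \<epsilon> p q = 0})"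

definition rsel :: "nat \<Rightarrow> nat set \<Rightarrow> nat" where
  "rsel d S = (if d + 1 \<notin> S then d + 1 else Min ({1..d} - S))"

definition Aset :: "nat \<Rightarrow> nat set \<Rightarrow> nat set" where
  "Aset d S = {1..d+1} - (S \<union> {rsel d S})"

definition pdx :: "nat \<Rightarrow> nat \<Rightarrow> fn \<Rightarrow> fn" where
  "pdx d i f = (if i \<le> d then pd i f else (\<lambda>x. 0))"

definition Dop :: "nat \<Rightarrow> nat \<Rightarrow> nat \<Rightarrow> fn \<Rightarrow> fn" where
  "Dop d r i f = (\<lambda>x. pdx d i f x - pdx d r f x)"

definition Rfun :: "nat \<Rightarrow> nat set \<Rightarrow> (nat \<Rightarrow> real) \<Rightarrow> (nat \<Rightarrow> nat) \<Rightarrow> fn" where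
  "Rfun d S \<epsilon> mm =
    (let r = rsel d S; A = Aset d S;
         G = (\<lambda>x. (\<Prod>i\<in>A. xx d x i powr (\<epsilon> i + real (mm i))) *
                   xx d x r powr (\<epsilon> r + real (\<Sum>i\<in>A. mm i)));
         DG = foldr (\<lambda>i g. (Dop d r i ^^ mm i) g) (sorted_list_of_set A) G
     in (\<lambda>x. (\<Prod>i\<in>A \<union> {r}. xx d x i powr (- \<epsilon> i)) * DG x))"

definition Hidx :: "nat set \<Rightarrow> nat \<Rightarrow> (nat \<Rightarrow> nat) set" where
  "Hidx A m = {mm. (\<forall>i. i \<notin> A \<longrightarrow> mm i = 0) \<and> (\<Sum>i\<in>A. mm i) = m}"

text \<open>span of the R_m, which are polynomials (identities holding on the
  interior of T^d, where the Rodrigues formula makes sense).\<close>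
definition Hsp :: "nat \<Rightarrow> nat set \<Rightarrow> (nat \<Rightarrow> real) \<Rightarrow> int \<Rightarrow> fn set" where
  "Hsp d S \<epsilon> m = (if m < 0 \<or> card S \<ge> d then {\<lambda>x. 0} else
     {p \<in> polys d. \<exists>c :: (nat \<Rightarrow> nat) \<Rightarrow> real. \<forall>x \<in> tsimplex_int d.
        p x = (\<Sum>mm\<in>Hidx (Aset d S) (nat m). c mm * Rfun d S \<epsilon> mm x)})"

definition Bset :: "nat \<Rightarrow> nat \<Rightarrow> nat set" where
  "Bset d k = {d - k + 2..d + 1}"

definition epsJ :: "nat \<Rightarrow> nat \<Rightarrow> (nat \<Rightarrow> real) \<Rightarrow> nat set \<Rightarrow> nat \<Rightarrow> real" where
  "epsJ d k \<gamma> J i = (if i \<le> d + 1 - k then \<gamma> i else if i \<in> J then 1 else 0)"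

text \<open>Defined for k <= d and all n, and for k = d+1 and n \<noteq> 1
  (the case k = d+1, n = 1 depends on the inner product and is given in the theorem).\<close>
definition Usp :: "nat \<Rightarrow> nat \<Rightarrow> (nat \<Rightarrow> real) \<Rightarrow> nat \<Rightarrow> fn set" where
  "Usp d k \<gamma> n =
    (if n = 0 then {f. \<exists>c. f = (\<lambda>x. c)}
     else if k \<le> d then
       (let B = Bset d k; Js = {J. J \<subseteq> B \<and> 1 \<le> card J \<and> card J \<le> k - 1} in
        {f. \<exists>v hs h. v \<in> Vsp d (epsJ d k \<gamma> B) (int n - int k)
              \<and> (\<forall>J\<in>Js. hs J \<in> Hsp d (B - J) (epsJ d k \<gamma> J) (int n - int (card J)))
              \<and> h \<in> Hsp d B (epsJ d k \<gamma> {}) (int n)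
              \<and> f = (\<lambda>x. xprod d B x * v x + (\<Sum>J\<in>Js. xprod d J x * hs J x) + h x)})
     else
       (let B = {1..d+1}; Js = {J. J \<subseteq> B \<and> 2 \<le> card J \<and> card J \<le> d} in
        {f. \<exists>v hs. v \<in> Vsp d (epsJ d k \<gamma> B) (int n - int d - 1)
              \<and> (\<forall>J\<in>Js. hs J \<in> Hsp d (B - J) (epsJ d k \<gamma> J) (int n - int (card J)))
              \<and> f = (\<lambda>x. xprod d B x * v x + (\<Sum>J\<in>Js. xprod d J x * hs J x))}))"

definition xgam :: "nat \<Rightarrow> nat \<Rightarrow> (nat \<Rightarrow> real) \<Rightarrow> fn" where
  "xgam d k \<gamma> x = (\<Prod>i\<in>{1..d+1-k}. x i powr \<gamma> i)"

definition sob_ip :: "nat \<Rightarrow> nat \<Rightarrow> (nat \<Rightarrow> real) \<Rightarrow> real \<Rightarrow> (nat \<Rightarrow> real) \<Rightarrow>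
    (nat set \<Rightarrow> real) \<Rightarrow> (nat \<Rightarrow> real) \<Rightarrow> fn \<Rightarrow> fn \<Rightarrow> real" where
  "sob_ip d k \<gamma> lam lami lamI lam0 f g =
    (if k = 1 then
       (\<Sum>i\<in>{1..d}. simp_int d (\<lambda>x. x i * pd i f x * pd i g x * xgam d k \<gamma> x))
       + lam * face_int d {d+1} (\<lambda>x. f x * g x * xgam d k \<gamma> x)
     else if k \<le> d then
       (let mk = {d-k+2..d} in
         simp_int d (\<lambda>x. pdset mk f x * pdset mk g x * (xx d x (d+1)) ^ (k - 2) * xgam d k \<gamma> x)
       + (\<Sum>I\<in>{I\<in>Pow mk. 1 \<le> card I \<and> card I \<le> k - 2}.
            lamI I * face_int d (mk - I)
              (\<lambda>x. pdset I f x * pdset I g x * (xx d x (d+1)) ^ (card I - 1) * xgam d k \<gamma> x))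
       + (\<Sum>i\<in>{1..d-k+1}. lami i *
            face_int d mk (\<lambda>x. x i * pd i f x * pd i g x * xgam d k \<gamma> x))
       + (if k = d then lam * f (ebas 1) * g (ebas 1)
          else lam * face_int d (mk \<union> {d+1}) (\<lambda>x. f x * g x * xgam d k \<gamma> x)))
     else
       simp_int d (\<lambda>x. pdset {1..d} f x * pdset {1..d} g x * (xx d x (d+1)) ^ (d - 1))
       + (\<Sum>I\<in>{I\<in>Pow {1..d}. 1 \<le> card I \<and> card I \<le> d - 1}.
            lamI I * face_int d ({1..d} - I)
              (\<lambda>x. pdset I f x * pdset I g x * (xx d x (d+1)) ^ (card I - 1)))
       + (\<Sum>j\<in>{0..d}. lam0 j * f (ebas j) * g (ebas j)))"

definition is_inner_product_on :: "fn set \<Rightarrow> (fn \<Rightarrow> fn \<Rightarrow> real) \<Rightarrow> bool" where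
  "is_inner_product_on P B \<longleftrightarrow>
     (\<forall>f\<in>P. \<forall>g\<in>P. B f g = B g f)
   \<and> (\<forall>f\<in>P. \<forall>g\<in>P. \<forall>h\<in>P. \<forall>a b. B (\<lambda>x. a * f x + b * g x) h = a * B f h + b * B g h)
   \<and> (\<forall>f\<in>P. f \<noteq> (\<lambda>x. 0) \<longrightarrow> B f f > 0)"

definition orth_polys :: "nat \<Rightarrow> (fn \<Rightarrow> fn \<Rightarrow> real) \<Rightarrow> nat \<Rightarrow> fn set" where
  "orth_polys d B n = {p \<in> polys_deg d (int n). \<forall>q \<in> polys_deg d (int n - 1). B p q = 0}"

end

(*
  In barycentric coordinates x_1, ..., x_{d+1} a polynomial of degree at most n on the simplex is the
  restriction of a homogeneous polynomial of degree n, and the integral of a homogeneous polynomial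
  against a Dirichlet weight over a face is a Gamma factor times its integral against the product
  weight x^e exp(-(x_1 + ... + x_{d+1})) over an orthant. For this Laguerre functional integration by
  parts is purely algebraic. All forms, the spaces V and the face spaces H thus become conditions on
  homogeneous polynomials: H and V consist of the homogeneous polynomials that are orthogonal to
  everything of lower degree in their own variables (for H by the Rodrigues formula and a
  biorthogonality argument).

  Orthogonality of x_J q to lower degrees: on a face the derivatives are moved to the other factor
  one at a time. The boundary terms vanish because of the factor x_J and the power of x_{d+1} in the
  weight, and after the last step q is paired with a polynomial of too small degree. Completeness: a
  homogeneous polynomial in given variables is a member of H plus the sum s of these variables times
  a polynomial of lower degree; on the simplex s is 1 minus the sum of the other variables, so this
  remainder has lower degree or belongs to a larger J. Definiteness: the vanishing of a mixed
  derivative along the edge directions of a face and of the function on the smaller faces forces the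
  function to vanish on the face. For k = 1 the sum is orthogonal because the elements of H are
  annihilated by the sum of x_i D_i^2 + (gamma_i + 1) D_i.
*)

theory Submission
  imports Defs
begin

section \<open>Polynomial functions\<close>

text \<open>The Gamma factor attached to a face depends on the polynomials only through their
  degrees, so it is common to all terms of a homogeneous polynomial and only its sign matters. This
  is why homogeneous representatives of fixed degree are used throughout and why \<open>hp\<close>
  carries the set of admissible degrees. The obstacle is the exponential weight. Integration by
  parts in x_i returns, besides the derivative, an undifferentiated term coming from
  \<open>exp (- x_i)\<close>, whose degree does not drop. In an edge derivative
  \<open>pd i - pd r\<close> the two exponential terms cancel, provided that both boundary terms
  vanish. If x_i is absent from the face polynomial, only the derivative in x_r survives, its
  exponential term stays, and one degree is lost. That the losses never exceed what orthogonality to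
  lower degrees allows is the count in \<open>Lag_move_foldr_Dd\<close> and \<open>T1_orth\<close>.
  A second obstacle is the convention \<open>0 powr a = 0\<close>, valid also for
  \<open>a = 0\<close>: weights with exponent 0 are wrong on the boundary, so integrals over faces
  are compared almost everywhere.\<close>

definition mon :: "nat set \<Rightarrow> (nat \<Rightarrow> nat) \<Rightarrow> fn" where
  "mon C a x = (\<Prod>i\<in>C. x i ^ a i)"

text \<open>Polynomials in the variables with index in C all of whose monomials have degree in D.\<close>

inductive_set hp :: "nat set \<Rightarrow> nat set \<Rightarrow> fn set" for C D where
  zero: "(\<lambda>x. 0) \<in> hp C D"
| step: "f \<in> hp C D \<Longrightarrow> sum a C \<in> D \<Longrightarrow> (\<lambda>x. f x + c * mon C a x) \<in> hp C D"

lemma hp_monomial: "sum a C \<in> D \<Longrightarrow> (\<lambda>x. c * mon C a x) \<in> hp C D"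
  using hp.step[OF hp.zero, of a C D c] by simp

lemma hp_add:
  assumes "f \<in> hp C D" "g \<in> hp C D"
  shows "(\<lambda>x. f x + g x) \<in> hp C D"
  using assms(2)
proof induction
  case zero
  then show ?case using assms(1) by simp
next
  case (step g a c)
  from hp.step[OF step(3,2), of c] show ?case by (simp add: add.assoc)
qed

lemma hp_scale:
  assumes "f \<in> hp C D"
  shows "(\<lambda>x. k * f x) \<in> hp C D"
  using assms
proof induction
  case zero
  then show ?case by (simp add: hp.zero)
next
  case (step g a c)
  from hp.step[OF step(3,2), of "k * c"] show ?case by (simp add: algebra_simps)
qed

lemma hp_diff:
  assumes "f \<in> hp C D" "g \<in> hp C D"
  shows "(\<lambda>x. f x - g x) \<in> hp C D"
  using hp_add[OF assms(1) hp_scale[OF assms(2), of "-1"]] by simp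

lemma hp_uminus: "f \<in> hp C D \<Longrightarrow> (\<lambda>x. - f x) \<in> hp C D"
  using hp_scale[of f C D "-1"] by simp

lemma hp_sum:
  assumes "\<And>s. s \<in> S \<Longrightarrow> f s \<in> hp C D"
  shows "(\<lambda>x. \<Sum>s\<in>S. f s x) \<in> hp C D"
  using assms
proof (induction S rule: infinite_finite_induct)
  case (insert s S)
  have "(\<lambda>x. f s x + (\<Sum>s\<in>S. f s x)) \<in> hp C D"
    by (rule hp_add) (use insert in auto)
  then show ?case using insert by simp
qed (auto intro: hp.zero)

lemma hp_mono:
  assumes "f \<in> hp C D" "D \<subseteq> E"
  shows "f \<in> hp C E"
  using assms(1) by induction (use assms(2) in \<open>auto intro: hp.intros\<close>)

lemma mon_mult: "mon C a x * mon C b x = mon C (\<lambda>i. a i + b i) x"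
  by (simp add: mon_def prod.distrib power_add)

lemma hp_mult:
  assumes f: "f \<in> hp C D" and g: "g \<in> hp C E" and "\<And>a b. a \<in> D \<Longrightarrow> b \<in> E \<Longrightarrow> a + b \<in> F"
  shows "(\<lambda>x. f x * g x) \<in> hp C F"
  using f
proof induction
  case zero
  then show ?case by (simp add: hp.zero)
next
  case (step f a c)
  have "(\<lambda>x. c * mon C a x * g x) \<in> hp C F"
    using g
  proof induction
    case zero
    then show ?case by (simp add: hp.zero)
  next
    case (step g b c')
    have "sum (\<lambda>i. a i + b i) C \<in> F"
      using \<open>sum a C \<in> D\<close> step(2) assms(3) by (simp add: sum.distrib)
    from hp.step[OF step(3) this, of "c * c'"] show ?case
      by (simp add: algebra_simps mon_mult[symmetric])
  qed
  from hp_add[OF step(3) this] show ?case by (simp add: algebra_simps)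
qed

lemma hp_const: "0 \<in> D \<Longrightarrow> (\<lambda>x. c) \<in> hp C D"
  using hp_monomial[of "\<lambda>_. 0" C D c] by (simp add: mon_def)

lemma mon_var:
  assumes "finite C" "i \<in> C"
  shows "mon C (\<lambda>j. if j = i then 1 else 0) = (\<lambda>x. x i)"
proof
  fix x :: pt
  have "mon C (\<lambda>j. if j = i then 1 else 0) x = (\<Prod>j\<in>C. if j = i then x j else 1)"
    unfolding mon_def by (rule prod.cong) auto
  then show "mon C (\<lambda>j. if j = i then 1 else 0) x = x i" using assms by simp
qed

lemma hp_var:
  assumes "finite C" "i \<in> C" "1 \<in> D"
  shows "(\<lambda>x. x i) \<in> hp C D"
  using hp_monomial[of "\<lambda>j. if j = i then 1 else 0" C D 1] assms
  by (simp add: mon_var sum.delta)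

lemma hp_power:
  assumes "f \<in> hp C {m}"
  shows "(\<lambda>x. f x ^ k) \<in> hp C {k * m}"
proof (induction k)
  case 0
  then show ?case by (simp add: hp_const)
next
  case (Suc k)
  have "(\<lambda>x. f x * f x ^ k) \<in> hp C {Suc k * m}"
    by (rule hp_mult[OF assms Suc]) auto
  then show ?case by simp
qed

lemma hp_prod_vars:
  assumes "finite C" "J \<subseteq> C"
  shows "(\<lambda>x. \<Prod>i\<in>J. x i) \<in> hp C {card J}"
proof -
  have "finite J" using assms finite_subset by blast
  then show ?thesis using assms(2)
  proof induction
    case empty
    then show ?case by (simp add: hp_const)
  next
    case (insert i J)
    have "(\<lambda>x. x i * (\<Prod>i\<in>J. x i)) \<in> hp C {card (insert i J)}"
      by (rule hp_mult[OF hp_var[of C i "{1}"]]) (use assms insert in auto)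
    then show ?case using insert by simp
  qed
qed

lemma mon_extend:
  assumes "finite C'" "C \<subseteq> C'"
  shows "mon C a x = mon C' (\<lambda>i. if i \<in> C then a i else 0) x"
proof -
  have "mon C' (\<lambda>i. if i \<in> C then a i else 0) x = (\<Prod>i\<in>C. x i ^ (if i \<in> C then a i else 0))"
    unfolding mon_def by (rule prod.mono_neutral_right) (use assms in auto)
  then show ?thesis by (simp add: mon_def)
qed

lemma hp_superset:
  assumes "f \<in> hp C D" "C \<subseteq> C'" "finite C'"
  shows "f \<in> hp C' D"
  using assms(1)
proof induction
  case zero
  then show ?case by (rule hp.zero)
next
  case (step f a c)
  have "sum (\<lambda>i. if i \<in> C then a i else 0) C' = sum a C"
    using assms by (simp add: sum.If_cases Int_absorb1)
  with hp.step[OF step(3), of "\<lambda>i. if i \<in> C then a i else 0" c] step(2) show ?case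
    by (simp add: mon_extend[OF assms(3,2), symmetric])
qed

text \<open>Polynomials without a record of variables and degrees: this is all that the
  differentiation rules and integrability ask for, while \<open>hp\<close> is kept for degree
  counts.\<close>

inductive pol :: "fn \<Rightarrow> bool" where
  pol_const: "pol (\<lambda>x. c)"
| pol_var: "pol (\<lambda>x. x i)"
| pol_add: "pol f \<Longrightarrow> pol g \<Longrightarrow> pol (\<lambda>x. f x + g x)"
| pol_mult: "pol f \<Longrightarrow> pol g \<Longrightarrow> pol (\<lambda>x. f x * g x)"

lemma pol_uminus: "pol f \<Longrightarrow> pol (\<lambda>x. - f x)"
  using pol_mult[OF pol_const[of "-1"], of f] by simp

lemma pol_diff: "pol f \<Longrightarrow> pol g \<Longrightarrow> pol (\<lambda>x. f x - g x)"
  using pol_add[OF _ pol_uminus, of f g] by simp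

lemma pol_power: "pol f \<Longrightarrow> pol (\<lambda>x. f x ^ k)"
  by (induction k) (auto intro: pol_const pol_mult)

lemma pol_sum: "(\<And>s. s \<in> S \<Longrightarrow> pol (f s)) \<Longrightarrow> pol (\<lambda>x. \<Sum>s\<in>S. f s x)"
  by (induction S rule: infinite_finite_induct) (auto intro: pol_const pol_add)

lemma pol_prod: "(\<And>s. s \<in> S \<Longrightarrow> pol (f s)) \<Longrightarrow> pol (\<lambda>x. \<Prod>s\<in>S. f s x)"
  by (induction S rule: infinite_finite_induct) (auto intro: pol_const pol_mult)

lemma pol_mon: "pol (mon C a)"
proof -
  have "pol (\<lambda>x. mon C a x)"
    unfolding mon_def by (intro pol_prod pol_power pol_var)
  then show ?thesis by simp
qed

lemma hp_imp_pol:
  assumes "f \<in> hp C D"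
  shows "pol f"
  using assms
proof induction
  case (step f a c)
  show ?case by (intro pol_add pol_mult pol_const pol_mon step(3))
qed (rule pol_const)

lemmas pol_intros = pol_const pol_var pol_add pol_mult pol_uminus pol_diff pol_power pol_sum pol_prod

lemma pol_imp_hp:
  assumes "pol f"
  shows "\<exists>C. finite C \<and> f \<in> hp C UNIV"
  using assms
proof induction
  case (pol_const c)
  then show ?case using hp_const[of UNIV c "{}"] by blast
next
  case (pol_var i)
  then show ?case using hp_var[of "{i}" i UNIV] by blast
next
  case (pol_add f g)
  then obtain C C' where "finite C" "f \<in> hp C UNIV" "finite C'" "g \<in> hp C' UNIV" by blast
  then have "f \<in> hp (C \<union> C') UNIV" "g \<in> hp (C \<union> C') UNIV"
    by (auto intro: hp_superset)
  then show ?case using \<open>finite C\<close> \<open>finite C'\<close> hp_add by blast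
next
  case (pol_mult f g)
  then obtain C C' where "finite C" "f \<in> hp C UNIV" "finite C'" "g \<in> hp C' UNIV" by blast
  then have "f \<in> hp (C \<union> C') UNIV" "g \<in> hp (C \<union> C') UNIV"
    by (auto intro: hp_superset)
  then show ?case using \<open>finite C\<close> \<open>finite C'\<close> hp_mult[of f _ UNIV g UNIV UNIV] by blast
qed

section \<open>Partial derivatives and derivatives along edges\<close>

lemma pol_differentiable:
  assumes "pol f"
  shows "(\<lambda>t. f (x(i := t))) differentiable at s"
  using assms
proof (induction)
  case (pol_var j)
  then show ?case by (cases "i = j") auto
qed auto

lemma pol_has_pd:
  assumes "pol f"
  shows "((\<lambda>t. f (x(i := t))) has_real_derivative pd i f x) (at (x i))"
  using pol_differentiable[OF assms, of x i "x i"]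
  unfolding pd_def by (simp add: DERIV_deriv_iff_real_differentiable)

lemma pd_eqI:
  assumes "((\<lambda>t. f (x(i := t))) has_real_derivative D) (at (x i))"
  shows "pd i f x = D"
  unfolding pd_def using assms by (rule DERIV_imp_deriv)

lemma pd_add: "pol f \<Longrightarrow> pol g \<Longrightarrow> pd i (\<lambda>x. f x + g x) = (\<lambda>x. pd i f x + pd i g x)"
  by (intro ext pd_eqI) (auto intro!: derivative_eq_intros pol_has_pd)

lemma pd_mult: "pol f \<Longrightarrow> pol g \<Longrightarrow> pd i (\<lambda>x. f x * g x) = (\<lambda>x. pd i f x * g x + f x * pd i g x)"
  by (intro ext pd_eqI) (auto intro!: derivative_eq_intros pol_has_pd)

lemma pd_const: "pd i (\<lambda>x. c) = (\<lambda>x. 0)"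
  by (intro ext pd_eqI) auto

lemma pd_scale: "pol f \<Longrightarrow> pd i (\<lambda>x. c * f x) = (\<lambda>x. c * pd i f x)"
  using pd_mult[OF pol_const, of f i c] by (simp add: pd_const)

lemma pd_var: "pd i (\<lambda>x. x j) = (\<lambda>x. if i = j then 1 else 0)"
  by (intro ext pd_eqI) auto

lemma pd_indep:
  assumes "\<And>x t. f (x(i := t)) = f x"
  shows "pd i f = (\<lambda>x. 0)"
  by (intro ext pd_eqI) (simp add: assms)

lemma hp_indep:
  assumes "f \<in> hp C D" "\<And>i. i \<in> C \<Longrightarrow> x i = y i"
  shows "f x = f y"
  using assms(1)
proof induction
  case (step f a c)
  have "mon C a x = mon C a y" unfolding mon_def using assms(2) by auto
  then show ?case using step by simp
qed simp

lemma pd_hp_indep: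
  assumes "f \<in> hp C D" "i \<notin> C"
  shows "pd i f = (\<lambda>x. 0)"
  by (rule pd_indep) (auto intro!: hp_indep[OF assms(1)] simp: assms(2))

lemma pd_power_var: "pd i (\<lambda>x. x i ^ k) = (\<lambda>x. real k * x i ^ (k - 1))"
  by (intro ext pd_eqI) (auto intro!: derivative_eq_intros)

lemma mon_split:
  assumes "finite C" "i \<in> C"
  shows "mon C a x = x i ^ a i * mon (C - {i}) a x"
  unfolding mon_def using assms by (rule prod.remove)

lemma pd_mon:
  assumes "finite C" "i \<in> C"
  shows "pd i (mon C a) = (\<lambda>x. real (a i) * mon C (a(i := a i - 1)) x)"
proof -
  have e: "mon (C - {i}) (a(i := a i - 1)) x = mon (C - {i}) a x" for x
    unfolding mon_def by (rule prod.cong) auto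
  have z: "pd i (mon (C - {i}) a) = (\<lambda>x. 0)"
    by (rule pd_indep) (auto simp: mon_def intro!: prod.cong)
  have "mon C a = (\<lambda>x. x i ^ a i * mon (C - {i}) a x)"
    using mon_split[OF assms] by auto
  then have "pd i (mon C a) = (\<lambda>x. real (a i) * x i ^ (a i - 1) * mon (C - {i}) a x)"
    by (simp add: pd_mult pol_power pol_var pol_mon pd_power_var z)
  then show ?thesis
    using mon_split[OF assms, of "a(i := a i - 1)"] e by (auto simp: mult.assoc)
qed

lemma hp_pd:
  assumes "f \<in> hp C D" "finite C" "\<And>n. n \<in> D \<Longrightarrow> n \<ge> 1 \<Longrightarrow> n - 1 \<in> E"
  shows "pd i f \<in> hp C E"
proof (cases "i \<in> C")
  case False
  then show ?thesis using pd_hp_indep[OF assms(1)] by (simp add: hp.zero)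
next
  case True
  from assms(1) show ?thesis
  proof induction
    case zero
    then show ?case by (simp add: pd_const hp.zero)
  next
    case (step f a c)
    have eq: "pd i (\<lambda>x. f x + c * mon C a x)
        = (\<lambda>x. pd i f x + (c * real (a i)) * mon C (a(i := a i - 1)) x)"
      by (simp add: pd_add hp_imp_pol[OF step(1)] pol_intros pol_mon pd_scale
          pd_mon[OF assms(2) True] mult.assoc)
    show ?case
    proof (cases "a i = 0")
      case True
      then show ?thesis using step(3) eq by simp
    next
      case False
      have "sum a C = a i + sum a (C - {i})"
        using assms(2) True by (simp add: sum.remove)
      moreover have "sum (a(i := a i - 1)) C = (a i - 1) + sum a (C - {i})"
        using assms(2) True by (simp add: sum.remove)
      ultimately have "sum (a(i := a i - 1)) C \<in> E"
        using assms(3)[OF step(2)] False by (simp add: numeral_2_eq_2 algebra_simps)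
      from hp.step[OF step(3) this] show ?thesis unfolding eq .
    qed
  qed
qed

lemma pol_pd: "pol f \<Longrightarrow> pol (pd i f)"
  using pol_imp_hp[of f] hp_pd[of f _ UNIV UNIV] hp_imp_pol by blast

lemmas pol_simps = pol_intros pol_mon pol_pd

text \<open>The derivative along the edge from vertex r to vertex i. By the chain rule
  \<open>pd i\<close> turns into it, with \<open>r = d + 1\<close>, under the barycentric
  substitution (\<open>pd_xx\<close>); other values of r occur in the Rodrigues formulas.\<close>

definition Dd :: "nat \<Rightarrow> nat \<Rightarrow> fn \<Rightarrow> fn" where
  "Dd r i f = (\<lambda>x. pd i f x - pd r f x)"

lemma pol_Dd: "pol f \<Longrightarrow> pol (Dd r i f)"
  unfolding Dd_def by (intro pol_diff pol_pd)

lemma Dd_add: "pol f \<Longrightarrow> pol g \<Longrightarrow> Dd r i (\<lambda>x. f x + g x) = (\<lambda>x. Dd r i f x + Dd r i g x)"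
  unfolding Dd_def by (simp add: pd_add algebra_simps)

lemma Dd_mult: "pol f \<Longrightarrow> pol g \<Longrightarrow> Dd r i (\<lambda>x. f x * g x) = (\<lambda>x. Dd r i f x * g x + f x * Dd r i g x)"
  unfolding Dd_def by (simp add: pd_mult algebra_simps)

lemma Dd_scale: "pol f \<Longrightarrow> Dd r i (\<lambda>x. c * f x) = (\<lambda>x. c * Dd r i f x)"
  unfolding Dd_def by (simp add: pd_scale algebra_simps)

lemma Dd_const: "Dd r i (\<lambda>x. c) = (\<lambda>x. 0)"
  unfolding Dd_def by (simp add: pd_const)

lemma hp_Dd:
  assumes "f \<in> hp C D" "finite C" "\<And>n. n \<in> D \<Longrightarrow> n \<ge> 1 \<Longrightarrow> n - 1 \<in> E"
  shows "Dd r i f \<in> hp C E"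
  unfolding Dd_def by (intro hp_diff hp_pd[OF assms])

lemma xx_upd:
  assumes "i \<in> {1..d}"
  shows "xx d (x(i := t)) j = xx d x j + (if j = i then t - x i else if j = d + 1 then x i - t else 0)"
proof (cases "j = d + 1")
  case True
  have "sum (x(i := t)) {1..d} = t + sum x ({1..d} - {i})"
    using assms by (simp add: sum.remove)
  moreover have "sum x {1..d} = x i + sum x ({1..d} - {i})"
    using assms by (simp add: sum.remove)
  ultimately show ?thesis using True assms by (simp add: xx_def)
qed (auto simp: xx_def)

lemma pol_chain:
  assumes "pol F" "i \<in> {1..d}"
  shows "((\<lambda>t. F (xx d (x(i := t)))) has_real_derivative Dd (d + 1) i F (xx d x)) (at (x i))"
  using assms(1)
proof induction
  case (pol_const c)
  then show ?case by (simp add: Dd_const)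
next
  case (pol_var j)
  show ?case unfolding xx_upd[OF assms(2)] Dd_def pd_var
    using assms(2) by (auto intro!: derivative_eq_intros)
next
  case (pol_add f g)
  then show ?case by (auto intro!: derivative_eq_intros simp: Dd_add)
next
  case (pol_mult f g)
  have "xx d (x(i := x i)) = xx d x" by simp
  then show ?case using DERIV_mult[OF pol_mult(3,4)]
    by (simp add: Dd_mult[OF pol_mult(1,2)] add.commute mult.commute del: fun_upd_apply)
qed

lemma pd_xx:
  assumes "pol F" "i \<in> {1..d}"
  shows "pd i (\<lambda>x. F (xx d x)) = (\<lambda>x. Dd (d + 1) i F (xx d x))"
  by (intro ext pd_eqI pol_chain assms)

lemma pol_foldr_Dd: "pol F \<Longrightarrow> pol (foldr (Dd r) is F)"
  by (induction "is") (auto intro: pol_Dd)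

lemma foldr_pd_xx:
  assumes "pol F" "set is \<subseteq> {1..d}"
  shows "foldr pd is (\<lambda>x. F (xx d x)) = (\<lambda>x. foldr (Dd (d + 1)) is F (xx d x))"
  using assms(2) by (induction "is") (auto simp: pd_xx pol_foldr_Dd assms(1))

section \<open>Restriction to faces\<close>

definition res :: "nat set \<Rightarrow> pt \<Rightarrow> pt" where
  "res C x = (\<lambda>i. if i \<in> C then x i else 0)"

lemma res_res: "res C (res C' x) = res (C \<inter> C') x"
  by (auto simp: res_def)

lemma mon_res:
  assumes "finite V" "finite C"
  shows "(\<exists>i\<in>V - C. a i > 0) \<and> mon V a (res C x) = 0 \<or>
    (\<forall>i\<in>V - C. a i = 0) \<and> mon V a (res C x) = mon C (\<lambda>i. if i \<in> V then a i else 0) x \<and>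
      sum (\<lambda>i. if i \<in> V then a i else 0) C = sum a V"
proof (cases "\<exists>i\<in>V - C. a i > 0")
  case True
  then show ?thesis using assms(1) by (auto simp: mon_def res_def)
next
  case False
  then have *: "\<forall>i\<in>V - C. a i = 0" by auto
  have "mon V a (res C x) = (\<Prod>i\<in>V \<inter> C. res C x i ^ a i)"
    unfolding mon_def by (rule prod.mono_neutral_right) (use assms * in auto)
  also have "\<dots> = (\<Prod>i\<in>V \<inter> C. x i ^ (if i \<in> V then a i else 0))"
    by (rule prod.cong) (auto simp: res_def)
  also have "\<dots> = mon C (\<lambda>i. if i \<in> V then a i else 0) x"
    unfolding mon_def by (rule prod.mono_neutral_left) (use assms in auto)
  finally have 1: "mon V a (res C x) = mon C (\<lambda>i. if i \<in> V then a i else 0) x" .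
  have "sum a V = sum a (V \<inter> C)"
    by (rule sum.mono_neutral_right) (use assms * in auto)
  also have "\<dots> = sum (\<lambda>i. if i \<in> V then a i else 0) C"
    using assms by (simp add: sum.If_cases Int_commute)
  finally show ?thesis using * 1 by simp
qed

lemma hp_res:
  assumes "f \<in> hp V D" "finite V" "finite C"
  shows "(\<lambda>x. f (res C x)) \<in> hp C D"
  using assms(1)
proof induction
  case zero
  then show ?case by (simp add: hp.zero)
next
  case (step f a c)
  show ?case
  proof (cases "\<exists>i\<in>V - C. a i > 0")
    case True
    then have "mon V a (res C x) = 0" for x
      using mon_res[OF assms(2,3), of a x] by (metis less_irrefl)
    then show ?thesis using step by simp
  next
    case False
    then have "mon V a (res C x) = mon C (\<lambda>i. if i \<in> V then a i else 0) x \<and>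
      sum (\<lambda>i. if i \<in> V then a i else 0) C = sum a V" for x
      using mon_res[OF assms(2,3), of a x] by auto
    then show ?thesis
      using hp.step[OF step(3), of "\<lambda>i. if i \<in> V then a i else 0" c] step(2) by simp
  qed
qed

lemma hp_res_same:
  assumes "f \<in> hp C D"
  shows "f (res C x) = f x"
  by (rule hp_indep[OF assms]) (simp add: res_def)

lemma pol_res:
  assumes "pol f"
  shows "pol (\<lambda>x. f (res C x))"
  using assms
proof induction
  case (pol_var i)
  show ?case unfolding res_def by (cases "i \<in> C") (auto intro: pol_intros)
qed (auto intro: pol_intros)

lemma pd_res:
  assumes "i \<in> C"
  shows "pd i (\<lambda>x. f (res C x)) = (\<lambda>x. pd i f (res C x))"
proof
  fix x
  have "res C (x(i := t)) = (res C x)(i := t)" for t using assms by (auto simp: res_def)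
  then show "pd i (\<lambda>x. f (res C x)) x = pd i f (res C x)"
    using assms by (simp add: pd_def res_def)
qed

lemma Dd_res:
  assumes "i \<in> C" "r \<in> C"
  shows "Dd r i (\<lambda>x. f (res C x)) = (\<lambda>x. Dd r i f (res C x))"
  unfolding Dd_def using assms by (simp add: pd_res)

lemma foldr_Dd_res:
  assumes "set is \<subseteq> C" "r \<in> C"
  shows "foldr (Dd r) is (\<lambda>x. f (res C x)) = (\<lambda>x. foldr (Dd r) is f (res C x))"
  using assms(1) by (induction "is") (auto simp: Dd_res assms(2))

section \<open>Criteria for a polynomial to vanish\<close>

lemma pol_poly:
  assumes "pol f"
  shows "\<exists>p. \<forall>t::real. f (x(i := t)) = poly p t"
  using assms
proof induction
  case (pol_const c)
  then show ?case by (intro exI[of _ "[:c:]"]) simp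
next
  case (pol_var j)
  show ?case
    by (cases "i = j"; intro exI[of _ "if i = j then [:0, 1:] else [:x j:]"]) auto
next
  case (pol_add f g)
  then obtain p q where "\<forall>t. f (x(i := t)) = poly p t" "\<forall>t. g (x(i := t)) = poly q t" by blast
  then show ?case by (intro exI[of _ "p + q"]) (simp del: fun_upd_apply)
next
  case (pol_mult f g)
  then obtain p q where "\<forall>t. f (x(i := t)) = poly p t" "\<forall>t. g (x(i := t)) = poly q t" by blast
  then show ?case by (intro exI[of _ "p * q"]) (simp del: fun_upd_apply)
qed

lemma pol_zero_positive:
  assumes "f \<in> hp C D" "finite C" "\<And>x. (\<forall>i\<in>C. x i > 0) \<Longrightarrow> f x = 0"
  shows "f = (\<lambda>x. 0)"
proof -
  \<comment> \<open>E collects the variables already freed from the positivity constraint. Freeing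
    one more is the fact that a polynomial in one variable with infinitely many zeros is
    zero.\<close>
  have "\<forall>x. (\<forall>i\<in>C - E. x i > 0) \<longrightarrow> f x = 0" if "finite E" for E
    using that
  proof induction
    case empty
    then show ?case using assms by simp
  next
    case (insert i E)
    show ?case
    proof (intro allI impI)
      fix x :: pt assume x: "\<forall>j\<in>C - insert i E. x j > 0"
      obtain p where p: "\<And>t::real. f (x(i := t)) = poly p t"
        using pol_poly[OF hp_imp_pol[OF assms(1)]] by blast
      have "{0<..} \<subseteq> {t. poly p t = 0}"
      proof
        fix t :: real assume "t \<in> {0<..}"
        then have "f (x(i := t)) = 0" using x insert by auto
        then show "t \<in> {t. poly p t = 0}" using p by simp
      qed
      then have "p = 0"
        using poly_roots_finite[of p] infinite_Ioi[of "0::real"] finite_subset by blast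
      with p[of "x i"] show "f x = 0" by simp
    qed
  qed
  from this[OF assms(2)] show ?thesis by auto
qed

lemma hp_homogeneous:
  assumes "f \<in> hp C {n}"
  shows "f (\<lambda>i. t * x i) = t ^ n * f x"
  using assms
proof induction
  case (step f a c)
  have "mon C a (\<lambda>i. t * x i) = t ^ n * mon C a x"
    using step(2) by (auto simp: mon_def power_mult_distrib prod.distrib power_sum)
  then show ?case using step by (simp add: algebra_simps)
qed simp

lemma sum_xx: "(\<Sum>i\<in>{1..d+1}. xx d x i) = 1"
proof -
  have "(\<Sum>i\<in>{1..d}. xx d x i) = (\<Sum>i\<in>{1..d}. x i)"
    by (rule sum.cong) (auto simp: xx_def)
  then show ?thesis by (simp add: xx_def)
qed

text \<open>Every point with positive coordinates is a positive multiple of the barycentric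
  coordinates of an interior point of the simplex, and homogeneity carries the zero along the
  ray.\<close>

lemma hp_xx_zero:
  assumes "f \<in> hp {1..d+1} {n}" "\<And>x. x \<in> tsimplex_int d \<Longrightarrow> f (xx d x) = 0"
  shows "f = (\<lambda>x. 0)"
proof (rule pol_zero_positive[OF assms(1)])
  fix x :: pt assume x: "\<forall>i\<in>{1..d+1}. x i > 0"
  define s where "s = (\<Sum>i\<in>{1..d+1}. x i)"
  have s: "s > 0" unfolding s_def by (rule sum_pos) (use x in auto)
  define y where "y = (\<lambda>i. x i / s)"
  have "(\<Sum>i\<in>{1..d}. y i) = (s - x (d+1)) / s"
    by (simp add: y_def s_def sum_divide_distrib)
  then have y1: "(\<Sum>i\<in>{1..d}. y i) = 1 - x (d+1) / s" using s by (simp add: field_simps)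
  have "y \<in> tsimplex_int d" unfolding tsimplex_int_def
    using x s y1 by (auto simp: y_def)
  then have "f (xx d y) = 0" by (rule assms(2))
  moreover have "f x = f (\<lambda>i. s * xx d y i)"
    by (rule hp_indep[OF assms(1)]) (use s y1 in \<open>auto simp: xx_def y_def\<close>)
  ultimately show "f x = 0" by (simp add: hp_homogeneous[OF assms(1)])
qed simp

section \<open>Polynomials of bounded degree as homogeneous polynomials in barycentric
  coordinates\<close>

lemma finite_mindex: "finite (mindex d m)"
proof -
  have "mindex d m \<subseteq> {f. \<forall>x. (x \<in> {1..d} \<longrightarrow> f x \<in> {0..m}) \<and> (x \<notin> {1..d} \<longrightarrow> f x = 0)}"
  proof (intro subsetI CollectI allI conjI impI)
    fix a i assume a: "a \<in> mindex d m" and i: "i \<in> {1..d}"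
    have "a i \<le> sum a {1..d}" using i by (simp add: member_le_sum)
    then show "a i \<in> {0..m}" using a by (simp add: mindex_def)
  qed (auto simp: mindex_def)
  moreover have "finite \<dots>" by (rule finite_set_of_finite_funs) auto
  ultimately show ?thesis by (rule finite_subset)
qed

lemma polys_deg_eq_hp: "polys_deg d (int n) = hp {1..d} {..n}"
proof
  show "polys_deg d (int n) \<subseteq> hp {1..d} {..n}"
  proof
    fix f assume "f \<in> polys_deg d (int n)"
    then obtain c where f: "f = (\<lambda>x. \<Sum>\<alpha>\<in>mindex d n. c \<alpha> * mon {1..d} \<alpha> x)"
      by (auto simp: polys_deg_def mon_def)
    show "f \<in> hp {1..d} {..n}" unfolding f
      by (intro hp_sum hp_monomial) (auto simp: mindex_def)
  qed
  show "hp {1..d} {..n} \<subseteq> polys_deg d (int n)"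
  proof
    fix f assume "f \<in> hp {1..d} {..n}"
    then show "f \<in> polys_deg d (int n)"
    proof induction
      case zero
      show ?case by (auto simp: polys_deg_def intro!: exI[of _ "\<lambda>_. 0"])
    next
      case (step f a k)
      then obtain c where f: "f = (\<lambda>x. \<Sum>\<alpha>\<in>mindex d n. c \<alpha> * mon {1..d} \<alpha> x)"
        by (auto simp: polys_deg_def mon_def)
      define b where "b = (\<lambda>i. if i \<in> {1..d} then a i else 0)"
      have b: "b \<in> mindex d n" using step(2) by (auto simp: mindex_def b_def)
      have ab: "mon {1..d} a = mon {1..d} b" by (auto simp: mon_def b_def)
      have "(\<lambda>x. f x + k * mon {1..d} a x) =
         (\<lambda>x. \<Sum>\<alpha>\<in>mindex d n. (c(b := c b + k)) \<alpha> * mon {1..d} \<alpha> x)"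
      proof
        fix x
        have "(\<Sum>\<alpha>\<in>mindex d n. (c(b := c b + k)) \<alpha> * mon {1..d} \<alpha> x) =
          (\<Sum>\<alpha>\<in>mindex d n. c \<alpha> * mon {1..d} \<alpha> x + (if \<alpha> = b then k * mon {1..d} \<alpha> x else 0))"
          by (rule sum.cong) (auto simp: algebra_simps)
        also have "\<dots> = f x + k * mon {1..d} b x"
          using b finite_mindex by (simp add: sum.distrib f sum.delta)
        finally show "f x + k * mon {1..d} a x =
          (\<Sum>\<alpha>\<in>mindex d n. (c(b := c b + k)) \<alpha> * mon {1..d} \<alpha> x)" by (simp only: ab)
      qed
      then show ?case unfolding polys_deg_def mon_def by auto
    qed
  qed
qed

lemma hp_sum_vars: "finite C \<Longrightarrow> (\<lambda>x. \<Sum>i\<in>C. x i) \<in> hp C {1}"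
  by (intro hp_sum hp_var) auto

lemma hp_pow_sum_vars: "finite C \<Longrightarrow> (\<lambda>x. (\<Sum>i\<in>C. x i) ^ k) \<in> hp C {k}"
  using hp_power[OF hp_sum_vars, of C k] by simp

text \<open>The barycentric coordinates sum to 1, so multiplying by powers of their sum homogenizes.\<close>

lemma polys_deg_eq_xx: "polys_deg d (int n) = (\<lambda>P x. P (xx d x)) ` hp {1..d+1} {n}"
proof
  show "polys_deg d (int n) \<subseteq> (\<lambda>P x. P (xx d x)) ` hp {1..d+1} {n}"
    unfolding polys_deg_eq_hp
  proof
    fix f assume "f \<in> hp {1..d} {..n}"
    then show "f \<in> (\<lambda>P x. P (xx d x)) ` hp {1..d+1} {n}"
    proof induction
      case zero
      show ?case by (rule image_eqI[OF _ hp.zero]) simp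
    next
      case (step f a c)
      then obtain P where P: "P \<in> hp {1..d+1} {n}" "f = (\<lambda>x. P (xx d x))" by auto
      define Q where "Q = (\<lambda>x. mon {1..d} a x * (\<Sum>i\<in>{1..d+1}. x i) ^ (n - sum a {1..d}))"
      have 1: "mon {1..d} a \<in> hp {1..d+1} {sum a {1..d}}"
        using hp_superset[OF hp_monomial[of a "{1..d}" "{sum a {1..d}}" 1], of "{1..d+1}"] by simp
      have "Q \<in> hp {1..d+1} {n}" unfolding Q_def
        by (rule hp_mult[OF 1 hp_pow_sum_vars]) (use step(2) in auto)
      moreover have "Q (xx d x) = mon {1..d} a x" for x
        unfolding Q_def sum_xx by (auto simp: mon_def xx_def intro!: prod.cong)
      ultimately show ?case
        by (intro image_eqI[OF _ hp_add[OF P(1) hp_scale[of Q _ _ c]]]) (auto simp: P(2))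
    qed
  qed
  show "(\<lambda>P x. P (xx d x)) ` hp {1..d+1} {n} \<subseteq> polys_deg d (int n)"
    unfolding polys_deg_eq_hp
  proof safe
    fix P assume "P \<in> hp {1..d+1} {n}"
    then show "(\<lambda>x. P (xx d x)) \<in> hp {1..d} {..n}"
    proof induction
      case zero
      show ?case by (rule hp.zero)
    next
      case (step f a c)
      have lin: "(\<lambda>x. 1 - (\<Sum>j\<in>{1..d}. x j)) \<in> hp {1..d} {..1}"
        by (intro hp_diff hp_const hp_mono[OF hp_sum_vars]) auto
      have pw: "(\<lambda>x. (1 - (\<Sum>j\<in>{1..d}. x j)) ^ k) \<in> hp {1..d} {..k}" for k
      proof (induction k)
        case (Suc k)
        have "(\<lambda>x. (1 - (\<Sum>j\<in>{1..d}. x j)) * (1 - (\<Sum>j\<in>{1..d}. x j)) ^ k) \<in> hp {1..d} {..Suc k}"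
          by (rule hp_mult[OF lin Suc]) auto
        then show ?case by simp
      qed (simp add: hp_const)
      have m: "mon {1..d} a \<in> hp {1..d} {sum a {1..d}}"
        using hp_monomial[of a "{1..d}" "{sum a {1..d}}" 1] by simp
      have "(\<lambda>x. mon {1..d} a x * (1 - (\<Sum>j\<in>{1..d}. x j)) ^ a (d+1)) \<in> hp {1..d} {..n}"
        by (rule hp_mult[OF m pw]) (use step(2) in auto)
      moreover have "mon {1..d+1} a (xx d x) = mon {1..d} a x * (1 - (\<Sum>j\<in>{1..d}. x j)) ^ a (d+1)" for x
      proof -
        have "(\<Prod>i\<in>{1..d}. xx d x i ^ a i) = (\<Prod>i\<in>{1..d}. x i ^ a i)"
          by (rule prod.cong) (auto simp: xx_def)
        then show ?thesis by (simp add: mon_def xx_def)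
      qed
      ultimately show ?case using hp_add[OF step(3) hp_scale[of _ _ _ c]] by simp
    qed
  qed
qed

lemma polys_deg_iff: "f \<in> polys_deg d (int n) \<longleftrightarrow> (\<exists>P\<in>hp {1..d+1} {n}. f = (\<lambda>x. P (xx d x)))"
  unfolding polys_deg_eq_xx by auto

lemma polys_deg_neg: "m < 0 \<Longrightarrow> polys_deg d m = {\<lambda>x. 0}"
  by (simp add: polys_deg_def)

section \<open>The Laguerre functional and Dirichlet integrals\<close>

definition gwt :: "nat set \<Rightarrow> (nat \<Rightarrow> real) \<Rightarrow> pt \<Rightarrow> real" where
  "gwt C e y = (\<Prod>i\<in>C. indicator {0..} (y i) * y i powr e i / exp (y i))"

text \<open>On homogeneous polynomials this is a Gamma factor times the Dirichlet integral
  over the simplex with vertices indexed by C.\<close>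

definition Lag :: "nat set \<Rightarrow> (nat \<Rightarrow> real) \<Rightarrow> fn \<Rightarrow> real" where
  "Lag C e f = (LINT y|PiM C (\<lambda>_. lborel). f (res C y) * gwt C e y)"

lemma product_sigma_finite_lborel: "product_sigma_finite (\<lambda>_::nat. lborel :: real measure)"
  by (rule product_sigma_finite.intro) (rule lborel.sigma_finite_measure_axioms)

interpretation psf: product_sigma_finite "\<lambda>_::nat. lborel :: real measure"
  by (rule product_sigma_finite_lborel)

lemma Gamma_weight_integral:
  assumes "s > (0::real)"
  shows "integrable lborel (\<lambda>t. indicator {0..} t * t powr (s - 1) / exp t)"
    and "(LINT t|lborel. indicator {0..} t * t powr (s - 1) / exp t) = Gamma s"
proof -
  have "(\<integral>\<^sup>+ t. ennreal (indicator {0..} t * t powr (s - 1) / exp t) \<partial>lborel) = ennreal (Gamma s)"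
    using Gamma_conv_nn_integral_real[OF assms] by simp
  moreover have "(\<lambda>t::real. indicator {0..} t * t powr (s - 1) / exp t) \<in> borel_measurable lborel"
    by measurable
  moreover have "AE t in lborel. 0 \<le> indicator {0..} t * t powr (s - 1) / exp t"
    by (intro AE_I2) (auto simp: indicator_def)
  ultimately have "integrable lborel (\<lambda>t. indicator {0..} t * t powr (s - 1) / exp t) \<and>
      (LINT t|lborel. indicator {0..} t * t powr (s - 1) / exp t) = Gamma s"
    using nn_integral_eq_integrable[of "\<lambda>t. indicator {0..} t * t powr (s - 1) / exp t" lborel "Gamma s"]
      Gamma_real_pos[OF assms] by auto
  then show "integrable lborel (\<lambda>t. indicator {0..} t * t powr (s - 1) / exp t)"
    "(LINT t|lborel. indicator {0..} t * t powr (s - 1) / exp t) = Gamma s" by auto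
qed

text \<open>Also correct at \<open>t = 0\<close>, where \<open>0 powr a = 0\<close> for every a
  makes both sides vanish, even for \<open>n = 0\<close>.\<close>

lemma pow_powr:
  fixes t :: real
  assumes "t \<ge> 0"
  shows "t ^ n * t powr s = t powr (real n + s)"
  using assms by (cases "t = 0") (auto simp: powr_add powr_realpow)

lemma mon_gwt:
  assumes "finite C"
  shows "mon C a y * gwt C e y =
    (\<Prod>i\<in>C. indicator {0..} (y i) * y i powr (real (a i) + e i + 1 - 1) / exp (y i))"
proof -
  have "mon C a y * gwt C e y = (\<Prod>i\<in>C. y i ^ a i * (indicator {0..} (y i) * y i powr e i / exp (y i)))"
    by (simp only: mon_def gwt_def prod.distrib)
  also have "\<dots> = (\<Prod>i\<in>C. indicator {0..} (y i) * y i powr (real (a i) + e i + 1 - 1) / exp (y i))"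
    by (rule prod.cong) (auto simp: indicator_def pow_powr)
  finally show ?thesis .
qed

lemma mon_gwt_integral:
  assumes "finite C" "\<forall>i\<in>C. e i > -1"
  shows "integrable (PiM C (\<lambda>_. lborel)) (\<lambda>y. mon C a y * gwt C e y)"
    and "(LINT y|PiM C (\<lambda>_. lborel). mon C a y * gwt C e y) = (\<Prod>i\<in>C. Gamma (real (a i) + e i + 1))"
proof -
  let ?f = "\<lambda>i t. indicator {0..} t * t powr (real (a i) + e i + 1 - 1) / exp t :: real"
  have i: "integrable lborel (?f i)" if "i \<in> C" for i
    by (rule Gamma_weight_integral) (use assms(2) that in force)
  show "integrable (PiM C (\<lambda>_. lborel)) (\<lambda>y. mon C a y * gwt C e y)"
    unfolding mon_gwt[OF assms(1)]
    by (rule psf.product_integrable_prod[OF assms(1), of ?f]) (rule i)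
  have "(LINT y|PiM C (\<lambda>_. lborel). mon C a y * gwt C e y) = (\<Prod>i\<in>C. integral\<^sup>L lborel (?f i))"
    unfolding mon_gwt[OF assms(1)]
    by (rule psf.product_integral_prod[OF assms(1), of ?f]) (rule i)
  also have "\<dots> = (\<Prod>i\<in>C. Gamma (real (a i) + e i + 1))"
    by (rule prod.cong[OF refl], rule Gamma_weight_integral) (use assms(2) in force)
  finally show "(LINT y|PiM C (\<lambda>_. lborel). mon C a y * gwt C e y) = (\<Prod>i\<in>C. Gamma (real (a i) + e i + 1))" .
qed

lemma hp_gwt_integrable:
  assumes "finite C" "\<forall>i\<in>C. e i > -1" "f \<in> hp C D"
  shows "integrable (PiM C (\<lambda>_. lborel)) (\<lambda>y. f y * gwt C e y)"
  using assms(3)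
proof induction
  case (step f a c)
  have "integrable (PiM C (\<lambda>_. lborel)) (\<lambda>y. f y * gwt C e y + c * (mon C a y * gwt C e y))"
    by (intro Bochner_Integration.integrable_add step integrable_mult_right mon_gwt_integral assms)
  then show ?case by (simp add: algebra_simps)
qed simp

lemma pol_res_hp:
  assumes "pol f" "finite C"
  shows "(\<lambda>x. f (res C x)) \<in> hp C UNIV"
  using pol_imp_hp[OF assms(1)] hp_res assms(2) by blast

lemma Lag_integrable:
  assumes "finite C" "\<forall>i\<in>C. e i > -1" "pol f"
  shows "integrable (PiM C (\<lambda>_. lborel)) (\<lambda>y. f (res C y) * gwt C e y)"
  by (rule hp_gwt_integrable[OF assms(1,2) pol_res_hp[OF assms(3,1)]])

lemma Lag_cong: "(\<And>x. f (res C x) = g (res C x)) \<Longrightarrow> Lag C e f = Lag C e g"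
  by (simp add: Lag_def)

lemma Lag_cong_exp: "(\<And>i. i \<in> C \<Longrightarrow> e i = e' i) \<Longrightarrow> Lag C e f = Lag C e' f"
  unfolding Lag_def gwt_def by (simp cong: prod.cong)

lemma Lag_res: "Lag C e (\<lambda>x. f (res C x)) = Lag C e f"
  by (rule Lag_cong) (simp add: res_res)

lemma Lag_zero: "Lag C e (\<lambda>x. 0) = 0"
  by (simp add: Lag_def)

lemma Lag_scale: "Lag C e (\<lambda>x. c * f x) = c * Lag C e f"
  by (simp add: Lag_def mult.assoc)

lemma Lag_uminus: "Lag C e (\<lambda>x. - f x) = - Lag C e f"
  using Lag_scale[of C e "-1" f] by simp

lemma Lag_add:
  assumes "finite C" "\<forall>i\<in>C. e i > -1" "pol f" "pol g"
  shows "Lag C e (\<lambda>x. f x + g x) = Lag C e f + Lag C e g"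
  using Lag_integrable[OF assms(1,2,3)] Lag_integrable[OF assms(1,2,4)]
  by (simp add: Lag_def distrib_right)

lemma Lag_diff:
  assumes "finite C" "\<forall>i\<in>C. e i > -1" "pol f" "pol g"
  shows "Lag C e (\<lambda>x. f x - g x) = Lag C e f - Lag C e g"
  using Lag_integrable[OF assms(1,2,3)] Lag_integrable[OF assms(1,2,4)]
  by (simp add: Lag_def left_diff_distrib)

lemma Lag_sum:
  assumes "finite C" "\<forall>i\<in>C. e i > -1" "\<And>s. s \<in> S \<Longrightarrow> pol (f s)"
  shows "Lag C e (\<lambda>x. \<Sum>s\<in>S. f s x) = (\<Sum>s\<in>S. Lag C e (f s))"
  using assms(3)
  by (induction S rule: infinite_finite_induct) (simp_all add: Lag_zero Lag_add[OF assms(1,2)] pol_sum)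

lemma mon_res_same: "mon C a (res C x) = mon C a x"
  by (simp add: mon_def res_def cong: prod.cong)

lemma Lag_mon:
  assumes "finite C" "\<forall>i\<in>C. e i > -1"
  shows "Lag C e (mon C a) = (\<Prod>i\<in>C. Gamma (real (a i) + e i + 1))"
  unfolding Lag_def mon_res_same by (rule mon_gwt_integral[OF assms])

text \<open>The functional equation of the Gamma function; every integration by parts below reduces
  to it.\<close>

lemma Lag_var_mon:
  assumes "finite C" "\<forall>i\<in>C. e i > -1" "i \<in> C"
  shows "Lag C e (\<lambda>x. x i * mon C a x) = (real (a i) + e i + 1) * Lag C e (mon C a)"
proof -
  have "(\<lambda>x. x i * mon C a x) = mon C (a(i := a i + 1))"
  proof
    fix x :: pt
    have "mon (C - {i}) (a(i := a i + 1)) x = mon (C - {i}) a x"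
      unfolding mon_def by (rule prod.cong) auto
    then show "x i * mon C a x = mon C (a(i := a i + 1)) x"
      using mon_split[OF assms(1,3)] by simp
  qed
  moreover have "(\<Prod>j\<in>C - {i}. Gamma (real ((a(i := a i + 1)) j) + e j + 1)) =
      (\<Prod>j\<in>C - {i}. Gamma (real (a j) + e j + 1))"
    by (rule prod.cong) auto
  moreover have "Gamma (real (a i + 1) + e i + 1) = (real (a i) + e i + 1) * Gamma (real (a i) + e i + 1)"
    using Gamma_plus1[of "real (a i) + e i + 1"] assms(2,3) nonpos_Ints_nonpos
    by (force simp: algebra_simps)
  ultimately show ?thesis
    by (simp add: Lag_mon[OF assms(1,2)] prod.remove[OF assms(1,3)])
qed

text \<open>The logarithmic derivative of the weight is \<open>e i / x_i - 1\<close>, and the factor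
  x_i under the derivative removes the boundary term; this gives the multiplier
  \<open>x_i - e i\<close>. No boundary has to be discussed: on monomials the identity is
  \<open>Lag_var_mon\<close>.\<close>

lemma Lag_ibp:
  assumes "finite C" "\<forall>i\<in>C. e i > -1" "i \<in> C" "pol f"
  shows "Lag C e (pd i (\<lambda>x. x i * f x)) = Lag C e (\<lambda>x. (x i - e i) * f x)"
proof -
  have *: "Lag C e (pd i (\<lambda>x. x i * f x)) = Lag C e (\<lambda>x. (x i - e i) * f x)"
    if "f \<in> hp C UNIV" for f
    using that
  proof induction
    case zero
    then show ?case by (simp add: pd_const)
  next
    case (step f a c)
    have pf: "pol f" by (rule hp_imp_pol[OF step(1)])
    have 1: "pd i (\<lambda>x. x i * (f x + c * mon C a x)) =
        (\<lambda>x. pd i (\<lambda>x. x i * f x) x + c * ((real (a i) + 1) * mon C a x))"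
    proof -
      have "x i * mon C (a(i := a i - 1)) x = mon C a x" if "a i > 0" for x
      proof -
        have "mon (C - {i}) (a(i := a i - 1)) x = mon (C - {i}) a x"
          unfolding mon_def by (rule prod.cong) auto
        then show ?thesis using mon_split[OF assms(1,3)] that
          by (simp add: power_eq_if)
      qed
      then have k: "real (a i) * (x i * mon C (a(i := a i - 1)) x) = real (a i) * mon C a x" for x
        by (cases "a i > 0") auto
      have "pd i (\<lambda>x. x i * (f x + c * mon C a x)) = (\<lambda>x. (f x + c * mon C a x) +
          x i * (pd i f x + c * (real (a i) * mon C (a(i := a i - 1)) x)))"
        by (simp add: pd_mult pd_add pd_var pd_const pd_scale pd_mon[OF assms(1,3)] pf pol_simps)
      also have "\<dots> = (\<lambda>x. (f x + c * mon C a x) +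
          (x i * pd i f x + c * (real (a i) * (x i * mon C (a(i := a i - 1)) x))))"
        by (simp add: algebra_simps)
      also have "\<dots> = (\<lambda>x. pd i (\<lambda>x. x i * f x) x + c * ((real (a i) + 1) * mon C a x))"
        unfolding k by (simp add: pd_mult pd_var pf pol_simps algebra_simps)
      finally show ?thesis .
    qed
    have "Lag C e (\<lambda>x. (x i - e i) * (f x + c * mon C a x)) =
        Lag C e (\<lambda>x. (x i - e i) * f x + c * (x i * mon C a x - e i * mon C a x))"
      by (simp add: algebra_simps)
    also have "\<dots> = Lag C e (\<lambda>x. (x i - e i) * f x) + c * ((real (a i) + 1) * Lag C e (mon C a))"
      by (simp add: Lag_add[OF assms(1,2)] Lag_diff[OF assms(1,2)] Lag_scale pf pol_simps
          Lag_var_mon[OF assms(1-3)] algebra_simps)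
    finally show ?case unfolding 1
      by (simp add: Lag_add[OF assms(1,2)] Lag_scale pf pol_simps step(3))
  qed
  \<comment> \<open>So far f had only variables in C. A general f is replaced by its restriction,
    which commutes with \<open>pd i\<close> because i lies in C.\<close>
  let ?g = "\<lambda>x. f (res C x)"
  have "Lag C e (pd i (\<lambda>x. x i * f x)) = Lag C e (\<lambda>x. pd i (\<lambda>x. x i * f x) (res C x))"
    by (simp add: Lag_res)
  also have "\<dots> = Lag C e (pd i (\<lambda>x. (res C x) i * f (res C x)))"
    by (subst pd_res[OF assms(3), symmetric]) simp
  also have "\<dots> = Lag C e (pd i (\<lambda>x. x i * ?g x))"
    using assms(3) by (simp add: res_def)
  also have "\<dots> = Lag C e (\<lambda>x. (x i - e i) * ?g x)"
    by (rule *[OF pol_res_hp[OF assms(4,1)]])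
  also have "\<dots> = Lag C e (\<lambda>x. (x i - e i) * f x)"
    by (rule Lag_cong) (simp add: res_res)
  finally show ?thesis .
qed

lemma Lag_shift:
  assumes "finite C" "J \<subseteq> C"
  shows "Lag C e (\<lambda>x. (\<Prod>i\<in>J. x i) * f x) = Lag C (\<lambda>i. if i \<in> J then e i + 1 else e i) f"
proof -
  have J: "finite J" using assms finite_subset by blast
  have "(\<Prod>i\<in>J. y i) * gwt C e y = gwt C (\<lambda>i. if i \<in> J then e i + 1 else e i) y" for y
  proof -
    have "(\<Prod>i\<in>J. y i) = (\<Prod>i\<in>C. if i \<in> J then y i else 1)"
      using assms by (simp add: prod.If_cases Int_absorb1)
    then have "(\<Prod>i\<in>J. y i) * gwt C e y =
      (\<Prod>i\<in>C. (if i \<in> J then y i else 1) * (indicator {0..} (y i) * y i powr e i / exp (y i)))"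
      by (simp only: gwt_def prod.distrib)
    also have "\<dots> = gwt C (\<lambda>i. if i \<in> J then e i + 1 else e i) y"
      unfolding gwt_def
    proof (rule prod.cong[OF refl])
      fix i
      show "(if i \<in> J then y i else 1) * (indicator {0..} (y i) * y i powr e i / exp (y i)) =
        indicator {0..} (y i) * y i powr (if i \<in> J then e i + 1 else e i) / exp (y i)"
        using pow_powr[of "y i" 1 "e i"] by (auto simp: indicator_def add.commute)
    qed
    finally show ?thesis .
  qed
  moreover have "(\<Prod>i\<in>J. res C y i) = (\<Prod>i\<in>J. y i)" for y
    using assms by (intro prod.cong) (auto simp: res_def)
  ultimately show ?thesis
    unfolding Lag_def by (intro Bochner_Integration.integral_cong refl) (metis mult.assoc mult.commute)
qed

text \<open>The weight is a product over the variables, so on monomials \<open>Lag\<close> factors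
  along \<open>C'\<close> and \<open>C - C'\<close>. This transports orthogonality from a face to
  the larger faces containing it.\<close>

lemma Lag_extend:
  assumes "finite C" "\<forall>i\<in>C. e i > -1" "C' \<subseteq> C" "q \<in> hp C' D"
  shows "Lag C e (\<lambda>x. q x * mon (C - C') b x) = Lag C' e q * Lag (C - C') e (mon (C - C') b)"
  using assms(4)
proof induction
  case zero
  then show ?case by (simp add: Lag_zero)
next
  case (step f a c)
  have f: "finite C'" "finite (C - C')" "\<forall>i\<in>C'. e i > -1" "\<forall>i\<in>C-C'. e i > -1"
    using assms finite_subset by auto
  let ?a = "\<lambda>i. if i \<in> C' then a i else b i"
  have sp: "prod g C = prod g C' * prod g (C - C')" for g :: "nat \<Rightarrow> real"
    using assms(1,3) by (simp add: prod.subset_diff mult.commute)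
  have "mon C' a x * mon (C - C') b x = mon C ?a x" for x
    unfolding mon_def sp by (intro arg_cong2[of _ _ _ _ "(*)"] prod.cong) auto
  then have m: "Lag C e (\<lambda>x. mon C' a x * mon (C - C') b x) = Lag C' e (mon C' a) * Lag (C - C') e (mon (C - C') b)"
    unfolding Lag_mon[OF assms(1,2)] Lag_mon[OF f(1,3)] Lag_mon[OF f(2,4)] sp
    by (simp add: Lag_mon[OF assms(1,2)] sp)
  have "Lag C e (\<lambda>x. (f x + c * mon C' a x) * mon (C - C') b x) =
     Lag C e (\<lambda>x. f x * mon (C - C') b x + c * (mon C' a x * mon (C - C') b x))"
    by (simp add: algebra_simps)
  also have "\<dots> = Lag C e (\<lambda>x. f x * mon (C - C') b x) + c * Lag C e (\<lambda>x. mon C' a x * mon (C - C') b x)"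
    by (simp add: Lag_add[OF assms(1,2)] Lag_scale hp_imp_pol[OF step(1)] pol_simps)
  also have "\<dots> = Lag C' e (\<lambda>x. f x + c * mon C' a x) * Lag (C - C') e (mon (C - C') b)"
    by (simp add: Lag_add[OF f(1,3)] Lag_scale hp_imp_pol[OF step(1)] pol_simps m step(3) algebra_simps)
  finally show ?case .
qed

text \<open>By \<open>Lag_var_mon\<close> each variable contributes its exponent plus
  \<open>e i + 1\<close>, and the total depends only on the degree. Hence homogenization, that is
  multiplication by the sum of the variables, acts on \<open>Lag\<close> as a scalar in each
  degree.\<close>

lemma Lag_sum_vars:
  assumes "finite C" "\<forall>i\<in>C. e i > -1" "f \<in> hp C {n}"
  shows "Lag C e (\<lambda>x. (\<Sum>i\<in>C. x i) * f x) = (real n + (\<Sum>i\<in>C. e i + 1)) * Lag C e f"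
  using assms(3)
proof induction
  case zero
  then show ?case by (simp add: Lag_zero)
next
  case (step f a c)
  have pf: "pol f" by (rule hp_imp_pol[OF step(1)])
  have "Lag C e (\<lambda>x. (\<Sum>i\<in>C. x i) * mon C a x) = (\<Sum>i\<in>C. (real (a i) + e i + 1) * Lag C e (mon C a))"
    by (simp add: sum_distrib_right Lag_sum[OF assms(1,2)] pol_simps Lag_var_mon[OF assms(1,2)])
  also have "\<dots> = (real n + (\<Sum>i\<in>C. e i + 1)) * Lag C e (mon C a)"
    using step(2) by (auto simp: sum_distrib_right[symmetric] sum.distrib algebra_simps)
  finally have m: "Lag C e (\<lambda>x. (\<Sum>i\<in>C. x i) * mon C a x) = \<dots>" .
  have "Lag C e (\<lambda>x. (\<Sum>i\<in>C. x i) * (f x + c * mon C a x)) =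
    Lag C e (\<lambda>x. (\<Sum>i\<in>C. x i) * f x + c * ((\<Sum>i\<in>C. x i) * mon C a x))"
    by (simp add: algebra_simps)
  also have "\<dots> = Lag C e (\<lambda>x. (\<Sum>i\<in>C. x i) * f x) + c * Lag C e (\<lambda>x. (\<Sum>i\<in>C. x i) * mon C a x)"
    by (simp add: Lag_add[OF assms(1,2)] Lag_scale pf pol_simps)
  also have "\<dots> = (real n + (\<Sum>i\<in>C. e i + 1)) * Lag C e (\<lambda>x. f x + c * mon C a x)"
    unfolding m step(3) by (simp add: Lag_add[OF assms(1,2)] Lag_scale pf pol_simps algebra_simps)
  finally show ?case .
qed

lemma Lag_pow_sum_vars:
  assumes "finite C" "C \<noteq> {}" "\<forall>i\<in>C. e i > -1"
  shows "\<exists>c>0. \<forall>f\<in>hp C {n}. Lag C e (\<lambda>x. (\<Sum>i\<in>C. x i) ^ k * f x) = c * Lag C e f"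
proof (induction k)
  case 0
  show ?case by (intro exI[of _ 1]) simp
next
  case (Suc k)
  then obtain c where c: "c > 0" "\<forall>f\<in>hp C {n}. Lag C e (\<lambda>x. (\<Sum>i\<in>C. x i) ^ k * f x) = c * Lag C e f" by blast
  have pos: "(\<Sum>i\<in>C. e i + 1) > 0" by (rule sum_pos) (use assms in force)+
  have "Lag C e (\<lambda>x. (\<Sum>i\<in>C. x i) ^ Suc k * f x) = ((real (k + n) + (\<Sum>i\<in>C. e i + 1)) * c) * Lag C e f"
    if f: "f \<in> hp C {n}" for f
  proof -
    have "(\<lambda>x. (\<Sum>i\<in>C. x i) ^ k * f x) \<in> hp C {k + n}"
      by (rule hp_mult[OF hp_pow_sum_vars f]) (use assms in auto)
    from Lag_sum_vars[OF assms(1,3) this] c(2) f show ?thesis by (simp add: mult.assoc)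
  qed
  then show ?case using c(1) pos by (intro exI[of _ "(real (k + n) + (\<Sum>i\<in>C. e i + 1)) * c"]) auto
qed

lemma gwt_nonneg: "gwt C e y \<ge> 0"
  unfolding gwt_def by (intro prod_nonneg) (auto simp: indicator_def)

lemma Lag_square_nonneg: "Lag C e (\<lambda>x. f x * f x) \<ge> 0"
  unfolding Lag_def by (intro integral_nonneg_AE AE_I2) (simp add: gwt_nonneg)

lemma pol_continuous:
  assumes "pol f"
  shows "continuous_on UNIV f"
  using assms by induction (auto intro!: continuous_intros)

text \<open>The weight is positive on the open orthant, so a continuous f that is nonzero at one
  point there would make the integrand positive on a box of positive measure.\<close>

lemma Lag_square_pos:
  assumes C: "finite C" "\<forall>i\<in>C. e i > -1" and f: "pol f" and L: "Lag C e (\<lambda>x. f x * f x) = 0"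
  shows "f (res C x) = 0"
proof -
  let ?M = "PiM C (\<lambda>_. lborel :: real measure)"
  let ?g = "\<lambda>x. f (res C x)"
  have g: "?g \<in> hp C UNIV" by (rule pol_res_hp[OF f C(1)])
  have "?g = (\<lambda>x. 0)"
  proof (rule pol_zero_positive[OF g C(1)])
    fix x0 :: pt assume x0: "\<forall>i\<in>C. x0 i > 0"
    show "?g x0 = 0"
    proof (rule ccontr)
      assume nz: "?g x0 \<noteq> 0"
      have "AE y in ?M. f (res C y) * f (res C y) * gwt C e y = 0"
        using L Lag_integrable[OF C pol_mult[OF f f]]
          integral_nonneg_eq_0_iff_AE[of ?M "\<lambda>y. f (res C y) * f (res C y) * gwt C e y"]
        unfolding Lag_def by (simp add: gwt_nonneg)
      then obtain N where N: "N \<in> null_sets ?M"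
        "{y \<in> space ?M. f (res C y) * f (res C y) * gwt C e y \<noteq> 0} \<subseteq> N"
        unfolding eventually_ae_filter by blast
      have "open {x. ?g x \<noteq> 0}"
        using pol_continuous[OF hp_imp_pol[OF g]] by (intro open_Collect_neq continuous_on_const)
      then have "openin (product_topology (\<lambda>_. euclidean) UNIV) {x. ?g x \<noteq> 0}"
        by (simp add: open_fun_def)
      from product_topology_open_contains_basis[OF this, of x0] nz
      obtain X where X: "x0 \<in> PiE UNIV X" "\<And>i. open (X i)" "PiE UNIV X \<subseteq> {x. ?g x \<noteq> 0}"
        by auto
      \<comment> \<open>Intersecting with the open half-lines keeps the box inside the orthant where
        \<open>gwt\<close> is positive.\<close>
      define Y where "Y = (\<lambda>i. X i \<inter> {0<..})"
      have "\<exists>d>0. ball (x0 i) d \<subseteq> Y i" if "i \<in> C" for i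
      proof -
        have "open (Y i)" using X(2) by (simp add: Y_def open_Int)
        moreover have "x0 i \<in> Y i" using X(1) x0 that by (auto simp: Y_def)
        ultimately show ?thesis using open_contains_ball by blast
      qed
      then obtain \<delta> where \<delta>: "\<And>i. i \<in> C \<Longrightarrow> \<delta> i > 0" "\<And>i. i \<in> C \<Longrightarrow> ball (x0 i) (\<delta> i) \<subseteq> Y i"
        by metis
      let ?B = "PiE C (\<lambda>i. ball (x0 i) (\<delta> i))"
      have "?B \<subseteq> N"
      proof
        fix y assume y: "y \<in> ?B"
        then have yY: "y i \<in> Y i" if "i \<in> C" for i using \<delta>(2) that by auto
        \<comment> \<open>Points of the product space carry information only on C, whereas X
          constrains all coordinates; z borrows the others from \<open>x0\<close>, and
          \<open>res C\<close> discards them.\<close>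
        define z where "z = (\<lambda>i. if i \<in> C then y i else x0 i)"
        have "z \<in> PiE UNIV X" using yY X(1) by (auto simp: z_def Y_def)
        then have "?g z \<noteq> 0" using X(3) by auto
        moreover have "res C z = res C y" by (auto simp: res_def z_def)
        ultimately have 1: "f (res C y) \<noteq> 0" by simp
        have "gwt C e y > 0" unfolding gwt_def
        proof (rule prod_pos)
          fix i assume "i \<in> C"
          then have "y i > 0" using yY by (auto simp: Y_def)
          then show "0 < indicator {0..} (y i) * y i powr e i / exp (y i)" by simp
        qed
        moreover have "y \<in> space ?M" using y by (auto simp: space_PiM PiE_iff)
        ultimately show "y \<in> N" using N(2) 1 by auto
      qed
      moreover have "emeasure ?M ?B = (\<Prod>i\<in>C. emeasure lborel (ball (x0 i) (\<delta> i)))"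
        by (rule psf.emeasure_PiM[OF C(1)]) auto
      moreover have "(\<Prod>i\<in>C. emeasure lborel (ball (x0 i) (\<delta> i))) \<noteq> 0"
      proof -
        have "emeasure lborel (ball (x0 i) (\<delta> i)) \<noteq> 0" if "i \<in> C" for i
          using \<delta>(1)[OF that] by (simp add: ball_eq_greaterThanLessThan)
        then show ?thesis using C(1) by simp
      qed
      ultimately show False
        using N(1) emeasure_mono[of ?B N ?M] by (auto simp: null_sets_def)
    qed
  qed
  then show ?thesis by metis
qed

section \<open>Dirichlet integrals over simplices\<close>

lemma nn_integral_Beta_scaled:
  fixes a b s :: real
  assumes "a > 0" "b > 0" "s \<ge> 0"
  shows "(\<integral>\<^sup>+ t. ennreal (indicator {0..s} t * t powr (a - 1) * (s - t) powr (b - 1)) \<partial>lborel) =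
    ennreal (s powr (a + b - 1) * Beta a b)"
\<comment> \<open>The substitution \<open>t = s * x\<close> degenerates for \<open>s = 0\<close>.
  There both sides are 0, the right one by \<open>0 powr a = 0\<close>, whatever the sign of
  \<open>a + b - 1\<close>.\<close>
proof (cases "s = 0")
  case True
  have "(\<integral>\<^sup>+ t. ennreal (indicator {0..s} t * t powr (a - 1) * (s - t) powr (b - 1)) \<partial>lborel) =
    (\<integral>\<^sup>+ t. 0 \<partial>(lborel :: real measure))"
    by (intro nn_integral_cong) (auto simp: indicator_def True)
  then show ?thesis by (simp add: True)
next
  case False
  with assms have s: "s > 0" by simp
  let ?f = "\<lambda>x::real. x powr (a - 1) * (1 - x) powr (b - 1)"
  have "(\<integral>\<^sup>+ t. ennreal (indicator {0..s} t * t powr (a - 1) * (s - t) powr (b - 1)) \<partial>lborel) =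
    ennreal \<bar>s\<bar> * (\<integral>\<^sup>+ x. ennreal (indicator {0..s} (0 + s * x) * (0 + s * x) powr (a - 1) *
        (s - (0 + s * x)) powr (b - 1)) \<partial>lborel)"
    by (rule nn_integral_real_affine) (use s in auto)
  also have "(\<integral>\<^sup>+ x. ennreal (indicator {0..s} (0 + s * x) * (0 + s * x) powr (a - 1) *
        (s - (0 + s * x)) powr (b - 1)) \<partial>lborel) =
      (\<integral>\<^sup>+ x. ennreal (s powr (a + b - 2)) * ennreal (indicator {0..1} x * ?f x) \<partial>lborel)"
  proof (rule nn_integral_cong)
    fix x :: real
    have "indicator {0..s} (0 + s * x) = (indicator {0..1} x :: real)"
      using s by (auto simp: indicator_def zero_le_mult_iff)
    moreover have "(s * x) powr (a - 1) * (s - s * x) powr (b - 1) = s powr (a + b - 2) * ?f x"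
      if "x \<in> {0..1}"
    proof -
      have "s - s * x = s * (1 - x)" by (simp add: algebra_simps)
      then have "(s * x) powr (a - 1) * (s - s * x) powr (b - 1) =
          (s powr (a - 1) * s powr (b - 1)) * ?f x"
        using s that by (simp add: powr_mult)
      also have "s powr (a - 1) * s powr (b - 1) = s powr (a + b - 2)"
        by (simp add: powr_add[symmetric])
      finally show ?thesis .
    qed
    ultimately show "ennreal (indicator {0..s} (0 + s * x) * (0 + s * x) powr (a - 1) *
        (s - (0 + s * x)) powr (b - 1)) = ennreal (s powr (a + b - 2)) * ennreal (indicator {0..1} x * ?f x)"
      by (auto simp: indicator_def ennreal_mult'[symmetric])
  qed
  also have "\<dots> = ennreal (s powr (a + b - 2)) * (\<integral>\<^sup>+ x. ennreal (indicator {0..1} x * ?f x) \<partial>lborel)"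
    by (rule nn_integral_cmult) measurable
  also have "(\<integral>\<^sup>+ x. ennreal (indicator {0..1} x * ?f x) \<partial>lborel) = ennreal (Beta a b)"
    using nn_integral_has_integral_lebesgue[OF _ has_integral_Beta_real[OF assms(1,2)]]
    by simp
  also have "ennreal \<bar>s\<bar> * (ennreal (s powr (a + b - 2)) * ennreal (Beta a b)) =
      ennreal (s * s powr (a + b - 2) * Beta a b)"
    using s assms by (simp add: ennreal_mult'[symmetric] mult.assoc Beta_def)
  also have "s * s powr (a + b - 2) = s powr (a + b - 1)"
    using s powr_add[of s 1 "a + b - 2"] by simp
  finally show ?thesis .
qed

lemma reg_measurable [measurable]:
  assumes [simp, measurable]: "finite G"
  shows "(\<lambda>y. indicator (reg G) y :: real) \<in> borel_measurable (PiM G (\<lambda>_. lborel))"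
proof -
  have "(\<lambda>y. indicator (reg G) y :: real) = (\<lambda>y. if (\<forall>i\<in>G. 0 \<le> y i) \<and> (\<Sum>i\<in>G. y i) \<le> 1 then 1 else 0)"
    by (auto simp: reg_def indicator_def)
  also have "\<dots> \<in> borel_measurable (PiM G (\<lambda>_. lborel))" by measurable
  finally show ?thesis .
qed

definition dirw :: "nat set \<Rightarrow> (nat \<Rightarrow> real) \<Rightarrow> real \<Rightarrow> pt \<Rightarrow> real" where
  "dirw G a b y = indicator (reg G) y * (\<Prod>i\<in>G. y i powr (a i - 1)) * (1 - (\<Sum>i\<in>G. y i)) powr (b - 1)"

lemma dirw_measurable:
  assumes "finite G"
  shows "dirw G a b \<in> borel_measurable (PiM G (\<lambda>_. lborel))"
  unfolding dirw_def[abs_def] using assms by measurable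

text \<open>Integrating out one coordinate i, from 0 to 1 minus the sum of the others, is a scaled
  Beta integral and leaves a Dirichlet weight whose last parameter is \<open>a i + b\<close>.
  Therefore b is generalized in the induction, and the factors \<open>Gamma (a i + b)\<close>
  cancel.\<close>

lemma nn_integral_Dirichlet:
  assumes "finite G" "\<forall>i\<in>G. a i > 0" "b > 0"
  shows "(\<integral>\<^sup>+ y. ennreal (dirw G a b y) \<partial>PiM G (\<lambda>_. lborel)) =
    ennreal ((\<Prod>i\<in>G. Gamma (a i)) * Gamma b / Gamma ((\<Sum>i\<in>G. a i) + b))"
  using assms
proof (induction G arbitrary: b)
  case empty
  have "Gamma b > 0" using empty by (simp add: Gamma_real_pos)
  then show ?case by (simp add: PiM_empty nn_integral_count_space_finite dirw_def reg_def)
next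
  case (insert i G)
  let ?M = "\<lambda>_::nat. lborel :: real measure"
  have ai: "a i > 0" and ag: "\<forall>i\<in>G. a i > 0" and b: "b > 0" using insert.prems by auto
  have pos: "Gamma (a i) > 0" "Gamma b > 0" "Gamma (a i + b) > 0"
    using ai b by (auto intro!: Gamma_real_pos)
  have "(\<integral>\<^sup>+ y. ennreal (dirw (insert i G) a b y) \<partial>PiM (insert i G) ?M) =
      (\<integral>\<^sup>+ x. (\<integral>\<^sup>+ t. ennreal (dirw (insert i G) a b (x(i := t))) \<partial>lborel) \<partial>PiM G ?M)"
    using psf.product_nn_integral_insert[OF insert(1,2), of "\<lambda>y. ennreal (dirw (insert i G) a b y)"]
      dirw_measurable[of "insert i G" a b] insert(1) by simp
  also have "\<dots> = (\<integral>\<^sup>+ x. ennreal (Beta (a i) b) * ennreal (dirw G a (a i + b) x) \<partial>PiM G ?M)"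
  proof (rule nn_integral_cong)
    fix x
    let ?s = "1 - (\<Sum>j\<in>G. x j)" and ?K = "\<Prod>j\<in>G. x j powr (a j - 1)"
    have sm: "(\<Sum>j\<in>insert i G. (x(i := t)) j) = t + (\<Sum>j\<in>G. x j)" for t
      using insert(1,2) by (auto intro!: sum.cong)
    have pr: "(\<Prod>j\<in>insert i G. (x(i := t)) j powr (a j - 1)) = t powr (a i - 1) * ?K" for t
      using insert(1,2) by (auto intro!: prod.cong)
    have rg: "indicator (reg (insert i G)) (x(i := t)) =
        (indicator (reg G) x * indicator {0..?s} t :: real)" for t
    proof -
      have "x(i := t) \<in> reg (insert i G) \<longleftrightarrow> x \<in> reg G \<and> t \<in> {0..?s}"
        unfolding reg_def mem_Collect_eq sm using insert(2) by auto
      then show ?thesis by (simp add: indicator_def)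
    qed
    have eq: "dirw (insert i G) a b (x(i := t)) =
        (indicator (reg G) x * ?K) * (indicator {0..?s} t * t powr (a i - 1) * (?s - t) powr (b - 1))" for t
      unfolding dirw_def rg sm pr by (simp add: algebra_simps)
    show "(\<integral>\<^sup>+ t. ennreal (dirw (insert i G) a b (x(i := t))) \<partial>lborel) =
        ennreal (Beta (a i) b) * ennreal (dirw G a (a i + b) x)"
    proof (cases "x \<in> reg G")
      case False
      then show ?thesis unfolding eq by (simp add: dirw_def)
    next
      case True
      then have s: "?s \<ge> 0" by (simp add: reg_def)
      have K: "?K \<ge> 0" by (intro prod_nonneg) auto
      have "(\<integral>\<^sup>+ t. ennreal (dirw (insert i G) a b (x(i := t))) \<partial>lborel) =
        (\<integral>\<^sup>+ t. ennreal ?K * ennreal (indicator {0..?s} t * t powr (a i - 1) * (?s - t) powr (b - 1)) \<partial>lborel)"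
        unfolding eq using True K by (simp add: ennreal_mult')
      also have "\<dots> = ennreal ?K * ennreal (?s powr (a i + b - 1) * Beta (a i) b)"
        by (subst nn_integral_cmult) (auto simp: nn_integral_Beta_scaled[OF ai b s])
      also have "\<dots> = ennreal (Beta (a i) b) * ennreal (dirw G a (a i + b) x)"
        using K True pos by (simp add: dirw_def ennreal_mult'[symmetric] Beta_def mult_ac)
      finally show ?thesis .
    qed
  qed
  also have "\<dots> = ennreal (Beta (a i) b) * (\<integral>\<^sup>+ x. ennreal (dirw G a (a i + b) x) \<partial>PiM G ?M)"
    by (rule nn_integral_cmult) (use dirw_measurable[OF insert(1), of a "a i + b"] in measurable)
  also have "\<dots> = ennreal (Beta (a i) b) *
      ennreal ((\<Prod>i\<in>G. Gamma (a i)) * Gamma (a i + b) / Gamma ((\<Sum>i\<in>G. a i) + (a i + b)))"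
    using insert.IH[OF ag, of "a i + b"] ai b by simp
  also have "\<dots> = ennreal (Beta (a i) b * ((\<Prod>i\<in>G. Gamma (a i)) * Gamma (a i + b) / Gamma ((\<Sum>i\<in>G. a i) + (a i + b))))"
    using pos by (subst ennreal_mult') (auto simp: Beta_def)
  also have "Beta (a i) b * ((\<Prod>i\<in>G. Gamma (a i)) * Gamma (a i + b) / Gamma ((\<Sum>i\<in>G. a i) + (a i + b))) =
      (\<Prod>i\<in>insert i G. Gamma (a i)) * Gamma b / Gamma ((\<Sum>i\<in>insert i G. a i) + b)"
    using insert(1,2) pos by (simp add: Beta_def algebra_simps)
  finally show ?case .
qed

text \<open>Needed because a weight \<open>x powr 0\<close> is 1 only off the boundary.\<close>

lemma AE_simplex_interior:
  fixes G :: "nat set"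
  assumes "finite G"
  shows "AE y in PiM G (\<lambda>_. lborel). (\<forall>i\<in>G. y i \<noteq> (0::real)) \<and> (\<Sum>i\<in>G. y i) \<noteq> 1"
proof -
  let ?M = "\<lambda>_::nat. lborel :: real measure"
  \<comment> \<open>Fubini in the coordinate i: each line in this direction meets the level set
    \<open>c = z\<close> at most in the point \<open>w y\<close>.\<close>
  have *: "AE y in PiM G ?M. c (y :: pt) \<noteq> z"
    if i: "i \<in> G" and c: "\<And>y::pt. {t::real. c (y(i := t)) = z} \<subseteq> {w y}"
      and [measurable]: "c \<in> borel_measurable (PiM G ?M)" for i and z :: real and w c :: "pt \<Rightarrow> real"
  proof -
    have [measurable]: "{y \<in> space (PiM G ?M). c y = z} \<in> sets (PiM G ?M)" by measurable
    have G: "G = insert i (G - {i})" using i by auto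
    have f: "(\<lambda>y. indicator {z} (c y) :: ennreal) \<in> borel_measurable (PiM G ?M)" by measurable
    have "(\<integral>\<^sup>+ y. indicator {z} (c y) \<partial>PiM G ?M) =
       (\<integral>\<^sup>+ x. (\<integral>\<^sup>+ t. indicator {z} (c (x(i := t))) \<partial>lborel) \<partial>PiM (G - {i}) ?M)"
      using psf.product_nn_integral_insert[of "G - {i}" i "\<lambda>y. indicator {z} (c y)"] f assms G by simp
    also have "\<dots> = (\<integral>\<^sup>+ x. 0 \<partial>PiM (G - {i}) ?M)"
    proof (rule nn_integral_cong)
      fix x
      have "AE t in lborel. t \<noteq> w x" by (rule AE_lborel_singleton)
      then have "AE t in lborel. indicator {z} (c (x(i := t))) = (0 :: ennreal)"
        by eventually_elim (use c[of x] in \<open>auto simp: indicator_def\<close>)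
      then have "(\<integral>\<^sup>+ t. indicator {z} (c (x(i := t))) \<partial>lborel) = (\<integral>\<^sup>+ t. 0 \<partial>(lborel :: real measure))"
        by (rule nn_integral_cong_AE)
      then show "(\<integral>\<^sup>+ t. indicator {z} (c (x(i := t))) \<partial>lborel) = 0" by simp
    qed
    finally have "(\<integral>\<^sup>+ y. indicator {z} (c y) \<partial>PiM G ?M) = 0" by simp
    then have "AE y in PiM G ?M. indicator {z} (c y) = (0::ennreal)"
      using f by (simp add: nn_integral_0_iff_AE)
    then show ?thesis by eventually_elim (auto simp: indicator_def split: if_splits)
  qed
  have 1: "AE y in PiM G ?M. \<forall>i\<in>G. y i \<noteq> 0"
  proof (rule AE_finite_allI[OF assms])
    fix i assume i: "i \<in> G"
    show "AE y in PiM G ?M. y i \<noteq> 0"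
      by (rule *[OF i, of "\<lambda>y. y i" 0 "\<lambda>_. 0"]) (use i in auto)
  qed
  have 2: "AE y in PiM G ?M. (\<Sum>i\<in>G. y i) \<noteq> 1"
  proof (cases "G = {}")
    case False
    then obtain i where i: "i \<in> G" by blast
    have e: "(\<Sum>j\<in>G. ((y :: pt)(i := t)) j) = t + (\<Sum>j\<in>G - {i}. y j)" for y t
      using i assms by (auto simp: sum.remove intro!: sum.cong)
    show ?thesis
    proof (rule *[OF i, of "\<lambda>y. \<Sum>i\<in>G. y i" 1 "\<lambda>y. 1 - (\<Sum>j\<in>G - {i}. y j)"])
      show "{t. (\<Sum>j\<in>G. (y(i := t)) j) = 1} \<subseteq> {1 - (\<Sum>j\<in>G - {i}. y j)}" for y :: pt
        unfolding e by auto
    qed measurable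
  qed simp
  from 1 2 show ?thesis by eventually_elim auto
qed

text \<open>The face with vertices \<open>insert u G\<close>, parametrized by the coordinates in G
  with u eliminated. It serves both kinds of faces: \<open>u = d + 1\<close> in general, and u the
  largest free index on a face inside \<open>x_{d+1} = 0\<close>.\<close>

definition bary :: "nat set \<Rightarrow> nat \<Rightarrow> pt \<Rightarrow> pt" where
  "bary G u y = (\<lambda>i. if i \<in> G then y i else if i = u then 1 - (\<Sum>j\<in>G. y j) else 0)"

lemma Dirichlet_mon:
  fixes a :: "nat \<Rightarrow> nat"
  assumes G: "finite G" "u \<notin> G" and e: "\<forall>i\<in>insert u G. e i > -1"
  defines "h \<equiv> \<lambda>y. indicator (reg G) y * (mon (insert u G) a (bary G u y) * (\<Prod>i\<in>insert u G. bary G u y i powr e i))"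
  shows "integrable (PiM G (\<lambda>_. lborel)) h"
    and "integral\<^sup>L (PiM G (\<lambda>_. lborel)) h = Lag (insert u G) e (mon (insert u G) a) /
      Gamma (real (sum a (insert u G)) + (\<Sum>i\<in>insert u G. e i + 1))"
proof -
  let ?a = "\<lambda>i. real (a i) + e i + 1"
  have h: "h = dirw G ?a (?a u)"
  proof
    fix y
    show "h y = dirw G ?a (?a u) y"
    proof (cases "y \<in> reg G")
      case False
      then show ?thesis by (simp add: h_def dirw_def)
    next
      case True
      then have y: "\<And>i. i \<in> G \<Longrightarrow> y i \<ge> 0" "1 - (\<Sum>j\<in>G. y j) \<ge> 0" by (auto simp: reg_def)
      have "mon (insert u G) a (bary G u y) * (\<Prod>i\<in>insert u G. bary G u y i powr e i) =
        (\<Prod>i\<in>insert u G. bary G u y i ^ a i * bary G u y i powr e i)"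
        by (simp only: mon_def prod.distrib)
      also have "\<dots> = (\<Prod>i\<in>insert u G. bary G u y i powr (?a i - 1))"
        by (rule prod.cong) (use y pow_powr in \<open>auto simp: bary_def\<close>)
      also have "\<dots> = (1 - (\<Sum>j\<in>G. y j)) powr (?a u - 1) * (\<Prod>i\<in>G. y i powr (?a i - 1))"
        using G by (simp add: bary_def cong: prod.cong)
      finally show ?thesis using True by (simp add: h_def dirw_def mult.commute)
    qed
  qed
  have n: "(\<integral>\<^sup>+ y. ennreal (h y) \<partial>PiM G (\<lambda>_. lborel)) =
    ennreal ((\<Prod>i\<in>G. Gamma (?a i)) * Gamma (?a u) / Gamma ((\<Sum>i\<in>G. ?a i) + ?a u))"
    unfolding h by (rule nn_integral_Dirichlet[OF G(1)]) (use e in force)+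
  have "(\<Sum>i\<in>G. ?a i) + ?a u = real (sum a (insert u G)) + (\<Sum>i\<in>insert u G. e i + 1)"
    using G by (simp add: sum.distrib)
  then have r: "(\<Prod>i\<in>G. Gamma (?a i)) * Gamma (?a u) / Gamma ((\<Sum>i\<in>G. ?a i) + ?a u) =
    Lag (insert u G) e (mon (insert u G) a) / Gamma (real (sum a (insert u G)) + (\<Sum>i\<in>insert u G. e i + 1))"
    using G e by (simp add: Lag_mon algebra_simps)
  have m: "h \<in> borel_measurable (PiM G (\<lambda>_. lborel))" unfolding h by (rule dirw_measurable[OF G(1)])
  have p: "AE y in PiM G (\<lambda>_. lborel). 0 \<le> h y"
    unfolding h dirw_def by (intro AE_I2 mult_nonneg_nonneg prod_nonneg) auto
  have "(\<Prod>i\<in>G. Gamma (?a i)) * Gamma (?a u) / Gamma ((\<Sum>i\<in>G. ?a i) + ?a u) \<ge> 0"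
  proof -
    have a: "?a i > 0" if "i \<in> insert u G" for i using e that by force
    have "(\<Sum>i\<in>G. ?a i) \<ge> 0" by (rule sum_nonneg) (use a in force)
    then have "(\<Sum>i\<in>G. ?a i) + ?a u > 0" using a[of u] by simp
    then show ?thesis using a
      by (intro divide_nonneg_pos mult_nonneg_nonneg prod_nonneg Gamma_real_pos less_imp_le[OF Gamma_real_pos]) auto
  qed
  from n nn_integral_eq_integrable[OF m p this] r
  show "integrable (PiM G (\<lambda>_. lborel)) h"
    and "integral\<^sup>L (PiM G (\<lambda>_. lborel)) h = Lag (insert u G) e (mon (insert u G) a) /
      Gamma (real (sum a (insert u G)) + (\<Sum>i\<in>insert u G. e i + 1))" by auto
qed

text \<open>In \<open>Dirichlet_mon\<close> the Gamma factor sees the monomial only through its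
  degree, so it can be taken out of a homogeneous sum.\<close>

lemma Dirichlet_hp:
  assumes G: "finite G" "u \<notin> G" and e: "\<forall>i\<in>insert u G. e i > -1" and P: "P \<in> hp (insert u G) {n}"
  defines "h \<equiv> \<lambda>P y. indicator (reg G) y * (P (bary G u y) * (\<Prod>i\<in>insert u G. bary G u y i powr e i))"
  shows "integrable (PiM G (\<lambda>_. lborel)) (h P) \<and>
    integral\<^sup>L (PiM G (\<lambda>_. lborel)) (h P) = Lag (insert u G) e P / Gamma (real n + (\<Sum>i\<in>insert u G. e i + 1))"
  using P
proof induction
  case zero
  then show ?case by (simp add: h_def Lag_zero)
next
  case (step f a c)
  have "h (\<lambda>x. f x + c * mon (insert u G) a x) = (\<lambda>y. h f y + c * h (mon (insert u G) a) y)"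
    by (simp add: h_def algebra_simps fun_eq_iff)
  moreover have "integrable (PiM G (\<lambda>_. lborel)) (h (mon (insert u G) a))"
    "integral\<^sup>L (PiM G (\<lambda>_. lborel)) (h (mon (insert u G) a)) =
      Lag (insert u G) e (mon (insert u G) a) / Gamma (real n + (\<Sum>i\<in>insert u G. e i + 1))"
    unfolding h_def using Dirichlet_mon[OF G e, of a] step(2) by auto
  moreover have "Lag (insert u G) e (\<lambda>x. f x + c * mon (insert u G) a x) =
      Lag (insert u G) e f + c * Lag (insert u G) e (mon (insert u G) a)"
    using G e by (simp add: Lag_add Lag_scale hp_imp_pol[OF step(1)] pol_simps)
  ultimately show ?case using step(3) by (simp add: add_divide_distrib)
qed

definition gz :: "nat set \<Rightarrow> (nat \<Rightarrow> real) \<Rightarrow> nat \<Rightarrow> real" where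
  "gz N \<gamma> i = (if i \<in> N then \<gamma> i else 0)"

lemma gz_gt: "\<forall>i\<in>N. \<gamma> i > -1 \<Longrightarrow> gz N \<gamma> i > -1"
  by (simp add: gz_def)

text \<open>The form has powers only for the variables in N, while \<open>Dirichlet_hp\<close> has
  one for every vertex of the face. The two weights agree off the boundary, which is enough for the
  integral.\<close>

lemma Dirichlet_face:
  assumes G: "finite G" "u \<notin> G" and g: "\<forall>i\<in>N. \<gamma> i > -1" and N: "N \<subseteq> insert u G"
    and P: "P \<in> hp V {n}" "finite V"
  shows "(LINT y|PiM G (\<lambda>_. lborel). indicator (reg G) y * (P (bary G u y) * (\<Prod>i\<in>N. bary G u y i powr \<gamma> i))) =
    Lag (insert u G) (gz N \<gamma>) P / Gamma (real n + (\<Sum>i\<in>insert u G. gz N \<gamma> i + 1))"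
proof -
  let ?M = "PiM G (\<lambda>_::nat. lborel :: real measure)" and ?C = "insert u G"
  let ?P = "\<lambda>x. P (res ?C x)" and ?e = "gz N \<gamma>"
  have P': "?P \<in> hp ?C {n}" by (rule hp_res[OF P]) (use G in auto)
  have b: "res ?C (bary G u y) = bary G u y" for y by (auto simp: res_def bary_def)
  let ?h = "\<lambda>y. indicator (reg G) y * (?P (bary G u y) * (\<Prod>i\<in>?C. bary G u y i powr ?e i))"
  let ?k = "\<lambda>y. indicator (reg G) y * (P (bary G u y) * (\<Prod>i\<in>N. bary G u y i powr \<gamma> i))"
  have D: "integrable ?M ?h" "integral\<^sup>L ?M ?h = Lag ?C ?e P / Gamma (real n + (\<Sum>i\<in>?C. ?e i + 1))"
    using Dirichlet_hp[OF G _ P', of ?e] gz_gt[OF g] by (auto simp: Lag_res)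
  have "AE y in ?M. ?h y = ?k y"
    using AE_simplex_interior[OF G(1)]
  proof eventually_elim
    case (elim y)
    have "(\<Prod>i\<in>?C. bary G u y i powr ?e i) = (\<Prod>i\<in>N. bary G u y i powr ?e i)" if "y \<in> reg G"
    proof (rule prod.mono_neutral_right)
      show "\<forall>i\<in>?C - N. bary G u y i powr ?e i = 1"
        using elim by (auto simp: gz_def bary_def)
    qed (use G N in auto)
    moreover have "(\<Prod>i\<in>N. bary G u y i powr ?e i) = (\<Prod>i\<in>N. bary G u y i powr \<gamma> i)"
      by (rule prod.cong) (auto simp: gz_def)
    ultimately show ?case unfolding b by (auto simp: indicator_def)
  qed
  moreover have "?k \<in> borel_measurable ?M"
  proof -
    have [measurable]: "(\<lambda>y. bary G u y i) \<in> borel_measurable ?M" for i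
      unfolding bary_def by (cases "i \<in> G"; cases "i = u") (auto intro!: borel_measurable_sum borel_measurable_diff)
    have "(\<lambda>y. f (bary G u y)) \<in> borel_measurable ?M" if "pol f" for f
      using that by induction auto
    then have [measurable]: "(\<lambda>y. P (bary G u y)) \<in> borel_measurable ?M"
      using hp_imp_pol[OF P(1)] by blast
    show ?thesis using G by measurable
  qed
  ultimately have "integral\<^sup>L ?M ?k = integral\<^sup>L ?M ?h"
    using D(1) by (intro integral_cong_AE) (auto elim!: eventually_mono)
  then show ?thesis using D(2) by simp
qed

section \<open>Face and simplex integrals expressed by the Laguerre functional\<close>

lemma face_int_eq_Lag:
  assumes I: "I \<subseteq> {1..d}" and N: "N \<subseteq> {1..d} - I" and g: "\<forall>i\<in>N. \<gamma> i > -1"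
    and P: "P \<in> hp {1..d+1} {n}"
  shows "face_int d I (\<lambda>x. P (xx d x) * (\<Prod>i\<in>N. x i powr \<gamma> i)) =
    Lag ({1..d+1} - I) (gz N \<gamma>) P / Gamma (real n + (\<Sum>i\<in>{1..d+1} - I. gz N \<gamma> i + 1))"
proof -
  let ?F = "{1..d} - I"
  let ?z = "\<lambda>y i. if i \<in> ?F then y i else (0::real)"
  have x: "xx d (?z y) = bary ?F (d+1) y" for y
  proof
    fix i
    have "(\<Sum>j\<in>{1..d}. ?z y j) = (\<Sum>j\<in>?F. y j)"
      by (rule sum.mono_neutral_cong_right) auto
    then show "xx d (?z y) i = bary ?F (d+1) y i" by (auto simp: xx_def bary_def)
  qed
  have p: "(\<Prod>i\<in>N. ?z y i powr \<gamma> i) = (\<Prod>i\<in>N. bary ?F (d+1) y i powr \<gamma> i)" for y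
    using N by (intro prod.cong) (auto simp: bary_def)
  have ins: "insert (d+1) ?F = {1..d+1} - I" using I by auto
  have "face_int d I (\<lambda>x. P (xx d x) * (\<Prod>i\<in>N. x i powr \<gamma> i)) =
    (LINT y|PiM ?F (\<lambda>_. lborel). indicator (reg ?F) y *
      (P (bary ?F (d+1) y) * (\<Prod>i\<in>N. bary ?F (d+1) y i powr \<gamma> i)))"
  proof -
    have "d + 1 \<notin> I" using I by auto
    then show ?thesis unfolding face_int_def Let_def x p by (simp only: not_False_eq_True if_True)
  qed
  also have "\<dots> = Lag (insert (d+1) ?F) (gz N \<gamma>) P /
      Gamma (real n + (\<Sum>i\<in>insert (d+1) ?F. gz N \<gamma> i + 1))"
    by (rule Dirichlet_face[OF _ _ g _ P]) (use N in auto)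
  finally show ?thesis unfolding ins .
qed

lemma face_int_top_eq_Lag:
  assumes I: "I \<subseteq> {1..d}" and N: "N \<subseteq> {1..d} - I" and ne: "{1..d} - I \<noteq> {}"
    and g: "\<forall>i\<in>N. \<gamma> i > -1" and P: "P \<in> hp {1..d+1} {n}"
  shows "face_int d (I \<union> {d+1}) (\<lambda>x. P (xx d x) * (\<Prod>i\<in>N. x i powr \<gamma> i)) =
    Lag ({1..d} - I) (gz N \<gamma>) P / Gamma (real n + (\<Sum>i\<in>{1..d} - I. gz N \<gamma> i + 1))"
proof -
  let ?F = "{1..d} - I"
  let ?m = "Max ?F"
  let ?G = "?F - {?m}"
  have m: "?m \<in> ?F" using ne by (intro Max_in) auto
  let ?z = "\<lambda>y i. if i \<in> ?G then y i else if i = ?m then 1 - (\<Sum>j\<in>?G. y j) else (0::real)"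
  have z: "?z y = bary ?G ?m y" for y by (auto simp: bary_def)
  have F: "{1..d} - (I \<union> {d+1}) = ?F" by auto
  have p: "(\<Prod>i\<in>N. ?z y i powr \<gamma> i) = (\<Prod>i\<in>N. bary ?G ?m y i powr \<gamma> i)" for y
    by (simp only: z[of y, symmetric])
  \<comment> \<open>On this face the first d coordinates sum to 1, so passing to barycentric
    coordinates adds a 0 at \<open>d + 1\<close>.\<close>
  have x: "xx d (bary ?G ?m y) = bary ?G ?m y" for y
  proof
    fix i
    have "(\<Sum>j\<in>{1..d}. bary ?G ?m y j) = (\<Sum>j\<in>?F. bary ?G ?m y j)"
      by (rule sum.mono_neutral_right) (use m in \<open>auto simp: bary_def\<close>)
    also have "\<dots> = bary ?G ?m y ?m + (\<Sum>j\<in>?G. bary ?G ?m y j)"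
      by (rule sum.remove[OF _ m]) simp
    also have "\<dots> = 1" by (simp add: bary_def)
    finally have "(\<Sum>j\<in>{1..d}. bary ?G ?m y j) = 1" .
    then show "xx d (bary ?G ?m y) i = bary ?G ?m y i"
      using m by (auto simp: xx_def bary_def)
  qed
  have ins: "insert ?m ?G = ?F" using m by auto
  have "face_int d (I \<union> {d+1}) (\<lambda>x. P (xx d x) * (\<Prod>i\<in>N. x i powr \<gamma> i)) =
    (LINT y|PiM ?G (\<lambda>_. lborel). indicator (reg ?G) y *
      (P (bary ?G ?m y) * (\<Prod>i\<in>N. bary ?G ?m y i powr \<gamma> i)))"
    using ne unfolding face_int_def Let_def F p z x by simp
  also have "\<dots> = Lag (insert ?m ?G) (gz N \<gamma>) P / Gamma (real n + (\<Sum>i\<in>insert ?m ?G. gz N \<gamma> i + 1))"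
    by (rule Dirichlet_face[OF _ _ g _ P]) (use N m in auto)
  finally show ?thesis unfolding ins .
qed

lemma simp_int_eq_face_int:
  assumes "\<And>x y. (\<And>i. i \<in> {1..d} \<Longrightarrow> x i = y i) \<Longrightarrow> h x = h y"
  shows "simp_int d h = face_int d {} h"
proof -
  have "tsimplex d = reg {1..d}" by (auto simp: tsimplex_def reg_def)
  moreover have "h (\<lambda>i. if i \<in> {1..d} then y i else 0) = h y" for y
    by (rule assms) simp
  ultimately show ?thesis unfolding simp_int_def face_int_def Let_def by simp
qed

lemma jac_ip_eq_Lag:
  assumes e: "\<forall>i\<in>{1..d+1}. e i > -1"
    and P: "P \<in> hp {1..d+1} {n}" and Q: "Q \<in> hp {1..d+1} {m}"
  shows "jac_ip d e (\<lambda>x. P (xx d x)) (\<lambda>x. Q (xx d x)) =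
    Lag {1..d+1} e (\<lambda>x. P x * Q x) / Gamma (real (n + m) + (\<Sum>i\<in>{1..d+1}. e i + 1))"
proof -
  have ins: "insert (d+1) {1..d} = {1..d+1}" by auto
  have PQ: "(\<lambda>x. P x * Q x) \<in> hp (insert (d+1) {1..d}) {n + m}"
    unfolding ins by (rule hp_mult[OF P Q]) auto
  have t: "tsimplex d = reg {1..d}" by (auto simp: tsimplex_def reg_def)
  have b: "xx d y i = bary {1..d} (d+1) y i" if "i \<in> {1..d+1}" for i y
    using that by (auto simp: xx_def bary_def)
  have "jac_ip d e (\<lambda>x. P (xx d x)) (\<lambda>x. Q (xx d x)) =
    (LINT y|PiM {1..d} (\<lambda>_. lborel). indicator (reg {1..d}) y *
      ((P (bary {1..d} (d+1) y) * Q (bary {1..d} (d+1) y)) *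
       (\<Prod>i\<in>insert (d+1) {1..d}. bary {1..d} (d+1) y i powr e i)))"
    unfolding jac_ip_def simp_int_def t ins
  proof (intro Bochner_Integration.integral_cong refl arg_cong2[of _ _ _ _ "(*)"])
    fix y
    show "P (xx d y) = P (bary {1..d} (d+1) y)" by (rule hp_indep[OF P b])
    show "Q (xx d y) = Q (bary {1..d} (d+1) y)" by (rule hp_indep[OF Q b])
    show "(\<Prod>i\<in>{1..d+1}. xx d y i powr e i) = (\<Prod>i\<in>{1..d+1}. bary {1..d} (d+1) y i powr e i)"
      by (rule prod.cong) (use b in auto)
  qed
  also have "\<dots> = Lag (insert (d+1) {1..d}) e (\<lambda>x. P x * Q x) /
      Gamma (real (n + m) + (\<Sum>i\<in>insert (d+1) {1..d}. e i + 1))"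
    using Dirichlet_hp[OF _ _ _ PQ, of e] e unfolding ins by simp
  finally show ?thesis unfolding ins .
qed

section \<open>Homogeneous orthogonal polynomials\<close>

text \<open>With C = {1..d+1} these are the spaces V of the paper, with smaller C the face spaces H
  (the complement of C is the index set S), both in homogeneous barycentric coordinates.\<close>

definition Hp :: "nat set \<Rightarrow> (nat \<Rightarrow> real) \<Rightarrow> nat \<Rightarrow> fn set" where
  "Hp C e m = {P \<in> hp C {m}. \<forall>Q \<in> hp C {..<m}. Lag C e (\<lambda>x. P x * Q x) = 0}"

lemma hp_empty_degrees: "f \<in> hp C {} \<Longrightarrow> f = (\<lambda>x. 0)"
  by (induction rule: hp.induct) auto

text \<open>Testing in the single degree \<open>m - 1\<close> is enough: a monomial of lower degree
  is lifted to it by a power of the sum of the variables, which by homogeneity multiplies the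
  pairing with P by a positive constant.\<close>

lemma HpI:
  assumes C: "finite C" "C \<noteq> {}" "\<forall>i\<in>C. e i > -1" and P: "P \<in> hp C {m}"
    and o: "\<And>Q. m \<ge> 1 \<Longrightarrow> Q \<in> hp C {m - 1} \<Longrightarrow> Lag C e (\<lambda>x. P x * Q x) = 0"
  shows "P \<in> Hp C e m"
proof -
  have "Lag C e (\<lambda>x. P x * Q x) = 0" if "Q \<in> hp C {..<m}" for Q
    using that
  proof induction
    case zero
    then show ?case by (simp add: Lag_zero)
  next
    case (step f a c)
    let ?j = "sum a C"
    have j: "?j < m" using step(2) by simp
    have mon: "mon C a \<in> hp C {?j}" using hp_monomial[of a C "{?j}" 1] by simp
    have 1: "(\<lambda>x. (\<Sum>i\<in>C. x i) ^ (m - 1 - ?j) * mon C a x) \<in> hp C {m - 1}"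
      by (rule hp_mult[OF hp_pow_sum_vars mon]) (use j C in auto)
    have 2: "(\<lambda>x. P x * mon C a x) \<in> hp C {m + ?j}"
      by (rule hp_mult[OF P mon]) auto
    obtain k where k: "k > 0" "\<forall>f\<in>hp C {m + ?j}. Lag C e (\<lambda>x. (\<Sum>i\<in>C. x i) ^ (m - 1 - ?j) * f x) = k * Lag C e f"
      using Lag_pow_sum_vars[OF C] by blast
    have "k * Lag C e (\<lambda>x. P x * mon C a x) = Lag C e (\<lambda>x. P x * ((\<Sum>i\<in>C. x i) ^ (m - 1 - ?j) * mon C a x))"
      using bspec[OF k(2) 2] by (simp add: mult.left_commute)
    also have "\<dots> = 0" using o[OF _ 1] j by simp
    finally have z: "Lag C e (\<lambda>x. P x * mon C a x) = 0" using k(1) by simp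
    have "Lag C e (\<lambda>x. P x * (f x + c * mon C a x)) = Lag C e (\<lambda>x. P x * f x + c * (P x * mon C a x))"
      by (simp add: algebra_simps)
    also have "\<dots> = 0"
      using z step(3) by (simp add: Lag_add[OF C(1,3)] Lag_scale hp_imp_pol[OF P] hp_imp_pol[OF step(1)] pol_simps)
    finally show ?case .
  qed
  then show ?thesis using P by (simp add: Hp_def)
qed

lemma Hp_hp: "P \<in> Hp C e m \<Longrightarrow> P \<in> hp C {m}"
  by (simp add: Hp_def)

lemma Hp_zero: "(\<lambda>x. 0) \<in> Hp C e m"
  by (simp add: Hp_def hp.zero Lag_zero)

lemma Hp_scale: "P \<in> Hp C e m \<Longrightarrow> (\<lambda>x. c * P x) \<in> Hp C e m"
  by (simp add: Hp_def hp_scale Lag_scale mult.assoc)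

lemma Hp_add:
  assumes "finite C" "\<forall>i\<in>C. e i > -1" "P \<in> Hp C e m" "Q \<in> Hp C e m"
  shows "(\<lambda>x. P x + Q x) \<in> Hp C e m"
  using assms(3,4)
  by (auto simp: Hp_def hp_add distrib_right Lag_add[OF assms(1,2)] hp_imp_pol pol_mult)

lemma Hp_sum:
  assumes "finite C" "\<forall>i\<in>C. e i > -1" "\<And>s. s \<in> S \<Longrightarrow> f s \<in> Hp C e m"
  shows "(\<lambda>x. \<Sum>s\<in>S. f s x) \<in> Hp C e m"
  using assms(3)
  by (induction S rule: infinite_finite_induct) (simp_all add: Hp_zero Hp_add[OF assms(1,2)])

lemma Hp_cong_exp: "(\<And>i. i \<in> C \<Longrightarrow> e i = e' i) \<Longrightarrow> Hp C e m = Hp C e' m"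
  unfolding Hp_def using Lag_cong_exp[of C e e'] by auto

text \<open>A monomial in C splits into its part in \<open>C'\<close>, still of degree below m and
  hence orthogonal to q, and a part in the other variables, over which \<open>Lag\<close>
  factors.\<close>

lemma Hp_orth_ext:
  assumes C: "finite C" "\<forall>i\<in>C. e i > -1" and C': "C' \<subseteq> C" and q: "q \<in> Hp C' e m"
    and Q: "Q \<in> hp C {..<m}"
  shows "Lag C e (\<lambda>x. q x * Q x) = 0"
  using Q
proof induction
  case zero
  then show ?case by (simp add: Lag_zero)
next
  case (step f a c)
  have pq: "pol q" by (rule hp_imp_pol[OF Hp_hp[OF q]])
  have sm: "sum a C' < m"
  proof -
    have "sum a C' \<le> sum a C" using C C' by (intro sum_mono2) auto
    then show ?thesis using step(2) by simp
  qed
  have mon: "mon C' a \<in> hp C' {..<m}" using hp_monomial[of a C' "{..<m}" 1] sm by simp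
  have "mon C a x = mon C' a x * mon (C - C') a x" for x
    unfolding mon_def using C(1) C' by (simp add: prod.subset_diff mult.commute)
  then have "Lag C e (\<lambda>x. q x * mon C a x) = Lag C e (\<lambda>x. (q x * mon C' a x) * mon (C - C') a x)"
    by (simp add: mult.assoc)
  also have "\<dots> = Lag C' e (\<lambda>x. q x * mon C' a x) * Lag (C - C') e (mon (C - C') a)"
    by (rule Lag_extend[OF C C']) (rule hp_mult[OF Hp_hp[OF q] mon, of UNIV], simp)
  also have "Lag C' e (\<lambda>x. q x * mon C' a x) = 0" using q mon by (simp add: Hp_def)
  finally have z: "Lag C e (\<lambda>x. q x * mon C a x) = 0" by simp
  have "Lag C e (\<lambda>x. q x * (f x + c * mon C a x)) = Lag C e (\<lambda>x. q x * f x + c * (q x * mon C a x))"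
    by (simp add: algebra_simps)
  also have "\<dots> = 0"
    using z step(3) by (simp add: Lag_add[OF C] Lag_scale pq hp_imp_pol[OF step(1)] pol_simps)
  finally show ?case .
qed

section \<open>Orthogonal projection and reduction modulo the sum of the variables\<close>

inductive_set lspan :: "fn set \<Rightarrow> fn set" for S where
  lspan_zero: "(\<lambda>x. 0) \<in> lspan S"
| lspan_step: "f \<in> lspan S \<Longrightarrow> s \<in> S \<Longrightarrow> (\<lambda>x. f x + c * s x) \<in> lspan S"

lemma lspan_add:
  assumes "f \<in> lspan S" "g \<in> lspan S"
  shows "(\<lambda>x. f x + g x) \<in> lspan S"
  using assms(2)
proof induction
  case lspan_zero
  then show ?case using assms(1) by simp
next
  case (lspan_step g s c)
  from lspan.lspan_step[OF lspan_step(3,2), of c] show ?case by (simp add: add.assoc)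
qed

lemma lspan_scale:
  assumes "f \<in> lspan S"
  shows "(\<lambda>x. k * f x) \<in> lspan S"
  using assms
proof induction
  case lspan_zero
  then show ?case by (simp add: lspan.lspan_zero)
next
  case (lspan_step g s c)
  from lspan.lspan_step[OF lspan_step(3,2), of "k * c"] show ?case by (simp add: algebra_simps)
qed

lemma lspan_mono: "f \<in> lspan S \<Longrightarrow> S \<subseteq> T \<Longrightarrow> f \<in> lspan T"
  by (induction rule: lspan.induct) (auto intro: lspan.intros)

text \<open>Gram-Schmidt over a finite set. The subspace W is kept explicit because the form is
  definite only there: \<open>Lag C\<close> does not see variables outside C.\<close>

lemma projection_exists:
  fixes B :: "fn \<Rightarrow> fn \<Rightarrow> real"
  assumes S: "finite S" "S \<subseteq> W" and W0: "(\<lambda>x. 0) \<in> W"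
    and W: "\<And>f g. f \<in> W \<Longrightarrow> g \<in> W \<Longrightarrow> (\<lambda>x. f x + g x) \<in> W" "\<And>f c. f \<in> W \<Longrightarrow> (\<lambda>x. c * f x) \<in> W"
    and B: "\<And>f g h. f \<in> W \<Longrightarrow> g \<in> W \<Longrightarrow> h \<in> W \<Longrightarrow> B (\<lambda>x. f x + g x) h = B f h + B g h"
      "\<And>f h c. f \<in> W \<Longrightarrow> h \<in> W \<Longrightarrow> B (\<lambda>x. c * f x) h = c * B f h"
      "\<And>f g. f \<in> W \<Longrightarrow> g \<in> W \<Longrightarrow> B f g = B g f"
      "\<And>f. f \<in> W \<Longrightarrow> B f f = 0 \<Longrightarrow> f = (\<lambda>x. 0)"
    and p: "p \<in> W"
  shows "\<exists>r\<in>lspan S. \<forall>s\<in>S. B (\<lambda>x. p x - r x) s = 0"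
  using S p
proof (induction S arbitrary: p)
  case empty
  then show ?case using lspan_zero by blast
next
  case (insert s S)
  have dW: "(\<lambda>x. f x - g x) \<in> W" if "f \<in> W" "g \<in> W" for f g
    using W(1)[OF that(1) W(2)[OF that(2), of "-1"]] by simp
  have Bd: "B (\<lambda>x. f x - g x) h = B f h - B g h" if "f \<in> W" "g \<in> W" "h \<in> W" for f g h
    using B(1)[OF that(1) W(2)[OF that(2), of "-1"] that(3)] B(2)[OF that(2,3), of "-1"] by simp
  have sW: "s \<in> W" and SW: "S \<subseteq> W" using insert.prems by auto
  have lW: "f \<in> W" if "f \<in> lspan S" for f
    using that by induction (use W0 W SW in auto)
  have orth: "B f g = 0" if f: "f \<in> W" "\<forall>t\<in>S. B f t = 0" and g: "g \<in> lspan S" for f g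
    using g
  proof induction
    case lspan_zero
    show ?case using B(2)[OF W0 f(1), of 0] B(3)[OF f(1) W0] by simp
  next
    case (lspan_step g t c)
    have gW: "g \<in> W" and tW: "t \<in> W" using lW lspan_step SW by auto
    have "B f (\<lambda>x. g x + c * t x) = B (\<lambda>x. g x + c * t x) f"
      by (rule B(3)[OF f(1) W(1)[OF gW W(2)[OF tW]]])
    also have "\<dots> = B g f + c * B t f"
      using B(1)[OF gW W(2)[OF tW] f(1)] B(2)[OF tW f(1)] by simp
    also have "\<dots> = 0" using lspan_step(2,3) f(2) B(3)[OF f(1) gW] B(3)[OF f(1) tW] by simp
    finally show ?case .
  qed
  obtain r0 where r0: "r0 \<in> lspan S" "\<forall>t\<in>S. B (\<lambda>x. p x - r0 x) t = 0"
    using insert.IH[OF SW insert.prems(2)] by blast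
  obtain s0 where s0: "s0 \<in> lspan S" "\<forall>t\<in>S. B (\<lambda>x. s x - s0 x) t = 0"
    using insert.IH[OF SW sW] by blast
  have r0W: "r0 \<in> W" and s0W: "s0 \<in> W" using r0 s0 lW by auto
  define s' where "s' = (\<lambda>x. s x - s0 x)"
  define q where "q = (\<lambda>x. p x - r0 x)"
  have s'W: "s' \<in> W" unfolding s'_def by (rule dW[OF sW s0W])
  have qW: "q \<in> W" unfolding q_def by (rule dW[OF insert.prems(2) r0W])
  have s'o: "\<forall>t\<in>S. B s' t = 0" using s0 by (simp add: s'_def)
  have qo: "\<forall>t\<in>S. B q t = 0" using r0 by (simp add: q_def)
  show ?case
  proof (cases "s' = (\<lambda>x. 0)")
    case True
    then have "s = s0" by (simp add: s'_def fun_eq_iff)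
    then have "B q s = 0" using orth[OF qW qo s0(1)] by simp
    moreover have "r0 \<in> lspan (insert s S)" by (rule lspan_mono[OF r0(1)]) auto
    ultimately show ?thesis using qo unfolding q_def by (intro bexI[of _ r0]) auto
  next
    case False
    \<comment> \<open>s' differs from s by a combination of S, to which s' is orthogonal; so the
      pivot \<open>B s' s\<close> is a square norm and nonzero.\<close>
    have "B s' s' = B s' s"
    proof -
      have "B s' s' = B s s' - B s0 s'" unfolding s'_def by (rule Bd) (use sW s0W dW in auto)
      also have "B s0 s' = 0" using orth[OF s'W s'o s0(1)] B(3)[OF s'W s0W] by simp
      also have "B s s' = B s' s" by (rule B(3)[OF sW s'W])
      finally show ?thesis by simp
    qed
    then have nz: "B s' s \<noteq> 0" using B(4)[OF s'W] False by auto
    define k where "k = B q s / B s' s"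
    let ?r = "\<lambda>x. r0 x + k * s' x"
    have "s' \<in> lspan (insert s S)"
      using lspan_add[OF lspan_step[OF lspan_zero, of s "insert s S" 1]
          lspan_scale[OF lspan_mono[OF s0(1)], of "insert s S" "-1"]]
      by (auto simp: s'_def)
    then have "?r \<in> lspan (insert s S)"
      using lspan_add[OF lspan_mono[OF r0(1)] lspan_scale, of "insert s S" s' k] by auto
    moreover have "B (\<lambda>x. p x - ?r x) t = 0" if "t \<in> insert s S" for t
    proof -
      have tW: "t \<in> W" using that sW SW by auto
      have "(\<lambda>x. p x - ?r x) = (\<lambda>x. q x - k * s' x)" by (auto simp: q_def)
      then have "B (\<lambda>x. p x - ?r x) t = B q t - k * B s' t"
        using Bd[OF qW W(2)[OF s'W] tW] B(2)[OF s'W tW] by simp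
      then show ?thesis using that qo s'o nz by (auto simp: k_def)
    qed
    ultimately show ?thesis by (intro bexI[of _ ?r]) auto
  qed
qed

lemma finite_mon:
  assumes "finite C"
  shows "finite {mon C a |a. sum a C = n}"
proof -
  let ?F = "{a. \<forall>x. (x \<in> C \<longrightarrow> a x \<in> {0..n}) \<and> (x \<notin> C \<longrightarrow> a x = 0)}"
  have "{mon C a |a. sum a C = n} \<subseteq> mon C ` ?F"
  proof clarify
    fix a assume a: "n = sum a C"
    let ?b = "\<lambda>i. if i \<in> C then a i else 0"
    have "mon C a = mon C ?b" by (auto simp: mon_def)
    moreover have "?b \<in> ?F" using a assms by (auto simp: member_le_sum)
    ultimately show "mon C a \<in> mon C ` {b. \<forall>x. (x \<in> C \<longrightarrow> b x \<in> {0..sum a C}) \<and> (x \<notin> C \<longrightarrow> b x = 0)}"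
      using a by blast
  qed
  moreover have "finite ?F" by (rule finite_set_of_finite_funs) (use assms in auto)
  ultimately show ?thesis using finite_surj by blast
qed

text \<open>q is the residual of the projection of P onto the multiples of the sum of the variables.
  By \<open>Lag_sum_vars\<close> orthogonality to the sum times S is, up to a positive factor,
  orthogonality to S itself, of degree \<open>m - 1\<close>, and \<open>HpI\<close> applies.\<close>

lemma Hp_decomp:
  assumes C: "finite C" "\<forall>i\<in>C. e i > -1" and P: "P \<in> hp C {m}"
  shows "\<exists>q\<in>Hp C e m. \<exists>R\<in>hp C {k. Suc k = m}. P = (\<lambda>x. q x + (\<Sum>i\<in>C. x i) * R x)"
\<comment> \<open>In these cases q is P itself: for \<open>m = 0\<close> there is no lower degree,
  and for empty C and positive m only the zero polynomial remains. The degree set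
  \<open>{k. Suc k = m}\<close> is empty for \<open>m = 0\<close>, which encodes R = 0.\<close>
proof (cases "m = 0 \<or> C = {}")
  case True
  then have "P \<in> Hp C e m"
  proof
    assume "m = 0"
    then show ?thesis using P by (auto simp: Hp_def Lag_zero dest!: hp_empty_degrees)
  next
    assume ce: "C = {}"
    show ?thesis
    proof (cases "m = 0")
      case True
      then show ?thesis using P by (auto simp: Hp_def Lag_zero dest!: hp_empty_degrees)
    next
      case False
      have "f = (\<lambda>x. 0)" if "f \<in> hp {} {m}" for f
        using that by induction (use False in auto)
      then show ?thesis using P ce by (auto intro: Hp_zero)
    qed
  qed
  then show ?thesis by (intro bexI[of _ P] bexI[OF _ hp.zero]) auto
next
  case False
  then obtain n where m: "m = Suc n" and ne: "C \<noteq> {}" by (cases m) auto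
  let ?s = "\<lambda>x::pt. \<Sum>i\<in>C. x i"
  let ?S = "(\<lambda>f x. ?s x * f x) ` {mon C a |a. sum a C = n}"
  let ?B = "\<lambda>f g. Lag C e (\<lambda>x. f x * g x)"
  have mult: "(\<lambda>x. ?s x * f x) \<in> hp C {m}" if "f \<in> hp C {n}" for f
    by (rule hp_mult[OF hp_sum_vars that]) (use C m in auto)
  have "\<exists>r\<in>lspan ?S. \<forall>s\<in>?S. ?B (\<lambda>x. P x - r x) s = 0"
  proof (rule projection_exists[where B = ?B and W = "hp C {m}" and S = ?S])
    show "finite ?S" using finite_mon[OF C(1)] by simp
    show "?S \<subseteq> hp C {m}" using mult hp_monomial[of _ C "{n}" 1] by auto
    show "f = (\<lambda>x. 0)" if f: "f \<in> hp C {m}" and "?B f f = 0" for f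
      using Lag_square_pos[OF C hp_imp_pol[OF f]] that hp_res_same[OF f] by auto
    show "?B f g = ?B g f" for f g by (simp add: mult.commute)
    show "?B (\<lambda>x. f x + g x) h = ?B f h + ?B g h" if "f \<in> hp C {m}" "g \<in> hp C {m}" "h \<in> hp C {m}" for f g h
      unfolding distrib_right using that by (intro Lag_add[OF C] pol_mult hp_imp_pol)
    show "?B (\<lambda>x. c * f x) h = c * ?B f h" for f h c
      unfolding mult.assoc by (rule Lag_scale)
  qed (intro hp.zero hp_add hp_scale P; assumption)+
  then obtain r where r: "r \<in> lspan ?S" "\<forall>s\<in>?S. ?B (\<lambda>x. P x - r x) s = 0" by blast
  have "\<exists>R\<in>hp C {n}. r = (\<lambda>x. ?s x * R x)"
    using r(1)
  proof induction
    case lspan_zero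
    show ?case by (intro bexI[OF _ hp.zero]) simp
  next
    case (lspan_step f s c)
    then obtain R a where "R \<in> hp C {n}" "f = (\<lambda>x. ?s x * R x)" "s = (\<lambda>x. ?s x * mon C a x)" "sum a C \<in> {n}"
      by auto
    then show ?case
      by (intro bexI[OF _ hp.step[of R C "{n}" a c]]) (auto simp: algebra_simps)
  qed
  then obtain R where R: "R \<in> hp C {n}" "r = (\<lambda>x. ?s x * R x)" by blast
  let ?q = "\<lambda>x. P x - r x"
  have q: "?q \<in> hp C {m}" using hp_diff[OF P mult[OF R(1)]] R(2) by simp
  have "?q \<in> Hp C e m"
  proof (rule HpI[OF C(1) ne C(2) q])
    fix Q assume "Q \<in> hp C {m - 1}"
    then have Q: "Q \<in> hp C {n}" using m by simp
    then show "?B ?q Q = 0"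
    proof induction
      case zero
      then show ?case by (simp add: Lag_zero)
    next
      case (step f a c)
      have mon: "mon C a \<in> hp C {n}" using hp_monomial[of a C "{n}" 1] step by simp
      have 2: "(\<lambda>x. ?q x * mon C a x) \<in> hp C {m + n}" by (rule hp_mult[OF q mon]) auto
      have "(real (m + n) + (\<Sum>i\<in>C. e i + 1)) * ?B ?q (mon C a) = ?B ?q (\<lambda>x. ?s x * mon C a x)"
        using Lag_sum_vars[OF C 2] by (simp add: mult.left_commute)
      also have "\<dots> = 0"
      proof -
        have "(\<lambda>x. ?s x * mon C a x) \<in> ?S" using step(2) by blast
        from bspec[OF r(2) this] show ?thesis .
      qed
      finally have "(real (m + n) + (\<Sum>i\<in>C. e i + 1)) * ?B ?q (mon C a) = 0" .
      moreover have "(\<Sum>i\<in>C. e i + 1) > 0" by (rule sum_pos) (use C ne in force)+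
      ultimately have z: "?B ?q (mon C a) = 0" by auto
      have "?B ?q (\<lambda>x. f x + c * mon C a x) = Lag C e (\<lambda>x. ?q x * f x + c * (?q x * mon C a x))"
        by (simp add: algebra_simps)
      also have "\<dots> = ?B ?q f + c * ?B ?q (mon C a)"
        using hp_imp_pol[OF step(1)] hp_imp_pol[OF q]
        by (subst Lag_add[OF C]) (auto simp: Lag_scale pol_simps)
      finally show ?case using z step(3) by simp
    qed
  qed
  moreover have "P = (\<lambda>x. ?q x + ?s x * R x)" using R(2) by simp
  moreover have "R \<in> hp C {k. Suc k = m}" by (rule hp_mono[OF R(1)]) (use m in auto)
  ultimately show ?thesis by (intro bexI[of _ ?q] bexI[of _ R])
qed

text \<open>One factor x_r is rewritten as the sum of all variables minus the other ones; repeating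
  this, by induction on the exponent of x_r, eliminates x_r modulo multiples of the sum.\<close>

lemma hp_mod_sum_vars:
  assumes C: "finite C" "r \<in> C" and P: "P \<in> hp C {m}"
  shows "\<exists>R\<in>hp (C - {r}) {m}. \<exists>P'\<in>hp C {k. Suc k = m}. P = (\<lambda>x. R x + (\<Sum>i\<in>C. x i) * P' x)"
    (is "?D P")
proof -
  let ?s = "\<lambda>x::pt. \<Sum>i\<in>C. x i"
  have Dadd: "?D (\<lambda>x. f x + g x)" if f: "?D f" and g: "?D g" for f g
  proof -
    obtain R P' R' P'' where "R \<in> hp (C - {r}) {m}" "P' \<in> hp C {k. Suc k = m}" "f = (\<lambda>x. R x + ?s x * P' x)"
      "R' \<in> hp (C - {r}) {m}" "P'' \<in> hp C {k. Suc k = m}" "g = (\<lambda>x. R' x + ?s x * P'' x)"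
      using f g by blast
    then show ?thesis
      by (intro bexI[of _ "\<lambda>x. R x + R' x"] bexI[of _ "\<lambda>x. P' x + P'' x"])
        (auto simp: hp_add algebra_simps)
  qed
  have Dscale: "?D (\<lambda>x. c * f x)" if f: "?D f" for f c
  proof -
    obtain R P' where "R \<in> hp (C - {r}) {m}" "P' \<in> hp C {k. Suc k = m}" "f = (\<lambda>x. R x + ?s x * P' x)"
      using f by blast
    then show ?thesis
      by (intro bexI[of _ "\<lambda>x. c * R x"] bexI[of _ "\<lambda>x. c * P' x"]) (auto simp: hp_scale algebra_simps)
  qed
  have D0: "?D (\<lambda>x. 0)"
    by (intro bexI[OF _ hp.zero] bexI[of _ "\<lambda>x. 0"]) (auto simp: hp.zero)
  have Dsum: "?D (\<lambda>x. \<Sum>s\<in>S. f s x)" if "finite S" "\<And>s. s \<in> S \<Longrightarrow> ?D (f s)" for S and f :: "nat \<Rightarrow> fn"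
    using that
  proof (induction S)
    case (insert s S)
    then show ?case using Dadd[of "f s" "\<lambda>x. \<Sum>s\<in>S. f s x"] by simp
  qed (use D0 in simp)
  have Dmon: "?D (mon C a)" if "a r = b" "sum a C = m" for a b
    using that
  proof (induction b arbitrary: a)
    case 0
    have "mon C a = mon (C - {r}) a" using mon_split[OF C] 0 by auto
    moreover have "sum a (C - {r}) = m" using 0 C by (simp add: sum.remove)
    ultimately have "mon C a \<in> hp (C - {r}) {m}" using hp_monomial[of a "C - {r}" "{m}" 1] by simp
    then show ?case by (intro bexI[of _ "mon C a"] bexI[OF _ hp.zero]) auto
  next
    case (Suc b)
    let ?a = "a(r := b)"
    have var: "x i * mon C a' x = mon C (a'(i := Suc (a' i))) x" if "i \<in> C" for i x a'
    proof -
      have "mon (C - {i}) (a'(i := Suc (a' i))) x = mon (C - {i}) a' x"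
        unfolding mon_def by (rule prod.cong) auto
      then show ?thesis using mon_split[OF C(1) that] by simp
    qed
    have upd: "sum (a'(i := k)) C + a' i = sum a' C + k" if "i \<in> C" for a' :: "nat \<Rightarrow> nat" and i k
    proof -
      have "sum a' (C - {i}) = sum (a'(i := k)) (C - {i})" by (rule sum.cong) auto
      then show ?thesis using sum.remove[OF C(1) that, of a'] sum.remove[OF C(1) that, of "a'(i := k)"] by simp
    qed
    have sa: "Suc (sum ?a C) = m" using upd[OF C(2), of a b] Suc.prems by simp
    have eq: "mon C a = (\<lambda>x. ?s x * mon C ?a x + (-1) * (\<Sum>i\<in>C - {r}. mon C (?a(i := Suc (?a i))) x))"
    proof
      fix x :: pt
      have "a = ?a(r := Suc (?a r))" using Suc.prems by auto
      then have "mon C a x = x r * mon C ?a x" using var[OF C(2), of x ?a] by simp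
      also have "x r = ?s x - (\<Sum>i\<in>C - {r}. x i)" using C by (simp add: sum.remove)
      finally have "mon C a x = ?s x * mon C ?a x - (\<Sum>i\<in>C - {r}. x i * mon C ?a x)"
        by (simp only: left_diff_distrib sum_distrib_right[of x "C - {r}"])
      also have "(\<Sum>i\<in>C - {r}. x i * mon C ?a x) = (\<Sum>i\<in>C - {r}. mon C (?a(i := Suc (?a i))) x)"
        by (rule sum.cong) (auto simp: var)
      finally show "mon C a x = ?s x * mon C ?a x + (-1) * (\<Sum>i\<in>C - {r}. mon C (?a(i := Suc (?a i))) x)"
        by (simp del: fun_upd_apply)
    qed
    have 1: "?D (\<lambda>x. ?s x * mon C ?a x)"
      using hp_monomial[of ?a C "{k. Suc k = m}" 1] sa
      by (intro bexI[OF _ hp.zero] bexI[of _ "mon C ?a"]) auto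
    have 2: "?D (mon C (?a(i := Suc (?a i))))" if "i \<in> C - {r}" for i
    proof (rule Suc.IH)
      show "(?a(i := Suc (?a i))) r = b" using that by auto
      show "sum (?a(i := Suc (?a i))) C = m" using upd[of i ?a "Suc (?a i)"] sa that by (simp del: fun_upd_apply)
    qed
    show ?case unfolding eq
      by (rule Dadd[OF 1 Dscale[OF Dsum]]) (use C in simp, rule 2)
  qed
  from P show ?thesis
  proof induction
    case zero
    show ?case by (rule D0)
  next
    case (step f a c)
    show ?case by (rule Dadd[OF step(3) Dscale[OF Dmon]]) (use step in auto)
  qed
qed

text \<open>The sum of the variables costs only a scalar, and what remains is a pairing with lower
  degree.\<close>

lemma Hp_subset_sum_vars_orth:
  assumes C: "finite C" "\<forall>i\<in>C. e i > -1" and P: "P \<in> Hp C e m" and R: "R \<in> hp C {k. Suc k = m}"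
  shows "Lag C e (\<lambda>x. P x * ((\<Sum>i\<in>C. x i) * R x)) = 0"
proof (cases m)
  case 0
  then have "R = (\<lambda>x. 0)" using hp_empty_degrees R by simp
  then show ?thesis by (simp add: Lag_zero)
next
  case (Suc n)
  have R': "R \<in> hp C {..<m}" by (rule hp_mono[OF R]) auto
  have "(\<lambda>x. P x * R x) \<in> hp C {m + n}" by (rule hp_mult[OF Hp_hp[OF P] R]) (use Suc in auto)
  from Lag_sum_vars[OF C this] P R' show ?thesis by (simp add: Hp_def mult.left_commute)
qed

text \<open>P differs from a polynomial without x_r by a multiple of the sum, which is orthogonal to
  P. So orthogonality to the former makes P orthogonal to itself.\<close>

lemma Hp_eq_zeroI:
  assumes C: "finite C" "r \<in> C" "\<forall>i\<in>C. e i > -1" and P: "P \<in> Hp C e m"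
    and o: "\<And>R. R \<in> hp (C - {r}) {m} \<Longrightarrow> Lag C e (\<lambda>x. P x * R x) = 0"
  shows "P = (\<lambda>x. 0)"
proof -
  obtain R P' where R: "R \<in> hp (C - {r}) {m}" "P' \<in> hp C {k. Suc k = m}"
    "P = (\<lambda>x. R x + (\<Sum>i\<in>C. x i) * P' x)"
    using hp_mod_sum_vars[OF C(1,2) Hp_hp[OF P]] by blast
  have pP: "pol P" by (rule hp_imp_pol[OF Hp_hp[OF P]])
  have "Lag C e (\<lambda>x. P x * P x) = Lag C e (\<lambda>x. P x * R x + P x * ((\<Sum>i\<in>C. x i) * P' x))"
    by (rule Lag_cong) (simp add: R(3) distrib_left)
  also have "\<dots> = 0"
    using o[OF R(1)] Hp_subset_sum_vars_orth[OF C(1,3) P R(2)] pP hp_imp_pol[OF R(1)] hp_imp_pol[OF R(2)]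
    by (simp add: Lag_add[OF C(1,3)] pol_simps)
  finally show ?thesis
    using Lag_square_pos[OF C(1,3) pP] hp_res_same[OF Hp_hp[OF P]] by auto
qed

text \<open>On a single vertex r everything of positive degree is a multiple of x_r, which is the
  sum of the variables. This agrees, in positive degree, with the convention that face spaces vanish
  for \<open>card S >= d\<close>.\<close>

lemma Hp_trivial:
  assumes "finite C" "card C \<le> 1" "m \<ge> 1" "\<forall>i\<in>C. e i > -1"
  shows "Hp C e m = {\<lambda>x. 0}"
proof -
  have h0: "f = (\<lambda>x. 0)" if "f \<in> hp {} {m}" for f
    using that by induction (use assms in auto)
  have "P = (\<lambda>x. 0)" if P: "P \<in> Hp C e m" for P
  proof (cases "C = {}")
    case True
    then show ?thesis using h0 Hp_hp[OF P] by simp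
  next
    case False
    then obtain r where r: "C = {r}" using assms(1,2) by (metis One_nat_def card_1_singletonE card_gt_0_iff le_antisym Suc_leI)
    show ?thesis
    proof (rule Hp_eq_zeroI[of C r e P m])
      fix R assume "R \<in> hp (C - {r}) {m}"
      then have "R = (\<lambda>x. 0)" using r h0 by simp
      then show "Lag C e (\<lambda>x. P x * R x) = 0" by (simp add: Lag_zero)
    qed (use r P assms in auto)
  qed
  then show ?thesis using Hp_zero by blast
qed

section \<open>Rodrigues formulas\<close>

definition rho :: "nat \<Rightarrow> (nat \<Rightarrow> real) \<Rightarrow> nat \<Rightarrow> fn \<Rightarrow> fn" where
  "rho r \<sigma> i P = (\<lambda>x. (\<sigma> i * x r - \<sigma> r * x i) * P x + x i * x r * Dd r i P x)"

definition raise2 :: "nat \<Rightarrow> nat \<Rightarrow> (nat \<Rightarrow> real) \<Rightarrow> nat \<Rightarrow> real" where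
  "raise2 r i e = (\<lambda>j. if j = i \<or> j = r then e j + 1 else e j)"

text \<open>Each letter i of the list stands for one application of the derivation D i;
  rho is its action on the polynomial factor when the exponents of the variables i and r drop by 1.\<close>

fun rodrigues :: "nat \<Rightarrow> (nat \<Rightarrow> real) \<Rightarrow> nat list \<Rightarrow> fn" where
  "rodrigues r e [] = (\<lambda>x. 1)"
| "rodrigues r e (i # L) = rho r (raise2 r i e) i (rodrigues r (raise2 r i e) L)"

text \<open>The exponents of the power product from which the Rodrigues formula starts.\<close>

fun rodrigues_exps :: "nat \<Rightarrow> (nat \<Rightarrow> real) \<Rightarrow> nat list \<Rightarrow> nat \<Rightarrow> real" where
  "rodrigues_exps r e [] = e"
| "rodrigues_exps r e (i # L) = rodrigues_exps r (raise2 r i e) L"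

text \<open>For a word with \<open>mm i\<close> letters i these are the exponents in
  \<open>Rfun\<close>: \<open>e i + mm i\<close>, and at r the number \<open>e r\<close> plus the
  total degree.\<close>

lemma rodrigues_exps_eq:
  assumes "r \<notin> set L"
  shows "rodrigues_exps r e L j = e j + real (count_list L j) + (if j = r then real (length L) else 0)"
  using assms by (induction L arbitrary: e) (auto simp: raise2_def)

lemma rodrigues_exps_ge: "rodrigues_exps r e L j \<ge> e j"
proof (induction L arbitrary: e)
  case (Cons i L)
  have "raise2 r i e j \<ge> e j" by (simp add: raise2_def)
  then show ?case using Cons[of "raise2 r i e"] by simp
qed simp

lemma rodrigues_hp:
  assumes "finite C" "r \<in> C" "set L \<subseteq> C"
  shows "rodrigues r e L \<in> hp C {length L}"
  using assms(3)
proof (induction L arbitrary: e)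
  case Nil
  then show ?case by (simp add: hp_const)
next
  case (Cons i L)
  let ?s = "raise2 r i e" and ?P = "rodrigues r (raise2 r i e) L"
  have P: "?P \<in> hp C {length L}" using Cons by simp
  have v: "(\<lambda>x. x i) \<in> hp C {1}" "(\<lambda>x. x r) \<in> hp C {1}"
    using assms Cons.prems by (auto intro: hp_var)
  have 1: "(\<lambda>x. (?s i * x r - ?s r * x i) * ?P x) \<in> hp C {Suc (length L)}"
    by (rule hp_mult[OF hp_diff[OF hp_scale[OF v(2)] hp_scale[OF v(1)]] P]) auto
  have "(\<lambda>x. x i * x r) \<in> hp C {2}" by (rule hp_mult[OF v]) auto
  then have 2: "(\<lambda>x. x i * x r * Dd r i ?P x) \<in> hp C {Suc (length L)}"
    by (rule hp_mult[OF _ hp_Dd[OF P assms(1), of "{n. n + 1 = length L}"]]) auto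
  show ?case using hp_add[OF 1 2] by (simp add: rho_def)
qed

text \<open>Integrations by parts in x_i and in x_r, each with the other variable as a spare factor;
  their exponential terms cancel. Up to sign, \<open>rho\<close> is thus the adjoint of
  \<open>Dd r i\<close>, the weight gaining a factor x_i x_r.\<close>

lemma Lag_rho:
  assumes C: "finite C" "i \<in> C" "r \<in> C" "i \<noteq> r" and e: "\<forall>i\<in>C. e i > -1" and P: "pol P" "pol Q"
  shows "Lag C e (\<lambda>x. rho r (raise2 r i e) i P x * Q x) = - Lag C (raise2 r i e) (\<lambda>x. P x * Dd r i Q x)"
proof -
  have pD: "pol (Dd r i P)" "pol (Dd r i Q)" using P by (auto intro: pol_Dd)
  let ?R = "\<lambda>x. P x * Q x"
  have e1: "raise2 r i e i = e i + 1" "raise2 r i e r = e r + 1" by (auto simp: raise2_def)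
  have i: "Lag C e (\<lambda>x. x r * pd i (\<lambda>x. x i * ?R x) x) = Lag C e (\<lambda>x. (x i - e i) * (x r * ?R x))"
  proof -
    have "pd i (\<lambda>x. x i * (x r * ?R x)) = (\<lambda>x. x r * pd i (\<lambda>x. x i * ?R x) x)"
      using C(4) P by (simp add: pd_mult pd_var pol_simps algebra_simps)
    then show ?thesis using Lag_ibp[OF C(1) e C(2), of "\<lambda>x. x r * ?R x"] P by (simp add: pol_simps)
  qed
  have r: "Lag C e (\<lambda>x. x i * pd r (\<lambda>x. x r * ?R x) x) = Lag C e (\<lambda>x. (x r - e r) * (x i * ?R x))"
  proof -
    have "pd r (\<lambda>x. x r * (x i * ?R x)) = (\<lambda>x. x i * pd r (\<lambda>x. x r * ?R x) x)"
      using C(4) P by (simp add: pd_mult pd_var pol_simps algebra_simps)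
    then show ?thesis using Lag_ibp[OF C(1) e C(3), of "\<lambda>x. x i * ?R x"] P by (simp add: pol_simps)
  qed
  have "Lag C e (\<lambda>x. rho r (raise2 r i e) i P x * Q x) =
     Lag C e (\<lambda>x. ((x r * pd i (\<lambda>x. x i * ?R x) x - x i * pd r (\<lambda>x. x r * ?R x) x)
        + (e i * (x r * ?R x) - e r * (x i * ?R x))) - x i * x r * (P x * Dd r i Q x))"
    using P by (intro Lag_cong) (simp add: rho_def e1 Dd_def pd_mult pd_var pol_simps algebra_simps)
  also have "\<dots> = (Lag C e (\<lambda>x. (x i - e i) * (x r * ?R x)) - Lag C e (\<lambda>x. (x r - e r) * (x i * ?R x)))
      + Lag C e (\<lambda>x. e i * (x r * ?R x) - e r * (x i * ?R x)) - Lag C e (\<lambda>x. x i * x r * (P x * Dd r i Q x))"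
    unfolding i[symmetric] r[symmetric] using P pD
    by (simp add: Lag_add[OF C(1) e] Lag_diff[OF C(1) e] pol_simps)
  also have "Lag C e (\<lambda>x. (x i - e i) * (x r * ?R x)) - Lag C e (\<lambda>x. (x r - e r) * (x i * ?R x)) =
      Lag C e (\<lambda>x. (x i - e i) * (x r * ?R x) - (x r - e r) * (x i * ?R x))"
    using P by (simp add: Lag_diff[OF C(1) e] pol_simps)
  also have "\<dots> = Lag C e (\<lambda>x. - (e i * (x r * ?R x) - e r * (x i * ?R x)))"
    by (intro Lag_cong) (simp add: algebra_simps)
  also have "\<dots> + Lag C e (\<lambda>x. e i * (x r * ?R x) - e r * (x i * ?R x)) = 0"
    by (simp only: Lag_uminus)
  also have "Lag C e (\<lambda>x. x i * x r * (P x * Dd r i Q x)) = Lag C (raise2 r i e) (\<lambda>x. P x * Dd r i Q x)"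
  proof -
    have "(\<lambda>j. if j \<in> {i, r} then e j + 1 else e j) = raise2 r i e" by (auto simp: raise2_def)
    then show ?thesis
      using Lag_shift[OF C(1), of "{i, r}" e "\<lambda>x. P x * Dd r i Q x"] C by simp
  qed
  finally show ?thesis by simp
qed

text \<open>\<open>Lag_rho\<close> is applied to the outermost letter first, so Q is differentiated
  in the order of the list, hence \<open>fold\<close> rather than \<open>foldr\<close>.\<close>

lemma Lag_rod:
  assumes C: "finite C" "r \<in> C" and L: "set L \<subseteq> C - {r}" and e: "\<forall>i\<in>C. e i > -1" and Q: "pol Q"
  shows "Lag C e (\<lambda>x. rodrigues r e L x * Q x) = (-1) ^ length L * Lag C (rodrigues_exps r e L) (fold (Dd r) L Q)"
  using L e Q
proof (induction L arbitrary: e Q)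
  case (Cons i L)
  have e': "\<forall>j\<in>C. raise2 r i e j > -1" using Cons.prems(2) by (force simp: raise2_def)
  have "pol (rodrigues r (raise2 r i e) L)"
    using rodrigues_hp[OF C, of L "raise2 r i e"] Cons.prems(1) hp_imp_pol by auto
  then have "Lag C e (\<lambda>x. rodrigues r e (i # L) x * Q x) = - Lag C (raise2 r i e) (\<lambda>x. rodrigues r (raise2 r i e) L x * Dd r i Q x)"
    using Lag_rho[OF C(1) _ C(2) _ Cons.prems(2)] Cons.prems by simp
  then show ?case using Cons.IH[OF _ e' pol_Dd[OF Cons.prems(3)]] Cons.prems(1) by simp
qed simp

lemma fold_Dd_zero:
  assumes "finite C" "Q \<in> hp C {..<length L}"
  shows "fold (Dd r) L Q = (\<lambda>x. 0)"
  using assms(2)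
proof (induction L arbitrary: Q)
  case Nil
  then show ?case using hp_empty_degrees by simp
next
  case (Cons i L)
  have "Dd r i Q \<in> hp C {..<length L}"
    by (rule hp_Dd[OF Cons.prems assms(1)]) auto
  then show ?case using Cons.IH by simp
qed

lemma rodrigues_Hp:
  assumes C: "finite C" "r \<in> C" and L: "set L \<subseteq> C - {r}" and e: "\<forall>i\<in>C. e i > -1"
  shows "rodrigues r e L \<in> Hp C e (length L)"
proof -
  have "Lag C e (\<lambda>x. rodrigues r e L x * Q x) = 0" if "Q \<in> hp C {..<length L}" for Q
    using Lag_rod[OF C L e hp_imp_pol[OF that]] fold_Dd_zero[OF C(1) that] by (simp add: Lag_zero)
  then show ?thesis using rodrigues_hp[OF C] L by (auto simp: Hp_def)
qed

lemma Dd_scale_mon: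
  assumes "finite A" "r \<notin> A" "j \<in> A"
  shows "Dd r j (\<lambda>x. k * mon A b x) = (\<lambda>x. (k * real (b j)) * mon A (b(j := b j - 1)) x)"
proof -
  have "pd r (mon A b) = (\<lambda>x. 0)"
    using pd_hp_indep[of "mon A b" A UNIV r] hp_monomial[of b A UNIV 1] assms by simp
  then show ?thesis using assms by (simp add: Dd_def pd_scale pol_mon pd_mon mult.assoc)
qed

lemma fold_Dd_mon_zero:
  assumes A: "finite A" "r \<notin> A" and L: "set L \<subseteq> A" and i: "i \<in> A" "count_list L i > b i"
  shows "fold (Dd r) L (\<lambda>x. k * mon A b x) = (\<lambda>x. 0)"
  using L i(2)
proof (induction L arbitrary: b k)
  case (Cons j L)
  have z: "fold (Dd r) L (\<lambda>x. 0) = (\<lambda>x. 0)"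
    by (induction L) (simp_all add: Dd_const)
  show ?case
  proof (cases "b j = 0")
    case True
    then show ?thesis using Cons.prems by (simp add: Dd_scale_mon[OF A] z)
  next
    case False
    then have "count_list L i > (b(j := b j - 1)) i" using Cons.prems by (auto split: if_splits)
    then show ?thesis using Cons.IH[of "b(j := b j - 1)"] Cons.prems(1)
      by (simp add: Dd_scale_mon[OF A] del: fun_upd_apply)
  qed
qed simp

lemma fold_Dd_mon_const:
  assumes A: "finite A" "r \<notin> A" and L: "set L \<subseteq> A" and b: "\<forall>i\<in>A. count_list L i = b i"
  shows "\<exists>c>0. \<forall>k. fold (Dd r) L (\<lambda>x. k * mon A b x) = (\<lambda>x. k * c)"
  using L b
proof (induction L arbitrary: b)
  case Nil
  then have "mon A b = (\<lambda>x. 1)" by (auto simp: mon_def)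
  then show ?case by (intro exI[of _ 1]) simp
next
  case (Cons j L)
  let ?b = "b(j := b j - 1)"
  have j: "j \<in> A" "b j > 0" using Cons.prems by auto
  have "\<forall>i\<in>A. count_list L i = ?b i"
  proof
    fix i assume "i \<in> A"
    then have "count_list (j # L) i = b i" using Cons.prems by blast
    then show "count_list L i = ?b i" by (auto split: if_splits)
  qed
  then obtain c where c: "c > 0" "\<forall>k. fold (Dd r) L (\<lambda>x. k * mon A ?b x) = (\<lambda>x. k * c)"
    using Cons.IH[of ?b] Cons.prems(1) by (auto simp del: fun_upd_apply)
  then have "fold (Dd r) (j # L) (\<lambda>x. k * mon A b x) = (\<lambda>x. k * (real (b j) * c))" for k
  proof -
    have "fold (Dd r) (j # L) (\<lambda>x. k * mon A b x) = fold (Dd r) L (\<lambda>x. (k * real (b j)) * mon A ?b x)"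
      by (simp only: fold_simps Dd_scale_mon[OF A j(1)])
    also have "\<dots> = (\<lambda>x. (k * real (b j)) * c)" using c(2) by blast
    finally show ?thesis by (simp only: mult.assoc)
  qed
  then show ?case using c(1) j(2) by (intro exI[of _ "real (b j) * c"]) auto
qed

definition replicate_list :: "nat set \<Rightarrow> (nat \<Rightarrow> nat) \<Rightarrow> nat list" where
  "replicate_list A mm = concat (map (\<lambda>i. replicate (mm i) i) (sorted_list_of_set A))"

lemma count_list_replicate: "count_list (replicate n i) j = (if i = j then n else 0)"
  by (induction n) auto

lemma replicate_list_props:
  assumes "finite A"
  shows "set (replicate_list A mm) \<subseteq> A" "length (replicate_list A mm) = sum mm A" "i \<in> A \<Longrightarrow> count_list (replicate_list A mm) i = mm i"
proof -
  have "count_list (concat (map (\<lambda>i. replicate (mm i) i) xs)) i = (if i \<in> set xs then mm i else 0)" if "distinct xs" for xs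
    using that by (induction xs) (auto simp: count_list_replicate)
  then show "i \<in> A \<Longrightarrow> count_list (replicate_list A mm) i = mm i" using assms by (simp add: replicate_list_def)
  have "length (concat (map (\<lambda>i. replicate (mm i) i) xs)) = sum mm (set xs)" if "distinct xs" for xs
    using that by (induction xs) auto
  then show "length (replicate_list A mm) = sum mm A" using assms by (simp add: replicate_list_def)
  show "set (replicate_list A mm) \<subseteq> A" using assms by (auto simp: replicate_list_def)
qed

lemma finite_Hidx: "finite A \<Longrightarrow> finite (Hidx A m)"
proof -
  assume A: "finite A"
  have "Hidx A m \<subseteq> {f. \<forall>x. (x \<in> A \<longrightarrow> f x \<in> {0..m}) \<and> (x \<notin> A \<longrightarrow> f x = 0)}"
    using A by (auto simp: Hidx_def member_le_sum)
  moreover have "finite \<dots>" by (rule finite_set_of_finite_funs) (use A in auto)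
  ultimately show ?thesis by (rule finite_subset)
qed

text \<open>The Rodrigues polynomials are biorthogonal to the monomials without the variable r,
  and these monomials together with the multiples of the sum of the variables span everything.\<close>

lemma Hp_eq_rod_combination:
  assumes C: "finite C" "r \<in> C" and e: "\<forall>i\<in>C. e i > -1" and P: "P \<in> Hp C e m"
  shows "\<exists>c. P = (\<lambda>x. \<Sum>mm\<in>Hidx (C - {r}) m. c mm * rodrigues r e (replicate_list (C - {r}) mm) x)"
proof -
  let ?A = "C - {r}" and ?I = "Hidx (C - {r}) m"
  let ?R = "\<lambda>mm. rodrigues r e (replicate_list (C - {r}) mm)"
  have A: "finite ?A" "r \<notin> ?A" using C by auto
  note lp = replicate_list_props[OF A(1)]
  have RH: "?R mm \<in> Hp C e m" if "mm \<in> ?I" for mm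
    using rodrigues_Hp[OF C lp(1) e, of mm] lp(2)[of mm] that by (simp add: Hidx_def)
  have pR: "pol (?R mm)" if "mm \<in> ?I" for mm by (rule hp_imp_pol[OF Hp_hp[OF RH[OF that]]])
  have pP: "pol P" by (rule hp_imp_pol[OF Hp_hp[OF P]])
  let ?k = "\<lambda>mm b. Lag C e (\<lambda>x. ?R mm x * mon ?A b x)"
  have k: "?k mm b = (-1) ^ length (replicate_list ?A mm) * Lag C (rodrigues_exps r e (replicate_list ?A mm)) (fold (Dd r) (replicate_list ?A mm) (\<lambda>x. 1 * mon ?A b x))" for mm b
    using Lag_rod[OF C lp(1) e pol_mon[of ?A b], of mm] by simp
  \<comment> \<open>Two different multi-indices of the same total degree: mm exceeds b in some
    variable, and the derivatives in that variable kill the monomial.\<close>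
  have k0: "?k mm b = 0" if "mm \<in> ?I" "b \<in> ?I" "mm \<noteq> b" for mm b
  proof -
    have "\<exists>i\<in>?A. mm i > b i"
    proof (rule ccontr)
      assume "\<not> ?thesis"
      then have le: "\<forall>i\<in>?A. mm i \<le> b i" by (meson linorder_not_less)
      have "\<forall>i\<in>?A. mm i = b i"
      proof (rule ccontr)
        assume "\<not> ?thesis"
        then have "\<exists>i\<in>?A. mm i < b i" using le by (meson le_neq_implies_less)
        then have "sum mm ?A < sum b ?A" using le A(1) by (intro sum_strict_mono_ex1) auto
        then show False using that by (simp add: Hidx_def)
      qed
      moreover have "mm i = b i" if "i \<notin> ?A" for i
        using that \<open>mm \<in> ?I\<close> \<open>b \<in> ?I\<close> unfolding Hidx_def by simp
      ultimately have "mm = b" by blast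
      then show False using that by simp
    qed
    then obtain i where "i \<in> ?A" "mm i > b i" by blast
    then have "fold (Dd r) (replicate_list ?A mm) (\<lambda>x. 1 * mon ?A b x) = (\<lambda>x. 0)"
      using fold_Dd_mon_zero[OF A lp(1)] lp(3) by metis
    then show ?thesis unfolding k by (simp add: Lag_zero)
  qed
  have k1: "?k mm mm \<noteq> 0" if "mm \<in> ?I" for mm
  proof -
    obtain c where "c > 0" "fold (Dd r) (replicate_list ?A mm) (\<lambda>x. 1 * mon ?A mm x) = (\<lambda>x. 1 * c)"
      using fold_Dd_mon_const[OF A lp(1), of mm mm] lp(3) by blast
    moreover have "Lag C (rodrigues_exps r e (replicate_list ?A mm)) (\<lambda>x. 1 * c) > 0" if "c > 0" for c
    proof -
      have t: "\<forall>i\<in>C. rodrigues_exps r e (replicate_list ?A mm) i > -1" using e rodrigues_exps_ge by (metis less_le_trans)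
      have "mon C (\<lambda>_. 0) = (\<lambda>x. 1)" by (auto simp: mon_def)
      then have "Lag C (rodrigues_exps r e (replicate_list ?A mm)) (\<lambda>x. c * 1) = c * (\<Prod>i\<in>C. Gamma (rodrigues_exps r e (replicate_list ?A mm) i + 1))"
        using Lag_mon[OF C(1) t, of "\<lambda>_. 0"] Lag_scale[of C _ c "\<lambda>_. 1"] by simp
      moreover have "\<dots> > 0" using that t by (intro mult_pos_pos prod_pos Gamma_real_pos) force+
      ultimately show ?thesis by simp
    qed
    ultimately have "Lag C (rodrigues_exps r e (replicate_list ?A mm)) (fold (Dd r) (replicate_list ?A mm) (\<lambda>x. 1 * mon ?A mm x)) \<noteq> 0"
      by (metis less_irrefl)
    then show ?thesis unfolding k by simp
  qed
  \<comment> \<open>The pairings of P with the monomials, divided by the diagonal entries of the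
    biorthogonal system; with these coefficients the difference is orthogonal to all monomials
    without x_r.\<close>
  define c where "c = (\<lambda>mm. Lag C e (\<lambda>x. P x * mon ?A mm x) / ?k mm mm)"
  let ?S = "\<lambda>x. \<Sum>mm\<in>?I. c mm * ?R mm x"
  let ?Q = "\<lambda>x. P x + (-1) * ?S x"
  have Q: "?Q \<in> Hp C e m"
    by (intro Hp_add[OF C(1) e] Hp_scale Hp_sum[OF C(1) e] P RH)
  have Qm: "Lag C e (\<lambda>x. ?Q x * mon ?A b x) = 0" if b: "b \<in> ?I" for b
  proof -
    have "Lag C e (\<lambda>x. ?Q x * mon ?A b x) = Lag C e (\<lambda>x. P x * mon ?A b x - (\<Sum>mm\<in>?I. c mm * (?R mm x * mon ?A b x)))"
      by (simp add: left_diff_distrib sum_distrib_right mult.assoc)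
    also have "\<dots> = Lag C e (\<lambda>x. P x * mon ?A b x) - (\<Sum>mm\<in>?I. c mm * ?k mm b)"
    proof (subst Lag_diff[OF C(1) e])
      show "pol (\<lambda>x. P x * mon ?A b x)" using pP by (intro pol_simps) (simp add: pol_mon)
      show "pol (\<lambda>x. \<Sum>mm\<in>?I. c mm * (?R mm x * mon ?A b x))"
        using pR by (intro pol_sum pol_mult pol_const) (auto simp: pol_mon)
      have "Lag C e (\<lambda>x. \<Sum>mm\<in>?I. c mm * (?R mm x * mon ?A b x)) = (\<Sum>mm\<in>?I. Lag C e (\<lambda>x. c mm * (?R mm x * mon ?A b x)))"
        using pR by (intro Lag_sum[OF C(1) e] pol_mult pol_const) (auto simp: pol_mon)
      then show "Lag C e (\<lambda>x. P x * mon ?A b x) - Lag C e (\<lambda>x. \<Sum>mm\<in>?I. c mm * (?R mm x * mon ?A b x)) =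
          Lag C e (\<lambda>x. P x * mon ?A b x) - (\<Sum>mm\<in>?I. c mm * ?k mm b)" by (simp only: Lag_scale)
    qed
    also have "(\<Sum>mm\<in>?I. c mm * ?k mm b) = c b * ?k b b"
    proof -
      have "(\<Sum>mm\<in>?I. c mm * ?k mm b) = (\<Sum>mm\<in>{b}. c mm * ?k mm b)"
        by (rule sum.mono_neutral_right) (use b k0 finite_Hidx[OF A(1)] in auto)
      then show ?thesis by simp
    qed
    finally show ?thesis using k1[OF b] by (simp add: c_def)
  qed
  have "?Q = (\<lambda>x. 0)"
  proof (rule Hp_eq_zeroI[OF C e Q])
    fix R assume "R \<in> hp ?A {m}"
    then show "Lag C e (\<lambda>x. ?Q x * R x) = 0"
    proof induction
      case zero
      then show ?case by (simp add: Lag_zero)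
    next
      case (step f a k)
      let ?a = "\<lambda>i. if i \<in> ?A then a i else 0"
      have "?a \<in> ?I" using step(2) by (simp add: Hidx_def)
      moreover have "mon ?A a = mon ?A ?a" by (auto simp: mon_def intro!: prod.cong)
      ultimately have z: "Lag C e (\<lambda>x. ?Q x * mon ?A a x) = 0" using Qm by simp
      have pQ: "pol ?Q" by (rule hp_imp_pol[OF Hp_hp[OF Q]])
      have "Lag C e (\<lambda>x. ?Q x * (f x + k * mon ?A a x)) = Lag C e (\<lambda>x. ?Q x * f x + k * (?Q x * mon ?A a x))"
        by (simp only: distrib_left mult.left_commute[of _ k])
      also have "\<dots> = Lag C e (\<lambda>x. ?Q x * f x) + k * Lag C e (\<lambda>x. ?Q x * mon ?A a x)"
        by (subst Lag_add[OF C(1) e pol_mult[OF pQ hp_imp_pol[OF step(1)]]])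
          (rule pol_mult[OF pol_const pol_mult[OF pQ pol_mon]], simp only: Lag_scale)
      finally show ?case using z step(3) by simp
    qed
  qed
  then have "P x = ?S x" for x using fun_cong[of ?Q "\<lambda>x. 0" x] by simp
  then show ?thesis by blast
qed

section \<open>Rodrigues formulas on the open simplex and identification of the spaces V and
  H\<close>

lemma tsimplex_int_pos: "x \<in> tsimplex_int d \<Longrightarrow> j \<in> {1..d+1} \<Longrightarrow> xx d x j > 0"
  by (auto simp: tsimplex_int_def xx_def)

text \<open>The power product with exponents sigma, written with exp and ln to ease differentiation.\<close>

definition Ew :: "nat \<Rightarrow> nat set \<Rightarrow> (nat \<Rightarrow> real) \<Rightarrow> fn" where
  "Ew d C \<sigma> x = exp (\<Sum>j\<in>C. \<sigma> j * ln (xx d x j))"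

lemma Ew_powr:
  assumes "x \<in> tsimplex_int d" "finite C" "C \<subseteq> {1..d+1}"
  shows "(\<Prod>j\<in>C. xx d x j powr \<sigma> j) = Ew d C \<sigma> x"
proof -
  have "xx d x j powr \<sigma> j = exp (\<sigma> j * ln (xx d x j))" if "j \<in> C" for j
    using tsimplex_int_pos[OF assms(1), of j] that assms(3) by (auto simp: powr_def)
  then show ?thesis using assms(2) by (simp add: Ew_def exp_sum)
qed

text \<open>s is the list of logarithmic derivatives of the power product; moving x_i changes the
  barycentric coordinates i and \<open>d + 1\<close> in opposite directions. For
  \<open>i = d + 1\<close> both sides are 0. Since derivatives are local, g has to be known only on
  the open simplex.\<close>

lemma pdx_Ew:
  assumes C: "finite C" "C \<subseteq> {1..d+1}" and i: "i \<in> {1..d+1}" and P: "pol P"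
    and g: "\<And>x. x \<in> tsimplex_int d \<Longrightarrow> g x = Ew d C \<sigma> x * P (xx d x)" and x: "x \<in> tsimplex_int d"
  defines "s \<equiv> \<lambda>j. if j \<in> C then \<sigma> j / xx d x j else 0"
  shows "pdx d i g x = Ew d C \<sigma> x * ((s i - s (d+1)) * P (xx d x) + Dd (d+1) i P (xx d x))"
proof (cases "i = d + 1")
  case True
  then show ?thesis by (simp add: pdx_def Dd_def)
next
  case False
  then have id: "i \<in> {1..d}" using i by auto
  have E: "((\<lambda>t. Ew d C \<sigma> (x(i := t))) has_real_derivative Ew d C \<sigma> x * (s i - s (d+1))) (at (x i))"
  proof -
    have l: "((\<lambda>t. ln (xx d (x(i := t)) j)) has_real_derivative
        (if j = i then 1 else if j = d + 1 then -1 else 0) / xx d x j) (at (x i))" if "j \<in> C" for j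
    proof -
      have "((\<lambda>t. xx d x j + (if j = i then t - x i else if j = d + 1 then x i - t else 0)) has_real_derivative
        (if j = i then 1 else if j = d + 1 then -1 else 0)) (at (x i))"
        by (auto intro!: derivative_eq_intros)
      moreover have "xx d x j > 0" using tsimplex_int_pos[OF x] that C by auto
      ultimately show ?thesis unfolding xx_upd[OF id]
        by (auto intro!: derivative_eq_intros simp: divide_inverse)
    qed
    have "((\<lambda>t. exp (\<Sum>j\<in>C. \<sigma> j * ln (xx d (x(i := t)) j))) has_real_derivative
        exp (\<Sum>j\<in>C. \<sigma> j * ln (xx d (x(i := x i)) j)) *
        (\<Sum>j\<in>C. \<sigma> j * ((if j = i then 1 else if j = d + 1 then -1 else 0) / xx d x j))) (at (x i))"
      by (intro DERIV_fun_exp DERIV_sum DERIV_cmult l)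
    moreover have "(\<Sum>j\<in>C. \<sigma> j * ((if j = i then 1 else if j = d + 1 then -1 else 0) / xx d x j)) = s i - s (d+1)"
    proof -
      have "(\<Sum>j\<in>C. \<sigma> j * ((if j = i then 1 else if j = d + 1 then -1 else 0) / xx d x j)) =
        (\<Sum>j\<in>C. (if j = i then s j else 0) - (if j = d + 1 then s j else 0))"
        by (rule sum.cong) (use False in \<open>auto simp: s_def\<close>)
      also have "\<dots> = s i - s (d+1)" using C by (simp add: sum_subtractf s_def)
      finally show ?thesis .
    qed
    ultimately show ?thesis by (simp add: Ew_def)
  qed
  have "((\<lambda>t. Ew d C \<sigma> (x(i := t)) * P (xx d (x(i := t)))) has_real_derivative
      Ew d C \<sigma> x * (s i - s (d+1)) * P (xx d x) + Dd (d+1) i P (xx d x) * Ew d C \<sigma> x) (at (x i))"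
    using DERIV_mult[OF E pol_chain[OF P id, of x]] by simp
  then have "((\<lambda>t. g (x(i := t))) has_real_derivative
      Ew d C \<sigma> x * (s i - s (d+1)) * P (xx d x) + Dd (d+1) i P (xx d x) * Ew d C \<sigma> x) (at (x i))"
  proof (rule has_field_derivative_transform_within_open)
    \<comment> \<open>The values of t for which the moved point stays in the open simplex.\<close>
    let ?S = "{t. 0 < t \<and> t < x i + (1 - (\<Sum>j\<in>{1..d}. x j))}"
    show "open ?S" by (intro open_Collect_conj open_Collect_less continuous_intros)
    show "x i \<in> ?S" using x id by (auto simp: tsimplex_int_def)
    fix t assume t: "t \<in> ?S"
    have "(\<Sum>j\<in>{1..d}. (x(i := t)) j) = t + (\<Sum>j\<in>{1..d} - {i}. x j)"
      using id by (simp add: sum.remove)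
    moreover have "(\<Sum>j\<in>{1..d}. x j) = x i + (\<Sum>j\<in>{1..d} - {i}. x j)"
      using id by (simp add: sum.remove)
    ultimately have "x(i := t) \<in> tsimplex_int d"
      using t x by (auto simp: tsimplex_int_def)
    then show "Ew d C \<sigma> (x(i := t)) * P (xx d (x(i := t))) = g (x(i := t))" by (simp add: g)
  qed
  then have "pd i g x = Ew d C \<sigma> x * (s i - s (d+1)) * P (xx d x) + Dd (d+1) i P (xx d x) * Ew d C \<sigma> x"
    by (rule pd_eqI)
  then show ?thesis using id by (simp add: pdx_def algebra_simps)
qed

text \<open>The contributions of the coordinate \<open>d + 1\<close> to the two partial derivatives
  cancel, so r may be any vertex of the face. Clearing the denominators x_i and x_r uses up the two
  exponents that \<open>raise2\<close> had added.\<close>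

lemma Dop_Ew:
  assumes C: "finite C" "C \<subseteq> {1..d+1}" and ir: "i \<in> C" "r \<in> C" "i \<noteq> r" and P: "pol P"
    and g: "\<And>x. x \<in> tsimplex_int d \<Longrightarrow> g x = Ew d C (raise2 r i e) x * P (xx d x)" and x: "x \<in> tsimplex_int d"
  shows "Dop d r i g x = Ew d C e x * rho r (raise2 r i e) i P (xx d x)"
proof -
  let ?s = "raise2 r i e" and ?X = "xx d x"
  have pos: "?X i > 0" "?X r > 0" using tsimplex_int_pos[OF x] ir C by auto
  have "Dop d r i g x = Ew d C ?s x * ((?s i / ?X i - ?s r / ?X r) * P ?X + Dd r i P ?X)"
  proof -
    define t where "t = (\<lambda>j. if j \<in> C then ?s j / ?X j else 0)"
    have V: "i \<in> {1..d+1}" "r \<in> {1..d+1}" using ir C(2) by auto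
    have "Dop d r i g x = Ew d C ?s x * ((t i - t (d+1)) * P ?X + Dd (d+1) i P ?X) -
        Ew d C ?s x * ((t r - t (d+1)) * P ?X + Dd (d+1) r P ?X)"
      using pdx_Ew[OF C V(1) P g x] pdx_Ew[OF C V(2) P g x] by (simp add: Dop_def t_def)
    also have "\<dots> = Ew d C ?s x * ((t i - t r) * P ?X + (Dd (d+1) i P ?X - Dd (d+1) r P ?X))"
      by (simp only: right_diff_distrib[symmetric]) (simp add: algebra_simps)
    finally show ?thesis using ir by (simp add: t_def Dd_def)
  qed
  also have "Ew d C ?s x = Ew d C e x * (?X i * ?X r)"
  proof -
    have "(\<Sum>j\<in>C. ?s j * ln (?X j)) = (\<Sum>j\<in>C. e j * ln (?X j) + ((if j = i then ln (?X j) else 0) + (if j = r then ln (?X j) else 0)))"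
      using ir(3) by (intro sum.cong) (auto simp: raise2_def algebra_simps)
    also have "\<dots> = (\<Sum>j\<in>C. e j * ln (?X j)) + (ln (?X i) + ln (?X r))"
      using ir C by (simp add: sum.distrib)
    finally show ?thesis using pos by (simp add: Ew_def exp_add)
  qed
  finally have D: "Dop d r i g x = Ew d C e x *
      ((?s i / ?X i - ?s r / ?X r) * (?X i * ?X r) * P ?X + ?X i * ?X r * Dd r i P ?X)"
    by (simp only: distrib_left mult_ac)
  have "(?s i / ?X i - ?s r / ?X r) * (?X i * ?X r) = ?s i * ?X r - ?s r * ?X i"
    using pos by (simp add: field_simps)
  then show ?thesis unfolding D rho_def by simp
qed

lemma foldr_Dop_Ew:
  assumes C: "finite C" "C \<subseteq> {1..d+1}" and r: "r \<in> C" and L: "set L \<subseteq> C - {r}"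
    and G: "\<And>x. x \<in> tsimplex_int d \<Longrightarrow> G x = Ew d C (rodrigues_exps r e L) x" and x: "x \<in> tsimplex_int d"
  shows "foldr (Dop d r) L G x = Ew d C e x * rodrigues r e L (xx d x)"
  using L G x
proof (induction L arbitrary: e x)
  case (Cons i L)
  have "pol (rodrigues r (raise2 r i e) L)"
    using rodrigues_hp[OF C(1) r, of L "raise2 r i e"] Cons.prems(1) hp_imp_pol by auto
  moreover have "foldr (Dop d r) L G y = Ew d C (raise2 r i e) y * rodrigues r (raise2 r i e) L (xx d y)"
    if "y \<in> tsimplex_int d" for y
    by (rule Cons.IH) (use Cons.prems that in auto)
  ultimately have "Dop d r i (foldr (Dop d r) L G) x = Ew d C e x * rho r (raise2 r i e) i (rodrigues r (raise2 r i e) L) (xx d x)"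
    using Dop_Ew[OF C _ r, of i "rodrigues r (raise2 r i e) L" "foldr (Dop d r) L G" e x] Cons.prems by auto
  then show ?case by simp
qed simp

lemma foldr_funpow_eq:
  "foldr (\<lambda>i g. (f i ^^ mm i) g) xs G = foldr f (concat (map (\<lambda>i. replicate (mm i) i) xs)) G"
  by (induction xs) (simp_all add: foldr_replicate)

lemma rsel_in:
  assumes "S \<subseteq> {1..d+1}" "card S < d"
  shows "rsel d S \<in> {1..d+1} - S"
proof (cases "d + 1 \<in> S")
  case True
  have "{1..d} - S \<noteq> {}"
  proof
    assume "{1..d} - S = {}"
    then have "card {1..d} \<le> card S"
      using assms(1) finite_subset by (intro card_mono) auto
    then show False using assms(2) by simp
  qed
  then have "Min ({1..d} - S) \<in> {1..d} - S" by (intro Min_in) auto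
  then show ?thesis using True by (auto simp: rsel_def)
qed (simp add: rsel_def)

text \<open>The prefactor of \<open>Rfun\<close> is the inverse of the power product left over after
  all derivatives have acted.\<close>

lemma Rfun_eq_rod:
  assumes S: "S \<subseteq> {1..d+1}" "card S < d" and x: "x \<in> tsimplex_int d"
  shows "Rfun d S e mm x = rodrigues (rsel d S) e (replicate_list (Aset d S) mm) (xx d x)"
proof -
  let ?r = "rsel d S" and ?A = "Aset d S" and ?C = "{1..d+1} - S"
  have r: "?r \<in> ?C" by (rule rsel_in[OF S])
  have A: "?A = ?C - {?r}" by (auto simp: Aset_def)
  have C: "finite ?C" "?C \<subseteq> {1..d+1}" by auto
  have Ar: "?A \<union> {?r} = ?C" "finite ?A" "?r \<notin> ?A" unfolding A using r by blast+
  note lp = replicate_list_props[OF Ar(2), where mm = mm]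
  define G where "G = (\<lambda>x. (\<Prod>i\<in>?A. xx d x i powr (e i + real (mm i))) *
                   xx d x ?r powr (e ?r + real (\<Sum>i\<in>?A. mm i)))"
  have "G y = Ew d ?C (rodrigues_exps ?r e (replicate_list ?A mm)) y" if y: "y \<in> tsimplex_int d" for y
  proof -
    have "?r \<notin> set (replicate_list ?A mm)" using lp(1) Ar(3) by auto
    then have t: "rodrigues_exps ?r e (replicate_list ?A mm) i = e i + real (mm i)" if "i \<in> ?A" for i
      using rodrigues_exps_eq[of ?r "replicate_list ?A mm" e i] lp(3)[OF that] that Ar(3) by auto
    have tr: "rodrigues_exps ?r e (replicate_list ?A mm) ?r = e ?r + real (\<Sum>i\<in>?A. mm i)"
      using rodrigues_exps_eq[of ?r "replicate_list ?A mm" e ?r] lp(2) \<open>?r \<notin> set (replicate_list ?A mm)\<close>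
      by (simp add: count_list_0_iff)
    have "Ew d ?C (rodrigues_exps ?r e (replicate_list ?A mm)) y = (\<Prod>i\<in>?C. xx d y i powr rodrigues_exps ?r e (replicate_list ?A mm) i)"
      by (rule Ew_powr[OF y C, symmetric])
    also have "\<dots> = xx d y ?r powr rodrigues_exps ?r e (replicate_list ?A mm) ?r * (\<Prod>i\<in>?A. xx d y i powr rodrigues_exps ?r e (replicate_list ?A mm) i)"
      unfolding A by (rule prod.remove[OF C(1) r])
    also have "\<dots> = G y"
      unfolding G_def tr by (subst mult.commute) (intro arg_cong2[of _ _ _ _ "(*)"] prod.cong refl, simp add: t)
    finally show ?thesis by simp
  qed
  then have f: "foldr (Dop d ?r) (replicate_list ?A mm) G x = Ew d ?C e x * rodrigues ?r e (replicate_list ?A mm) (xx d x)"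
    using foldr_Dop_Ew[OF C r lp(1)[unfolded A] _ x] unfolding A by blast
  have "(\<Prod>i\<in>?A \<union> {?r}. xx d x i powr (- e i)) = 1 / Ew d ?C e x"
    unfolding Ar(1) Ew_powr[OF x C] by (simp add: Ew_def sum_negf exp_minus field_simps)
  moreover have "Ew d ?C e x > 0" by (simp add: Ew_def)
  ultimately show ?thesis
    unfolding Rfun_def Let_def foldr_funpow_eq G_def[symmetric] replicate_list_def[symmetric] f by (simp only: divide_simps) simp
qed

lemma polys_eqI:
  assumes "f \<in> polys d" "g \<in> polys d" "\<And>x. x \<in> tsimplex_int d \<Longrightarrow> f x = g x"
  shows "f = g"
proof -
  obtain n m where "f \<in> polys_deg d (int n)" "g \<in> polys_deg d (int m)"
    using assms by (auto simp: polys_def)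
  then have "f \<in> hp {1..d} {..max n m}" "g \<in> hp {1..d} {..max n m}"
    unfolding polys_deg_eq_hp by (auto elim: hp_mono)
  then have "(\<lambda>x. f x - g x) \<in> polys_deg d (int (max n m))"
    unfolding polys_deg_eq_hp by (rule hp_diff)
  then obtain P where P: "P \<in> hp {1..d+1} {max n m}" "(\<lambda>x. f x - g x) = (\<lambda>x. P (xx d x))"
    unfolding polys_deg_iff by blast
  have "P (xx d x) = 0" if "x \<in> tsimplex_int d" for x
    using fun_cong[OF P(2), of x] assms(3)[OF that] by simp
  then have "P = (\<lambda>x. 0)" using hp_xx_zero[OF P(1)] by blast
  then have "f x - g x = 0" for x using fun_cong[OF P(2), of x] by simp
  then show ?thesis by auto
qed

lemma hp_xx_polys: "P \<in> hp {1..d+1} {n} \<Longrightarrow> (\<lambda>x. P (xx d x)) \<in> polys d"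
  using polys_deg_iff by (auto simp: polys_def)

text \<open>The Rodrigues functions lie in \<open>Hp\<close> by \<open>rodrigues_Hp\<close> and span
  it by \<open>Hp_eq_rod_combination\<close>; identities on the open simplex determine polynomials.
  The right-hand side is free of r: every admissible choice of r gives the same span.\<close>

lemma Hsp_eq:
  assumes S: "S \<subseteq> {1..d+1}" "card S < d" and e: "\<forall>i\<in>{1..d+1} - S. e i > -1"
  shows "Hsp d S e (int m) = (\<lambda>P x. P (xx d x)) ` Hp ({1..d+1} - S) e m"
proof
  let ?C = "{1..d+1} - S" and ?r = "rsel d S" and ?A = "Aset d S"
  have r: "?r \<in> ?C" by (rule rsel_in[OF S])
  have A: "?A = ?C - {?r}" by (auto simp: Aset_def)
  have C: "finite ?C" by simp
  have Hx: "(\<lambda>x. P (xx d x)) \<in> polys d" if "P \<in> Hp ?C e m" for P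
    using hp_xx_polys[OF hp_superset[OF Hp_hp[OF that]]] by auto
  have Hsp: "Hsp d S e (int m) = {p \<in> polys d. \<exists>c. \<forall>x \<in> tsimplex_int d.
        p x = (\<Sum>mm\<in>Hidx ?A m. c mm * rodrigues ?r e (replicate_list ?A mm) (xx d x))}"
    using S by (simp add: Hsp_def Rfun_eq_rod)
  show "Hsp d S e (int m) \<subseteq> (\<lambda>P x. P (xx d x)) ` Hp ?C e m"
  proof
    fix p assume "p \<in> Hsp d S e (int m)"
    then obtain c where p: "p \<in> polys d"
      "\<And>x. x \<in> tsimplex_int d \<Longrightarrow> p x = (\<Sum>mm\<in>Hidx ?A m. c mm * rodrigues ?r e (replicate_list ?A mm) (xx d x))"
      unfolding Hsp by blast
    let ?Q = "\<lambda>x. \<Sum>mm\<in>Hidx ?A m. c mm * rodrigues ?r e (replicate_list ?A mm) x"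
    have Q: "?Q \<in> Hp ?C e m"
    proof (intro Hp_sum[OF C e] Hp_scale)
      fix mm assume "mm \<in> Hidx ?A m"
      then have "length (replicate_list ?A mm) = m" using replicate_list_props(2)[of ?A mm] A by (simp add: Hidx_def)
      then show "rodrigues ?r e (replicate_list ?A mm) \<in> Hp ?C e m"
        using rodrigues_Hp[OF C r _ e, of "replicate_list ?A mm"] replicate_list_props(1)[of ?A mm] A by auto
    qed
    have "p = (\<lambda>x. ?Q (xx d x))"
      by (rule polys_eqI[OF p(1) Hx[OF Q]]) (use p(2) in auto)
    then show "p \<in> (\<lambda>P x. P (xx d x)) ` Hp ?C e m" by (rule image_eqI[OF _ Q])
  qed
  show "(\<lambda>P x. P (xx d x)) ` Hp ?C e m \<subseteq> Hsp d S e (int m)"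
  proof clarify
    fix P assume P: "P \<in> Hp ?C e m"
    obtain c where "P = (\<lambda>x. \<Sum>mm\<in>Hidx ?A m. c mm * rodrigues ?r e (replicate_list ?A mm) x)"
      using Hp_eq_rod_combination[OF C r e P] unfolding A by blast
    then have "\<forall>x\<in>tsimplex_int d. P (xx d x) = (\<Sum>mm\<in>Hidx ?A m. c mm * rodrigues ?r e (replicate_list ?A mm) (xx d x))"
      by simp
    then show "(\<lambda>x. P (xx d x)) \<in> Hsp d S e (int m)" unfolding Hsp using Hx[OF P] by blast
  qed
qed

text \<open>On homogeneous representatives of degrees m and \<open>m - 1\<close> the form
  \<open>jac_ip\<close> is a positive multiple of \<open>Lag\<close>, and by \<open>HpI\<close>
  these degrees suffice.\<close>

lemma Vsp_eq:
  assumes e: "\<forall>i\<in>{1..d+1}. e i > -1"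
  shows "Vsp d e (int m) = (\<lambda>P x. P (xx d x)) ` Hp {1..d+1} e m"
proof -
  let ?V = "{1..d+1}"
  have V: "finite ?V" "?V \<noteq> {}" by auto
  have pos: "Gamma (real (a + b) + (\<Sum>i\<in>?V. e i + 1)) > 0" for a b :: nat
  proof -
    have "(\<Sum>i\<in>?V. e i + 1) > 0" by (rule sum_pos) (use e in force)+
    then show ?thesis by (intro Gamma_real_pos) auto
  qed
  have "(\<forall>q\<in>polys_deg d (int m - 1). jac_ip d e (\<lambda>x. P (xx d x)) q = 0) \<longleftrightarrow> P \<in> Hp ?V e m"
    if P: "P \<in> hp ?V {m}" for P
  proof (cases m)
    case 0
    have "jac_ip d e f (\<lambda>x. 0) = 0" for f by (simp add: jac_ip_def simp_int_def)
    then have "\<forall>q\<in>polys_deg d (int m - 1). jac_ip d e (\<lambda>x. P (xx d x)) q = 0"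
      using 0 by (simp add: polys_deg_neg)
    moreover have "P \<in> Hp ?V e m" by (rule HpI[OF V e P]) (use 0 in auto)
    ultimately show ?thesis by simp
  next
    case (Suc n)
    then have i: "int m - 1 = int n" by simp
    have j: "jac_ip d e (\<lambda>x. P (xx d x)) (\<lambda>x. Q (xx d x)) = 0 \<longleftrightarrow> Lag ?V e (\<lambda>x. P x * Q x) = 0"
      if "Q \<in> hp ?V {n}" for Q
      using jac_ip_eq_Lag[OF e P that] pos[of m n] by simp
    have "(\<forall>q\<in>polys_deg d (int m - 1). jac_ip d e (\<lambda>x. P (xx d x)) q = 0) \<longleftrightarrow>
      (\<forall>Q\<in>hp ?V {n}. Lag ?V e (\<lambda>x. P x * Q x) = 0)"
      unfolding i polys_deg_eq_xx using j by auto
    also have "\<dots> \<longleftrightarrow> P \<in> Hp ?V e m"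
    proof
      assume "\<forall>Q\<in>hp ?V {n}. Lag ?V e (\<lambda>x. P x * Q x) = 0"
      then show "P \<in> Hp ?V e m" by (intro HpI[OF V e P]) (use Suc in auto)
    next
      assume "P \<in> Hp ?V e m"
      moreover have "hp ?V {n} \<subseteq> hp ?V {..<m}" using hp_mono[of _ ?V "{n}" "{..<m}"] Suc by auto
      ultimately show "\<forall>Q\<in>hp ?V {n}. Lag ?V e (\<lambda>x. P x * Q x) = 0" by (auto simp: Hp_def)
    qed
    finally show ?thesis .
  qed
  note orth = this
  have V: "Vsp d e (int m) = {p \<in> polys_deg d (int m). \<forall>q \<in> polys_deg d (int m - 1). jac_ip d e p q = 0}"
    by (simp add: Vsp_def)
  show ?thesis
  proof
    show "Vsp d e (int m) \<subseteq> (\<lambda>P x. P (xx d x)) ` Hp ?V e m"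
    proof
      fix p assume p: "p \<in> Vsp d e (int m)"
      then obtain P where P: "P \<in> hp ?V {m}" "p = (\<lambda>x. P (xx d x))"
        unfolding V using polys_deg_iff by blast
      have "P \<in> Hp ?V e m" using orth[OF P(1)] p unfolding V P(2) by blast
      then show "p \<in> (\<lambda>P x. P (xx d x)) ` Hp ?V e m" using P(2) by blast
    qed
    show "(\<lambda>P x. P (xx d x)) ` Hp ?V e m \<subseteq> Vsp d e (int m)"
    proof
      fix p assume "p \<in> (\<lambda>P x. P (xx d x)) ` Hp ?V e m"
      then obtain P where P: "P \<in> Hp ?V e m" "p = (\<lambda>x. P (xx d x))" by blast
      then show "p \<in> Vsp d e (int m)"
        unfolding V using orth[OF Hp_hp[OF P(1)]] polys_deg_iff[of p d m] Hp_hp[OF P(1)] by blast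
    qed
  qed
qed

section \<open>The Sobolev inner product\<close>

lemma Gamma_sum_pos:
  assumes "finite C" "C \<noteq> {}" "\<And>i. i \<in> C \<Longrightarrow> e i > -1"
  shows "Gamma (real n + (\<Sum>i\<in>C. e i + 1)) > 0"
proof -
  have "(\<Sum>i\<in>C. e i + 1) > 0" by (rule sum_pos) (use assms in force)+
  then show ?thesis by (intro Gamma_real_pos) auto
qed

text \<open>The truncated subtraction is harmless: with more derivatives than degrees the result is
  0, which lies in every \<open>hp\<close>.\<close>

lemma hp_foldr_Dd:
  assumes "F \<in> hp C {n}" "finite C"
  shows "foldr (Dd r) is F \<in> hp C {n - length is}"
proof (induction "is")
  case (Cons i "is")
  show ?case using hp_Dd[OF Cons assms(2), of "{n - length (i # is)}" r i] by simp
qed (use assms in simp)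

lemma Lag_pow_var:
  assumes "finite C" "i \<in> C"
  shows "Lag C e (\<lambda>x. x i ^ q * f x) = Lag C (e(i := e i + real q)) f"
proof (induction q arbitrary: e)
  case (Suc q)
  have s: "Lag C e (\<lambda>x. x i * g x) = Lag C (e(i := e i + 1)) g" for e g
  proof -
    have "(\<lambda>j. if j \<in> {i} then e j + 1 else e j) = e(i := e i + 1)" by auto
    then show ?thesis using Lag_shift[OF assms(1), of "{i}" e g] assms(2) by simp
  qed
  have "Lag C e (\<lambda>x. x i ^ Suc q * f x) = Lag C (e(i := e i + 1)) (\<lambda>x. x i ^ q * f x)"
    using s[of e "\<lambda>x. x i ^ q * f x"] by (simp add: mult.assoc)
  also have "\<dots> = Lag C (e(i := e i + real (Suc q))) f"
    by (subst Suc) (simp add: add.assoc)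
  finally show ?case .
qed simp

lemma Lag_pow_square:
  assumes "finite C" "i \<in> C" "\<forall>j\<in>C. e j > -1" "pol f"
  shows "Lag C e (\<lambda>x. x i ^ q * (f x * f x)) \<ge> 0"
    and "Lag C e (\<lambda>x. x i ^ q * (f x * f x)) = 0 \<Longrightarrow> f (res C x) = 0"
proof -
  show "Lag C e (\<lambda>x. x i ^ q * (f x * f x)) \<ge> 0"
    unfolding Lag_pow_var[OF assms(1,2)] by (rule Lag_square_nonneg)
  have "\<forall>j\<in>C. (e(i := e i + real q)) j > -1"
  proof
    fix j assume "j \<in> C"
    then have "e j > -1" using assms(3) by blast
    then show "(e(i := e i + real q)) j > -1" by auto
  qed
  then show "f (res C x) = 0" if "Lag C e (\<lambda>x. x i ^ q * (f x * f x)) = 0"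
    using that unfolding Lag_pow_var[OF assms(1,2)] by (intro Lag_square_pos[OF assms(1) _ assms(4)])
qed

lemma simp_int_eq_Lag:
  assumes N: "N \<subseteq> {1..d}" and g: "\<forall>i\<in>N. \<gamma> i > -1" and P: "P \<in> hp {1..d+1} {n}"
  shows "simp_int d (\<lambda>x. P (xx d x) * (\<Prod>i\<in>N. x i powr \<gamma> i)) =
    Lag {1..d+1} (gz N \<gamma>) P / Gamma (real n + (\<Sum>i\<in>{1..d+1}. gz N \<gamma> i + 1))"
proof -
  have "simp_int d (\<lambda>x. P (xx d x) * (\<Prod>i\<in>N. x i powr \<gamma> i)) =
     face_int d {} (\<lambda>x. P (xx d x) * (\<Prod>i\<in>N. x i powr \<gamma> i))"
  proof (rule simp_int_eq_face_int)
    fix x y :: pt assume xy: "\<And>i. i \<in> {1..d} \<Longrightarrow> x i = y i"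
    have "(\<Sum>j\<in>{1..d}. x j) = (\<Sum>j\<in>{1..d}. y j)" by (rule sum.cong) (use xy in auto)
    then have "P (xx d x) = P (xx d y)"
      by (intro hp_indep[OF P]) (use xy in \<open>auto simp: xx_def\<close>)
    moreover have "(\<Prod>i\<in>N. x i powr \<gamma> i) = (\<Prod>i\<in>N. y i powr \<gamma> i)"
      by (rule prod.cong) (use xy N in auto)
    ultimately show "P (xx d x) * (\<Prod>i\<in>N. x i powr \<gamma> i) = P (xx d y) * (\<Prod>i\<in>N. y i powr \<gamma> i)" by simp
  qed
  then show ?thesis using face_int_eq_Lag[of "{}" d N \<gamma> P n] assms by simp
qed

section \<open>Polynomials that are constant along edge directions\<close>

lemma pol_line_deriv:
  assumes "pol F" "i \<noteq> r"
  shows "((\<lambda>s. F (x(i := x i + s, r := x r - s))) has_real_derivative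
    Dd r i F (x(i := x i + s, r := x r - s))) (at s)"
  using assms(1)
proof induction
  case (pol_const c)
  then show ?case by (simp add: Dd_const)
next
  case (pol_var j)
  show ?case unfolding Dd_def pd_var using assms(2) by (auto intro!: derivative_eq_intros)
next
  case (pol_add f g)
  then show ?case by (auto intro!: derivative_eq_intros simp: Dd_add)
next
  case (pol_mult f g)
  then show ?case
    using DERIV_mult[OF pol_mult(3,4)]
    by (simp add: Dd_mult[OF pol_mult(1,2)] add.commute mult.commute del: fun_upd_apply)
qed

lemma Dd_zero_line:
  assumes "pol F" "i \<noteq> r" "Dd r i F = (\<lambda>x. 0)"
  shows "F (x(i := x i + t, r := x r - t)) = F x"
proof -
  have "\<forall>s. ((\<lambda>s. F (x(i := x i + s, r := x r - s))) has_real_derivative 0) (at s)"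
    using pol_line_deriv[OF assms(1,2), of x] assms(3) by metis
  from DERIV_isconst_all[OF this, of t 0] show ?thesis by simp
qed

lemma foldr_Dd_zeroing:
  assumes "i \<notin> set is" "i \<noteq> r"
  shows "foldr (Dd r) is (\<lambda>x. f (x(i := 0))) = (\<lambda>x. foldr (Dd r) is f (x(i := 0)))"
proof -
  have "pd j (\<lambda>x. g (x(i := 0))) = (\<lambda>x. pd j g (x(i := 0)))" if "i \<noteq> j" for j g
    using that by (simp add: pd_def fun_upd_twist)
  then have "Dd r j (\<lambda>x. g (x(i := 0))) = (\<lambda>x. Dd r j g (x(i := 0)))" if "i \<noteq> j" for j g
    using that assms(2) by (simp add: Dd_def)
  then show ?thesis using assms(1) by (induction "is") auto
qed

text \<open>G is constant along the direction of each D i, and each line in this direction meets the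
  facet where the i-th variable vanishes.\<close>

lemma foldr_Dd_zero_imp:
  assumes "pol G" "\<And>i x. i \<in> set is \<Longrightarrow> G (x(i := 0)) = 0" "distinct is" "r \<notin> set is"
    "foldr (Dd r) is G = (\<lambda>x. 0)"
  shows "G = (\<lambda>x. 0)"
  using assms(2-)
proof (induction "is")
  case (Cons i "is")
  let ?H = "foldr (Dd r) is G"
  have ir: "i \<noteq> r" using Cons.prems by auto
  have "(\<lambda>x. ?H (x(i := 0))) = foldr (Dd r) is (\<lambda>x. G (x(i := 0)))"
    by (rule foldr_Dd_zeroing[symmetric]) (use Cons.prems ir in auto)
  also have "(\<lambda>x. G (x(i := 0))) = (\<lambda>x. 0)" using Cons.prems(1) by (simp del: fun_upd_apply)
  also have "foldr (Dd r) is (\<lambda>x. 0) = (\<lambda>x. 0)" by (induction "is") (simp_all add: Dd_const)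
  finally have z: "?H (y(i := 0)) = 0" for y by metis
  have "Dd r i ?H = (\<lambda>x. 0)" using Cons.prems(4) by simp
  \<comment> \<open>A step of \<open>- x i\<close> along the line reaches the facet
    \<open>x i = 0\<close>, where z applies.\<close>
  then have "?H x = 0" for x
    using Dd_zero_line[OF pol_foldr_Dd[OF assms(1)] ir, of r "is" x "- x i"]
      z[of "x(r := x r + x i)"] ir by (simp add: fun_upd_twist)
  then have "?H = (\<lambda>x. 0)" by auto
  then show ?case using Cons by simp
qed simp

locale jacobi =
  fixes d k :: nat and \<gamma> :: "nat \<Rightarrow> real"
  assumes d2: "2 \<le> d" and k1: "1 \<le> k" and kd: "k \<le> d + 1"
    and gam: "\<forall>j\<in>{1..d+1-k}. \<gamma> j > -1"
begin

text \<open>M is the set m_k of the paper; for k = d + 1 it is {1..d}, whereas {d-k+2..d} would be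
  {2..d} because of truncated subtraction.\<close>

definition N :: "nat set" where "N = {1..d+1-k}"
definition M :: "nat set" where "M = {d+2-k..d}"
abbreviation V :: "nat set" where "V \<equiv> {1..d+1}"
definition e0 :: "nat \<Rightarrow> real" where "e0 = gz N \<gamma>"

definition DI :: "nat set \<Rightarrow> fn \<Rightarrow> fn" where
  "DI I F = foldr (Dd (d+1)) (sorted_list_of_set I) F"

text \<open>In homogeneous barycentric coordinates, up to positive factors, the terms of the Sobolev form:
  T1 belongs to a nonempty set I of derivatives (I = M being the integral over the whole simplex),
  T2 to the first order terms, T3 to the last term for k at most d.\<close>

definition T1 :: "nat set \<Rightarrow> fn \<Rightarrow> fn \<Rightarrow> real" where
  "T1 I F G = Lag (N \<union> I \<union> {d+1}) e0 (\<lambda>x. x (d+1) ^ (card I - 1) * (DI I F x * DI I G x))"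
definition T2 :: "nat \<Rightarrow> fn \<Rightarrow> fn \<Rightarrow> real" where
  "T2 i F G = Lag (N \<union> {d+1}) e0 (\<lambda>x. x i * (Dd (d+1) i F x * Dd (d+1) i G x))"
definition T3 :: "fn \<Rightarrow> fn \<Rightarrow> real" where
  "T3 F G = Lag N e0 (\<lambda>x. F x * G x)"

lemma NM: "finite N" "finite M" "N \<subseteq> {1..d}" "M \<subseteq> {1..d}" "{1..d} - M = N" "{1..d} - N = M"
    "N \<union> M \<union> {d+1} = V" "d + 1 \<notin> N" "d + 1 \<notin> M" "card M = k - 1" "N \<inter> M = {}"
  using k1 kd by (auto simp: N_def M_def)

lemma gamN: "\<forall>i\<in>N. \<gamma> i > -1"
  using gam by (simp add: N_def)

lemma e0: "e0 i > -1"
  unfolding e0_def by (rule gz_gt[OF gamN])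

lemma xgam_eq: "xgam d k \<gamma> x = (\<Prod>i\<in>N. x i powr \<gamma> i)"
  by (simp add: xgam_def N_def)

lemma pdset_xx:
  assumes "F \<in> hp V {n}" "I \<subseteq> M"
  shows "pdset I (\<lambda>x. F (xx d x)) = (\<lambda>x. DI I F (xx d x))"
proof -
  have "finite I" "set (sorted_list_of_set I) \<subseteq> {1..d}"
    using assms(2) NM finite_subset[of I M] by auto
  then show ?thesis unfolding pdset_def DI_def by (intro foldr_pd_xx hp_imp_pol[OF assms(1)])
qed

lemma DI_hp: "F \<in> hp V {n} \<Longrightarrow> DI I F \<in> hp V {n - card I}"
  unfolding DI_def using hp_foldr_Dd[of F V n "d+1" "sorted_list_of_set I"] by simp

lemma term1_hp:
  assumes "F \<in> hp V {n}" "G \<in> hp V {m}"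
  shows "(\<lambda>x. x (d+1) ^ (card I - 1) * (DI I F x * DI I G x)) \<in> hp V {(card I - 1) + ((n - card I) + (m - card I))}"
proof -
  have "(\<lambda>x. x (d+1) ^ (card I - 1)) \<in> hp V {card I - 1}"
    using hp_power[of "\<lambda>x. x (d+1)" V 1 "card I - 1"] hp_var[of V "d+1" "{1}"] by simp
  then show ?thesis by (rule hp_mult[OF _ hp_mult[OF DI_hp[OF assms(1)] DI_hp[OF assms(2)]]]) auto
qed

lemma term2_hp:
  assumes "F \<in> hp V {n}" "G \<in> hp V {m}" "i \<in> N"
  shows "(\<lambda>x. x i * (Dd (d+1) i F x * Dd (d+1) i G x)) \<in> hp V {1 + ((n - 1) + (m - 1))}"
proof -
  have "Dd (d+1) i F \<in> hp V {n - 1}" by (rule hp_Dd[OF assms(1)]) auto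
  moreover have "Dd (d+1) i G \<in> hp V {m - 1}" by (rule hp_Dd[OF assms(2)]) auto
  moreover have "(\<lambda>x. x i) \<in> hp V {1}" using assms(3) NM(3) by (intro hp_var) auto
  ultimately show ?thesis by (intro hp_mult[of "\<lambda>x. x i" V "{1}"] hp_mult) auto
qed

text \<open>Reciprocals of the Gamma factors in the passage from integrals to \<open>Lag\<close>,
  for a pairing of degrees n and m; the first summand is the degree of the integrand. What matters
  later is that they are positive.\<close>

definition a1 :: "nat \<Rightarrow> nat \<Rightarrow> nat set \<Rightarrow> real" where
  "a1 n m I = 1 / Gamma (real ((card I - 1) + ((n - card I) + (m - card I))) + (\<Sum>i\<in>N \<union> I \<union> {d+1}. e0 i + 1))"
definition a2 :: "nat \<Rightarrow> nat \<Rightarrow> real" where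
  "a2 n m = 1 / Gamma (real (1 + ((n - 1) + (m - 1))) + (\<Sum>i\<in>N \<union> {d+1}. e0 i + 1))"
text \<open>For \<open>k = d\<close> the last term of the form is a value at the vertex e_1, and N =
  {1}. On this vertex a homogeneous polynomial is its value at e_1 times a power of x_1, so
  \<open>T3\<close> is the product of the values times the Gamma moment that is divided out
  here.\<close>

definition a3 :: "nat \<Rightarrow> nat \<Rightarrow> real" where
  "a3 n m = (if k = d then 1 / Lag {1} e0 (mon {1} (\<lambda>_. n + m))
     else 1 / Gamma (real (n + m) + (\<Sum>i\<in>N. e0 i + 1)))"

lemma a_pos: "I \<subseteq> M \<Longrightarrow> a1 n m I > 0" "a2 n m > 0" "k \<le> d \<Longrightarrow> a3 n m > 0"
proof -
  show "I \<subseteq> M \<Longrightarrow> a1 n m I > 0"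
    unfolding a1_def using NM finite_subset[of I M] by (intro divide_pos_pos Gamma_sum_pos e0) auto
  show "a2 n m > 0"
    unfolding a2_def using NM by (intro divide_pos_pos Gamma_sum_pos e0) auto
  assume k: "k \<le> d"
  then have "N \<noteq> {}" by (auto simp: N_def)
  moreover have "Lag {1} e0 (mon {1} (\<lambda>_. n + m)) > 0"
    using Lag_mon[of "{1}" e0 "\<lambda>_. n + m"] e0[of 1] by (simp add: Gamma_real_pos)
  ultimately show "a3 n m > 0"
    unfolding a3_def using NM(1) Gamma_sum_pos[of N e0 "n + m"] e0 by (cases "k = d") auto
qed

lemma face_term1:
  assumes F: "F \<in> hp V {n}" and G: "G \<in> hp V {m}" and I: "I \<subseteq> M"
  shows "face_int d (M - I) (\<lambda>x. pdset I (\<lambda>x. F (xx d x)) x * pdset I (\<lambda>x. G (xx d x)) x *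
      (xx d x (d+1)) ^ (card I - 1) * xgam d k \<gamma> x) = a1 n m I * T1 I F G"
proof -
  have V: "V - (M - I) = N \<union> I \<union> {d+1}" using NM(3,4,5,7) I NM by blast
  have "face_int d (M - I) (\<lambda>x. (xx d x (d+1) ^ (card I - 1) * (DI I F (xx d x) * DI I G (xx d x))) *
      (\<Prod>i\<in>N. x i powr \<gamma> i)) = T1 I F G * a1 n m I"
    using face_int_eq_Lag[OF _ _ gamN term1_hp[OF F G, of I], of "M - I"] NM unfolding V
    by (auto simp: T1_def a1_def e0_def)
  then show ?thesis unfolding pdset_xx[OF F I] pdset_xx[OF G I] xgam_eq by (simp add: mult_ac)
qed

lemma simp_term1:
  assumes F: "F \<in> hp V {n}" and G: "G \<in> hp V {m}"
  shows "simp_int d (\<lambda>x. pdset M (\<lambda>x. F (xx d x)) x * pdset M (\<lambda>x. G (xx d x)) x *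
      (xx d x (d+1)) ^ (card M - 1) * xgam d k \<gamma> x) = a1 n m M * T1 M F G"
proof -
  have "simp_int d (\<lambda>x. (xx d x (d+1) ^ (card M - 1) * (DI M F (xx d x) * DI M G (xx d x))) *
      (\<Prod>i\<in>N. x i powr \<gamma> i)) = T1 M F G * a1 n m M"
    using simp_int_eq_Lag[OF NM(3) gamN term1_hp[OF F G, of M]]
    unfolding T1_def a1_def e0_def NM(7) by simp
  then show ?thesis unfolding pdset_xx[OF F order_refl] pdset_xx[OF G order_refl] xgam_eq by (simp add: mult_ac)
qed

lemma face_term2:
  assumes F: "F \<in> hp V {n}" and G: "G \<in> hp V {m}" and i: "i \<in> N"
  shows "face_int d M (\<lambda>x. x i * pd i (\<lambda>x. F (xx d x)) x * pd i (\<lambda>x. G (xx d x)) x * xgam d k \<gamma> x)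
      = a2 n m * T2 i F G"
proof -
  have V: "V - M = N \<union> {d+1}" using NM(3,4,5,7) NM by blast
  have id: "i \<in> {1..d}" using i NM by auto
  have x: "x i = xx d x i" for x using id by (auto simp: xx_def)
  have "face_int d M (\<lambda>x. (xx d x i * (Dd (d+1) i F (xx d x) * Dd (d+1) i G (xx d x))) *
      (\<Prod>i\<in>N. x i powr \<gamma> i)) = T2 i F G * a2 n m"
    using face_int_eq_Lag[OF _ _ gamN term2_hp[OF F G i], of M] NM unfolding V
    by (auto simp: T2_def a2_def e0_def)
  then show ?thesis
    unfolding pd_xx[OF hp_imp_pol[OF F] id] pd_xx[OF hp_imp_pol[OF G] id] xgam_eq
    by (simp add: mult_ac x[symmetric])
qed

lemma simp_term2:
  assumes F: "F \<in> hp V {n}" and G: "G \<in> hp V {m}" and i: "i \<in> N" and k: "k = 1"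
  shows "simp_int d (\<lambda>x. x i * pd i (\<lambda>x. F (xx d x)) x * pd i (\<lambda>x. G (xx d x)) x * xgam d k \<gamma> x)
      = a2 n m * T2 i F G"
proof -
  have "M = {}" unfolding M_def using k by simp
  then have V: "V = N \<union> {d+1}" using NM(7) by (metis Un_empty_right)
  have id: "i \<in> {1..d}" using i NM by auto
  have x: "x i = xx d x i" for x using id by (auto simp: xx_def)
  have "simp_int d (\<lambda>x. (xx d x i * (Dd (d+1) i F (xx d x) * Dd (d+1) i G (xx d x))) *
      (\<Prod>i\<in>N. x i powr \<gamma> i)) = T2 i F G * a2 n m"
    using simp_int_eq_Lag[OF NM(3) gamN term2_hp[OF F G i]]
    unfolding T2_def a2_def e0_def V by simp
  then show ?thesis
    unfolding pd_xx[OF hp_imp_pol[OF F] id] pd_xx[OF hp_imp_pol[OF G] id] xgam_eq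
    by (simp add: mult_ac x[symmetric])
qed

lemma xx_ebas: "j \<in> {1..d} \<Longrightarrow> xx d (ebas j) = (\<lambda>i. if i = j then 1 else 0)"
  "xx d (ebas 0) = (\<lambda>i. if i = 0 \<or> i = d + 1 then 1 else 0)"
  by (auto simp: xx_def ebas_def)

lemma face_term3:
  assumes F: "F \<in> hp V {n}" and G: "G \<in> hp V {m}" and k: "k \<le> d"
  shows "(if k = d then F (xx d (ebas 1)) * G (xx d (ebas 1))
     else face_int d (M \<union> {d+1}) (\<lambda>x. F (xx d x) * G (xx d x) * xgam d k \<gamma> x)) = a3 n m * T3 F G"
proof (cases "k = d")
  case True
  then have N: "N = {1}" unfolding N_def by auto
  let ?e = "xx d (ebas 1)"
  have e: "?e = (\<lambda>i. if i = 1 then 1 else 0)" using xx_ebas(1)[of 1] d2 by auto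
  have r: "res {1} x = (\<lambda>i. x 1 * ?e i)" for x unfolding e by (auto simp: res_def)
  have "T3 F G = Lag {1} e0 (\<lambda>x. (F ?e * G ?e) * mon {1} (\<lambda>_. n + m) x)"
    unfolding T3_def N
  proof (rule Lag_cong)
    fix x
    have "F (res {1} x) = x 1 ^ n * F ?e" "G (res {1} x) = x 1 ^ m * G ?e"
      unfolding r by (rule hp_homogeneous[OF F], rule hp_homogeneous[OF G])
    then show "F (res {1} x) * G (res {1} x) = F ?e * G ?e * mon {1} (\<lambda>_. n + m) (res {1} x)"
      by (simp add: mon_def res_def power_add)
  qed
  also have "\<dots> = (F ?e * G ?e) * Lag {1} e0 (mon {1} (\<lambda>_. n + m))" by (rule Lag_scale)
  finally have T: "T3 F G = (F ?e * G ?e) * Lag {1} e0 (mon {1} (\<lambda>_. n + m))" .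
  have a: "a3 n m = 1 / Lag {1} e0 (mon {1} (\<lambda>_. n + m))"
    unfolding a3_def by (rule if_P[OF True])
  have "Lag {1} e0 (mon {1} (\<lambda>_. n + m)) \<noteq> 0" using a_pos(3)[OF k, of n m] unfolding a by auto
  then show ?thesis unfolding if_P[OF True] T a by simp
next
  case False
  have V: "{1..d} - M \<noteq> {}" unfolding NM(5) using k by (auto simp: N_def)
  have FG: "(\<lambda>x. F x * G x) \<in> hp V {n + m}" by (rule hp_mult[OF F G]) auto
  show ?thesis using face_int_top_eq_Lag[OF NM(4) _ V gamN FG] False
    unfolding xgam_eq T3_def a3_def e0_def NM(5) by simp
qed

text \<open>Among the terms with a nonempty set of derivatives, the one over the whole simplex
  carries no free parameter.\<close>

definition lI :: "(nat set \<Rightarrow> real) \<Rightarrow> nat set \<Rightarrow> real" where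
  "lI lamI I = (if I = M then 1 else lamI I)"

text \<open>One expression for the three shapes of the form. For \<open>k = 1\<close> the set M is
  empty, the first sum disappears and the first-order terms live on the whole simplex with
  coefficient 1; for \<open>k = d + 1\<close> the set N is empty and vertex values replace the last
  two terms.\<close>

lemma sob_ip_eq:
  assumes F: "F \<in> hp V {n}" and G: "G \<in> hp V {m}"
  shows "sob_ip d k \<gamma> lam lami lamI lam0 (\<lambda>x. F (xx d x)) (\<lambda>x. G (xx d x)) =
    (\<Sum>I\<in>Pow M - {{}}. lI lamI I * a1 n m I * T1 I F G) +
    (if k \<le> d then (\<Sum>i\<in>N. (if k = 1 then 1 else lami i) * a2 n m * T2 i F G) + lam * a3 n m * T3 F G
     else (\<Sum>j\<in>{0..d}. lam0 j * F (xx d (ebas j)) * G (xx d (ebas j))))"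
proof -
  let ?f = "\<lambda>x. F (xx d x)" and ?g = "\<lambda>x. G (xx d x)"
  have cM: "card I = k - 1 \<longleftrightarrow> I = M" if "I \<subseteq> M" for I
    using card_subset_eq[OF NM(2) that] NM(10) by auto
  have split: "(\<Sum>I\<in>Pow M - {{}}. lI lamI I * a1 n m I * T1 I F G) = a1 n m M * T1 M F G +
     (\<Sum>I\<in>{I\<in>Pow M. 1 \<le> card I \<and> card I \<le> k - 2}. lamI I * (a1 n m I * T1 I F G))" if k: "2 \<le> k"
  proof -
    have M: "M \<in> Pow M - {{}}" using NM(10) k by force
    \<comment> \<open>Since \<open>card M = k - 1\<close>, the bound \<open>k - 2\<close> singles
      out the proper subsets.\<close>
    have eq: "Pow M - {{}} - {M} = {I\<in>Pow M. 1 \<le> card I \<and> card I \<le> k - 2}"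
    proof (intro set_eqI iffI)
      fix I assume I: "I \<in> Pow M - {{}} - {M}"
      then have "finite I" using NM(2) finite_subset by auto
      then have "card I \<ge> 1" using I by (simp add: Suc_le_eq card_gt_0_iff)
      moreover have "card I \<le> k - 1" "card I \<noteq> k - 1"
        using I cM[of I] card_mono[OF NM(2), of I] NM(10) by auto
      ultimately show "I \<in> {I\<in>Pow M. 1 \<le> card I \<and> card I \<le> k - 2}" using I by auto
    next
      fix I assume I: "I \<in> {I\<in>Pow M. 1 \<le> card I \<and> card I \<le> k - 2}"
      then show "I \<in> Pow M - {{}} - {M}" using NM(10) k by auto
    qed
    have "(\<Sum>I\<in>Pow M - {{}} - {M}. lI lamI I * a1 n m I * T1 I F G) =
      (\<Sum>I\<in>Pow M - {{}} - {M}. lamI I * (a1 n m I * T1 I F G))"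
      by (rule sum.cong) (auto simp: lI_def)
    then show ?thesis
      using sum.remove[OF _ M, of "\<lambda>I. lI lamI I * a1 n m I * T1 I F G"] NM(2)
      unfolding eq by (simp add: lI_def)
  qed
  have t1: "(\<Sum>I\<in>{I\<in>Pow M. 1 \<le> card I \<and> card I \<le> k - 2}.
            lamI I * face_int d (M - I)
              (\<lambda>x. pdset I ?f x * pdset I ?g x * (xx d x (d+1)) ^ (card I - 1) * xgam d k \<gamma> x)) =
     (\<Sum>I\<in>{I\<in>Pow M. 1 \<le> card I \<and> card I \<le> k - 2}. lamI I * (a1 n m I * T1 I F G))"
  proof (rule sum.cong[OF refl])
    fix I assume "I \<in> {I\<in>Pow M. 1 \<le> card I \<and> card I \<le> k - 2}"
    then have "I \<subseteq> M" by simp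
    then show "lamI I * face_int d (M - I)
        (\<lambda>x. pdset I ?f x * pdset I ?g x * (xx d x (d+1)) ^ (card I - 1) * xgam d k \<gamma> x) =
      lamI I * (a1 n m I * T1 I F G)" by (simp only: face_term1[OF F G])
  qed
  consider "k = 1" | "2 \<le> k" "k \<le> d" | "k = d + 1" using k1 kd by linarith
  then show ?thesis
  proof cases
    case 1
    have M: "M = {}" unfolding M_def using 1 by simp
    have Nd: "N = {1..d}" unfolding N_def using 1 by simp
    have "(\<Sum>i\<in>N. simp_int d (\<lambda>x. x i * pd i ?f x * pd i ?g x * xgam d k \<gamma> x)) = (\<Sum>i\<in>N. a2 n m * T2 i F G)"
      by (rule sum.cong[OF refl]) (rule simp_term2[OF F G _ 1])
    moreover have "face_int d {d+1} (\<lambda>x. ?f x * ?g x * xgam d k \<gamma> x) = a3 n m * T3 F G"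
      using face_term3[OF F G] 1 d2 M by simp
    ultimately show ?thesis using 1 d2 M unfolding sob_ip_def Nd by simp
  next
    case 2
    have "d - k + 2 = d + 2 - k" using 2 by linarith
    then have M: "{d-k+2..d} = M" unfolding M_def by simp
    have "d - k + 1 = d + 1 - k" using 2 by linarith
    then have Ne: "{1..d-k+1} = N" unfolding N_def by simp
    have t2: "(\<Sum>i\<in>N. lami i * face_int d M (\<lambda>x. x i * pd i ?f x * pd i ?g x * xgam d k \<gamma> x)) =
        (\<Sum>i\<in>N. lami i * a2 n m * T2 i F G)"
    proof (rule sum.cong[OF refl])
      fix i assume i: "i \<in> N"
      show "lami i * face_int d M (\<lambda>x. x i * pd i ?f x * pd i ?g x * xgam d k \<gamma> x) = lami i * a2 n m * T2 i F G"
        unfolding face_term2[OF F G i] by (rule mult.assoc[symmetric])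
    qed
    have t3: "(if k = d then lam * ?f (ebas 1) * ?g (ebas 1)
          else lam * face_int d (M \<union> {d+1}) (\<lambda>x. ?f x * ?g x * xgam d k \<gamma> x)) = lam * a3 n m * T3 F G"
      using face_term3[OF F G 2(2)] by (auto split: if_splits)
    have t0: "simp_int d (\<lambda>x. pdset M ?f x * pdset M ?g x * (xx d x (d+1)) ^ (k - 2) * xgam d k \<gamma> x) = a1 n m M * T1 M F G"
      using simp_term1[OF F G] NM(10) by (simp add: numeral_2_eq_2)
    show ?thesis
      using 2 unfolding sob_ip_def Let_def M Ne t0 t1 t2 t3 split[OF 2(1)] by simp
  next
    case 3
    have M: "{1..d} = M" unfolding M_def using 3 by simp
    have x1: "xgam d k \<gamma> x = 1" for x using 3 by (simp add: xgam_def)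
    have kd': "d - 1 = k - 2" using 3 by simp
    have t0: "simp_int d (\<lambda>x. pdset M ?f x * pdset M ?g x * (xx d x (d+1)) ^ (k - 2)) = a1 n m M * T1 M F G"
      using simp_term1[OF F G] NM(10) x1 by (simp add: numeral_2_eq_2)
    have "2 \<le> k" using 3 d2 by simp
    then show ?thesis
      using 3 t1 unfolding sob_ip_def Let_def M kd' t0 split[OF \<open>2 \<le> k\<close>] x1 by simp
  qed
qed

end

section \<open>Linearity and symmetry of the form\<close>

lemma foldr_Dd_lin:
  assumes "pol F" "pol G"
  shows "foldr (Dd r) is (\<lambda>x. a * F x + b * G x) = (\<lambda>x. a * foldr (Dd r) is F x + b * foldr (Dd r) is G x)"
  by (induction "is") (simp_all add: Dd_add Dd_scale pol_foldr_Dd assms pol_simps)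

lemma Dd_lin:
  assumes "pol F" "pol G"
  shows "Dd r i (\<lambda>x. a * F x + b * G x) = (\<lambda>x. a * Dd r i F x + b * Dd r i G x)"
  using foldr_Dd_lin[OF assms, of r "[i]"] by simp

lemma polys_deg_mono: "f \<in> polys_deg d (int n) \<Longrightarrow> n \<le> n' \<Longrightarrow> f \<in> polys_deg d (int n')"
  unfolding polys_deg_eq_hp by (auto elim: hp_mono)

lemma polys_xxE:
  assumes "finite A" "A \<subseteq> polys d"
  shows "\<exists>n. \<forall>f\<in>A. \<exists>F\<in>hp {1..d+1} {n}. f = (\<lambda>x. F (xx d x))"
proof -
  have "\<forall>f\<in>A. \<exists>n. f \<in> polys_deg d (int n)" using assms(2) by (auto simp: polys_def)
  then obtain \<nu> where \<nu>: "\<And>f. f \<in> A \<Longrightarrow> f \<in> polys_deg d (int (\<nu> f))" by metis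
  have "f \<in> polys_deg d (int (Max (\<nu> ` A)))" if "f \<in> A" for f
    by (rule polys_deg_mono[OF \<nu>[OF that]]) (use assms(1) that in auto)
  then show ?thesis using polys_deg_iff by blast
qed

context jacobi
begin

lemma pol_DI: "pol F \<Longrightarrow> pol (DI I F)"
  unfolding DI_def by (rule pol_foldr_Dd)

lemma finI: "I \<subseteq> M \<Longrightarrow> finite (N \<union> I \<union> {d+1})"
  using NM finite_subset[of I M] by auto

lemma Lag_lin:
  assumes "finite C" "pol F" "pol G"
  shows "Lag C e0 (\<lambda>x. a * F x + b * G x) = a * Lag C e0 F + b * Lag C e0 G"
  using assms e0 by (simp add: Lag_add Lag_scale pol_simps)

lemma T1_lin:
  assumes "I \<subseteq> M" "pol F" "pol G" "pol H"
  shows "T1 I (\<lambda>x. a * F x + b * G x) H = a * T1 I F H + b * T1 I G H"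
proof -
  have "T1 I (\<lambda>x. a * F x + b * G x) H = Lag (N \<union> I \<union> {d+1}) e0
    (\<lambda>x. a * (x (d+1) ^ (card I - 1) * (DI I F x * DI I H x)) + b * (x (d+1) ^ (card I - 1) * (DI I G x * DI I H x)))"
    unfolding T1_def DI_def foldr_Dd_lin[OF assms(2,3)] by (simp add: algebra_simps)
  then show ?thesis
    by (subst (asm) Lag_lin[OF finI[OF assms(1)]]) (use assms in \<open>auto simp: T1_def intro!: pol_DI pol_mult pol_power pol_var\<close>)
qed

lemma T2_lin:
  assumes "pol F" "pol G" "pol H"
  shows "T2 i (\<lambda>x. a * F x + b * G x) H = a * T2 i F H + b * T2 i G H"
proof -
  have "T2 i (\<lambda>x. a * F x + b * G x) H = Lag (N \<union> {d+1}) e0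
    (\<lambda>x. a * (x i * (Dd (d+1) i F x * Dd (d+1) i H x)) + b * (x i * (Dd (d+1) i G x * Dd (d+1) i H x)))"
    unfolding T2_def Dd_lin[OF assms(1,2)] by (simp add: algebra_simps)
  then show ?thesis
    by (subst (asm) Lag_lin) (use assms NM in \<open>auto simp: T2_def intro!: pol_Dd pol_mult pol_var\<close>)
qed

lemma T3_lin:
  assumes "pol F" "pol G" "pol H"
  shows "T3 (\<lambda>x. a * F x + b * G x) H = a * T3 F H + b * T3 G H"
proof -
  have "T3 (\<lambda>x. a * F x + b * G x) H = Lag N e0 (\<lambda>x. a * (F x * H x) + b * (G x * H x))"
    unfolding T3_def by (simp add: algebra_simps)
  then show ?thesis
    by (subst (asm) Lag_lin) (use assms NM in \<open>auto simp: T3_def intro!: pol_mult\<close>)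
qed

lemma sob_ip_symmetric:
  assumes F: "F \<in> hp V {n}" and G: "G \<in> hp V {n}"
  shows "sob_ip d k \<gamma> lam lami lamI lam0 (\<lambda>x. F (xx d x)) (\<lambda>x. G (xx d x)) =
    sob_ip d k \<gamma> lam lami lamI lam0 (\<lambda>x. G (xx d x)) (\<lambda>x. F (xx d x))"
proof -
  have "T1 I F G = T1 I G F" "T2 i F G = T2 i G F" "T3 F G = T3 G F" for I i
    by (simp_all add: T1_def T2_def T3_def mult.commute)
  then show ?thesis unfolding sob_ip_eq[OF F G] sob_ip_eq[OF G F] by (simp add: mult_ac)
qed

lemma sob_ip_linear:
  assumes F: "F \<in> hp V {n}" and G: "G \<in> hp V {n}" and H: "H \<in> hp V {m}"
  shows "sob_ip d k \<gamma> lam lami lamI lam0 (\<lambda>x. a * F (xx d x) + b * G (xx d x)) (\<lambda>x. H (xx d x)) =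
    a * sob_ip d k \<gamma> lam lami lamI lam0 (\<lambda>x. F (xx d x)) (\<lambda>x. H (xx d x)) +
    b * sob_ip d k \<gamma> lam lami lamI lam0 (\<lambda>x. G (xx d x)) (\<lambda>x. H (xx d x))"
proof -
  have FG: "(\<lambda>x. a * F x + b * G x) \<in> hp V {n}" by (intro hp_add hp_scale F G)
  note p = hp_imp_pol[OF F] hp_imp_pol[OF G] hp_imp_pol[OF H]
  have s1: "(\<Sum>I\<in>Pow M - {{}}. lI lamI I * a1 n m I * T1 I (\<lambda>x. a * F x + b * G x) H) =
     a * (\<Sum>I\<in>Pow M - {{}}. lI lamI I * a1 n m I * T1 I F H) + b * (\<Sum>I\<in>Pow M - {{}}. lI lamI I * a1 n m I * T1 I G H)"
    unfolding sum_distrib_left sum.distrib[symmetric]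
    by (rule sum.cong) (auto simp: T1_lin p algebra_simps)
  have s2: "(\<Sum>i\<in>N. (if k = 1 then 1 else lami i) * a2 n m * T2 i (\<lambda>x. a * F x + b * G x) H) =
     a * (\<Sum>i\<in>N. (if k = 1 then 1 else lami i) * a2 n m * T2 i F H) + b * (\<Sum>i\<in>N. (if k = 1 then 1 else lami i) * a2 n m * T2 i G H)"
    unfolding sum_distrib_left sum.distrib[symmetric]
    by (rule sum.cong[OF refl]) (simp only: T2_lin p, simp only: distrib_left mult_ac)
  have s3: "(\<Sum>j\<in>{0..d}. lam0 j * (a * F (xx d (ebas j)) + b * G (xx d (ebas j))) * H (xx d (ebas j))) =
     a * (\<Sum>j\<in>{0..d}. lam0 j * F (xx d (ebas j)) * H (xx d (ebas j))) + b * (\<Sum>j\<in>{0..d}. lam0 j * G (xx d (ebas j)) * H (xx d (ebas j)))"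
    unfolding sum_distrib_left sum.distrib[symmetric]
    by (rule sum.cong[OF refl]) (simp only: distrib_left distrib_right mult_ac)
  show ?thesis
    unfolding sob_ip_eq[OF FG H] sob_ip_eq[OF F H] sob_ip_eq[OF G H] s1 s2 s3 T3_lin[OF p]
    by (cases "k \<le> d") (simp_all only: if_True if_False distrib_left mult_ac add_ac)
qed

section \<open>Definiteness\<close>

lemma zero_on_low_face:
  assumes F: "F \<in> hp V {n}" and k: "k \<le> d"
    and N2: "\<And>i x. i \<in> N \<Longrightarrow> Dd (d+1) i F (res (N \<union> {d+1}) x) = 0" and N3: "\<And>x. F (res N x) = 0"
  shows "F (res (N \<union> {d+1}) x) = 0"
proof -
  \<comment> \<open>The direction joining the vertices \<open>d + 1\<close> and 1 is used: F is
    constant along it on the face, and each such line meets the facet \<open>x_{d+1} = 0\<close>,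
    where F vanishes.\<close>
  have "1 \<in> N" unfolding N_def using k by auto
  let ?C = "N \<union> {d+1}" and ?G = "\<lambda>x. F (res (N \<union> {d+1}) x)"
  have ne: "1 \<noteq> d + 1" using d2 by simp
  have "Dd (d+1) 1 ?G = (\<lambda>x. 0)"
    by (subst Dd_res) (use \<open>1 \<in> N\<close> N2 in auto)
  from Dd_zero_line[OF pol_res[OF hp_imp_pol[OF F]] ne this, of x "x (d+1)"]
  have "?G x = F (res ?C (x(1 := x 1 + x (d+1), d+1 := 0)))" by simp
  also have "res ?C (x(1 := x 1 + x (d+1), d+1 := 0)) = res N (x(1 := x 1 + x (d+1)))"
    using NM(8) by (auto simp: res_def fun_eq_iff)
  finally show ?thesis using N3 by simp
qed

text \<open>For \<open>k = d + 1\<close> the smallest face is the vertex e_0, but the known zero may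
  be at another vertex e_j. The term with I = {j} makes F constant on the edge joining the
  two.\<close>

lemma zero_on_vertices:
  assumes F: "F \<in> hp V {n}" and k: "k = d + 1"
    and N1: "\<And>I x. I \<subseteq> M \<Longrightarrow> I \<noteq> {} \<Longrightarrow> DI I F (res (N \<union> I \<union> {d+1}) x) = 0"
    and j: "j \<in> {0..d}" "F (xx d (ebas j)) = 0"
  shows "F (res (N \<union> {d+1}) x) = 0"
proof -
  have N: "N = {}" and M: "M = {1..d}" unfolding N_def M_def using k by auto
  let ?v = "\<lambda>i. if i = d + 1 then 1 else (0::real)"
  have v0: "F (xx d (ebas 0)) = F ?v"
    by (rule hp_indep[OF F]) (auto simp: xx_ebas)
  have v: "F ?v = 0"
  proof (cases "j = 0")
    case True
    then show ?thesis using j v0 by simp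
  next
    case False
    then have jM: "j \<in> M" using j M by auto
    have ne: "j \<noteq> d + 1" using j by simp
    let ?C = "{j, d+1}" and ?G = "\<lambda>x. F (res {j, d+1} x)"
    have "DI {j} F = Dd (d+1) j F" by (simp add: DI_def)
    then have z: "Dd (d+1) j F (res {j, d+1} x) = 0" for x using N1[of "{j}" x] jM N by (simp add: insert_commute)
    have "Dd (d+1) j ?G = (\<lambda>x. 0)"
      by (subst Dd_res) (use z in auto)
    from Dd_zero_line[OF pol_res[OF hp_imp_pol[OF F]] ne this, of ?v 1]
    have "?G ?v = F (res ?C (?v(j := ?v j + 1, d+1 := ?v (d+1) - 1)))" by simp
    also have "res ?C (?v(j := ?v j + 1, d+1 := ?v (d+1) - 1)) = xx d (ebas j)"
      using xx_ebas(1)[of j] False j ne by (auto simp: res_def fun_eq_iff)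
    also have "res ?C ?v = ?v" using ne by (auto simp: res_def fun_eq_iff)
    finally show ?thesis using j(2) by simp
  qed
  have "res (N \<union> {d+1}) x = (\<lambda>i. x (d+1) * ?v i)" unfolding N by (auto simp: res_def)
  then show ?thesis using hp_homogeneous[OF F, of "x (d+1)" ?v] v by simp
qed

lemma zero_from_faces:
  assumes F: "F \<in> hp V {n}"
    and N1: "\<And>I x. I \<subseteq> M \<Longrightarrow> I \<noteq> {} \<Longrightarrow> DI I F (res (N \<union> I \<union> {d+1}) x) = 0"
    and base: "\<And>x. F (res (N \<union> {d+1}) x) = 0"
  shows "F = (\<lambda>x. 0)"
proof -
  have "\<forall>x. F (res (N \<union> I \<union> {d+1}) x) = 0" if "finite I" "I \<subseteq> M" for I
    using that
  proof (induction I rule: finite_psubset_induct)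
    case (psubset I)
    show ?case
    proof (cases "I = {}")
      case True
      then show ?thesis using base by simp
    next
      case False
      let ?C = "N \<union> I \<union> {d+1}" and ?L = "sorted_list_of_set I"
      let ?G = "\<lambda>x. F (res ?C x)"
      have L: "set ?L = I" "distinct ?L" using psubset(1) by auto
      have "?G = (\<lambda>x. 0)"
      proof (rule foldr_Dd_zero_imp[OF pol_res[OF hp_imp_pol[OF F]]])
        show "foldr (Dd (d+1)) ?L ?G = (\<lambda>x. 0)"
          using N1[OF psubset(3) False] L by (subst foldr_Dd_res) (auto simp: DI_def)
        show "d + 1 \<notin> set ?L" using L NM(9) psubset(3) by auto
        fix i x assume i: "i \<in> set ?L"
        then have iN: "i \<notin> N" "i \<noteq> d + 1" using L psubset(3) NM by auto
        have "res ?C (x(i := 0)) = res (N \<union> (I - {i}) \<union> {d+1}) x"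
          using iN by (auto simp: res_def fun_eq_iff)
        moreover have "I - {i} \<subset> I" using i L by auto
        ultimately show "?G (x(i := 0)) = 0" using psubset by auto
      qed (use L in auto)
      then show ?thesis by metis
    qed
  qed
  from this[OF NM(2) order_refl] have "\<forall>x. F (res V x) = 0" unfolding NM(7) .
  then show ?thesis using hp_res_same[OF F] by auto
qed

text \<open>Starting from \<open><= 0\<close> serves two purposes: strict positivity of the form by
  contraposition, and F = 0 from a vanishing square in the completeness argument.\<close>

lemma sob_ip_pos:
  assumes F: "F \<in> hp V {n}"
    and P1: "\<And>I. I \<subseteq> M \<Longrightarrow> I \<noteq> {} \<Longrightarrow> lI lamI I > 0"
    and P2: "k \<le> d \<Longrightarrow> lam > 0 \<and> (\<forall>i\<in>N. (if k = 1 then 1 else lami i) > 0)"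
    and P3: "k = d + 1 \<Longrightarrow> (\<forall>j. lam0 j \<ge> 0) \<and> (\<exists>j\<in>{0..d}. lam0 j > 0)"
    and le: "sob_ip d k \<gamma> lam lami lamI lam0 (\<lambda>x. F (xx d x)) (\<lambda>x. F (xx d x)) \<le> 0"
  shows "F = (\<lambda>x. 0)"
proof -
  have pF: "pol F" by (rule hp_imp_pol[OF F])
  have T1: "T1 I F F \<ge> 0" "T1 I F F = 0 \<Longrightarrow> DI I F (res (N \<union> I \<union> {d+1}) x) = 0" if "I \<subseteq> M" for I x
    unfolding T1_def
    using Lag_pow_square[OF finI[OF that], of "d+1" e0 "DI I F" "card I - 1"] pol_DI[OF pF] e0 by auto
  have T2: "T2 i F F \<ge> 0" "T2 i F F = 0 \<Longrightarrow> Dd (d+1) i F (res (N \<union> {d+1}) x) = 0" if "i \<in> N" for i x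
    unfolding T2_def
    using Lag_pow_square[of "N \<union> {d+1}" i e0 "Dd (d+1) i F" 1] pol_Dd[OF pF] e0 NM(1) that by auto
  have T3: "T3 F F \<ge> 0" "T3 F F = 0 \<Longrightarrow> F (res N x) = 0" for x
    unfolding T3_def using Lag_square_nonneg Lag_square_pos[OF NM(1) _ pF, of e0] e0 by auto
  let ?S1 = "\<Sum>I\<in>Pow M - {{}}. lI lamI I * a1 n n I * T1 I F F"
  let ?S2 = "\<Sum>i\<in>N. (if k = 1 then 1 else lami i) * a2 n n * T2 i F F"
  let ?S3 = "\<Sum>j\<in>{0..d}. lam0 j * F (xx d (ebas j)) * F (xx d (ebas j))"
  have c1: "lI lamI I * a1 n n I > 0" if "I \<in> Pow M - {{}}" for I
    using that P1 a_pos(1) by simp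
  have n1: "lI lamI I * a1 n n I * T1 I F F \<ge> 0" if "I \<in> Pow M - {{}}" for I
    using c1[OF that] T1(1)[of I] that by (intro mult_nonneg_nonneg[OF less_imp_le]) auto
  have S1: "?S1 \<ge> 0" by (rule sum_nonneg) (rule n1)
  have N1: "DI I F (res (N \<union> I \<union> {d+1}) x) = 0" if "?S1 = 0" "I \<subseteq> M" "I \<noteq> {}" for I x
  proof -
    have "\<forall>I\<in>Pow M - {{}}. lI lamI I * a1 n n I * T1 I F F = 0"
      using that(1) n1 NM(2) by (subst (asm) sum_nonneg_eq_0_iff) auto
    then have "lI lamI I * a1 n n I * T1 I F F = 0" using that by blast
    moreover have "lI lamI I * a1 n n I > 0" using c1[of I] that by blast
    ultimately have "T1 I F F = 0" by (metis less_irrefl mult_eq_0_iff)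
    then show ?thesis using T1(2) that by blast
  qed
  show ?thesis
  proof (cases "k \<le> d")
    case True
    have c2: "(if k = 1 then 1 else lami i) * a2 n n > 0" if "i \<in> N" for i
      using P2[OF True] that a_pos(2)[of n n] by (intro mult_pos_pos) auto
    have c3: "lam * a3 n n > 0" using P2[OF True] a_pos(3)[OF True, of n n] by simp
    have n2: "(if k = 1 then 1 else lami i) * a2 n n * T2 i F F \<ge> 0" if "i \<in> N" for i
      using c2[OF that] T2(1)[OF that] by (rule mult_nonneg_nonneg[OF less_imp_le])
    have S2: "?S2 \<ge> 0" by (rule sum_nonneg) (rule n2)
    have S3: "lam * a3 n n * T3 F F \<ge> 0" using c3 T3(1) by (rule mult_nonneg_nonneg[OF less_imp_le])
    have "?S1 + (?S2 + lam * a3 n n * T3 F F) \<le> 0"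
      using le unfolding sob_ip_eq[OF F F] if_P[OF True] .
    with S1 S2 S3 have z: "?S1 = 0" "?S2 = 0" "lam * a3 n n * T3 F F = 0" by linarith+
    have N3: "F (res N x) = 0" for x using z(3) c3 T3(2) by (metis less_irrefl mult_eq_0_iff)
    have N2: "Dd (d+1) i F (res (N \<union> {d+1}) x) = 0" if i: "i \<in> N" for i x
    proof -
      have "\<forall>i\<in>N. (if k = 1 then 1 else lami i) * a2 n n * T2 i F F = 0"
        using z(2) n2 NM(1) by (subst (asm) sum_nonneg_eq_0_iff) auto
      then have "(if k = 1 then 1 else lami i) * a2 n n * T2 i F F = 0" using i by blast
      then have "T2 i F F = 0" using c2[OF i] by (metis less_irrefl mult_eq_0_iff)
      then show ?thesis using T2(2)[OF i] by blast
    qed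
    show ?thesis
      by (rule zero_from_faces[OF F N1[OF z(1)] zero_on_low_face[OF F True N2 N3]])
  next
    case False
    then have k: "k = d + 1" using kd by simp
    have n3: "lam0 j * F (xx d (ebas j)) * F (xx d (ebas j)) \<ge> 0" for j
      using P3[OF k] by (simp add: mult.assoc)
    have S3: "?S3 \<ge> 0" by (rule sum_nonneg) (rule n3)
    have "?S1 + ?S3 \<le> 0" using le unfolding sob_ip_eq[OF F F] if_not_P[OF False] .
    with S1 S3 have z: "?S1 = 0" "?S3 = 0" by linarith+
    obtain j where j: "j \<in> {0..d}" "lam0 j > 0" using P3[OF k] by blast
    have "\<forall>j\<in>{0..d}. lam0 j * F (xx d (ebas j)) * F (xx d (ebas j)) = 0"
      using z(2) n3 by (subst (asm) sum_nonneg_eq_0_iff) auto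
    then have "lam0 j * F (xx d (ebas j)) * F (xx d (ebas j)) = 0" using j(1) by blast
    then have "F (xx d (ebas j)) = 0" using j(2) by simp
    then show ?thesis
      using zero_from_faces[OF F N1[OF z(1)] zero_on_vertices[OF F k N1[OF z(1)] j(1)]] by blast
  qed
qed

end

section \<open>Orthogonality\<close>

text \<open>Sharper than \<open>hp_foldr_Dd\<close>: with more derivatives than degrees the degree
  set is empty and so records that the result is 0.\<close>

lemma hp_foldr_Dd_exact:
  assumes "F \<in> hp C {n}" "finite C"
  shows "foldr (Dd r) is F \<in> hp C {a. a + length is = n}"
proof (induction "is")
  case Nil
  then show ?case using assms(1) by simp
next
  case (Cons i "is")
  show ?case using hp_Dd[OF Cons assms(2), of "{a. a + length (i # is) = n}" r i] by auto
qed

lemma hp_foldr_Dd_UNIV: "F \<in> hp C UNIV \<Longrightarrow> finite C \<Longrightarrow> foldr (Dd r) is F \<in> hp C UNIV"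
  by (induction "is") (auto intro: hp_Dd)

lemma foldr_Dd_indep:
  assumes "F \<in> hp C UNIV" "finite C" "r \<notin> C" "i \<in> set is" "i \<notin> C"
  shows "foldr (Dd r) is F = (\<lambda>x. 0)"
  using assms(4)
proof (induction "is")
  case (Cons j "is")
  have H: "foldr (Dd r) is F \<in> hp C UNIV" by (rule hp_foldr_Dd_UNIV[OF assms(1,2)])
  show ?case
  proof (cases "i \<in> set is")
    case True
    then show ?thesis using Cons by (simp add: Dd_const)
  next
    case False
    then have ij: "i = j" using Cons by simp
    have "Dd r j (foldr (Dd r) is F) x = 0" for x
      using fun_cong[OF pd_hp_indep[OF H assms(5)], of x] fun_cong[OF pd_hp_indep[OF H assms(3)], of x] ij
      by (simp only: Dd_def)
    then show ?thesis by auto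
  qed
qed simp

lemma foldr_Dd_var_mult:
  assumes "pol f" "i \<notin> set is" "i \<noteq> r"
  shows "foldr (Dd r) is (\<lambda>x. x i * f x) = (\<lambda>x. x i * foldr (Dd r) is f x)"
  using assms(2)
proof (induction "is")
  case (Cons j "is")
  have "Dd r j (\<lambda>x. x i) = (\<lambda>x. 0)" using Cons.prems assms(3) by (auto simp: Dd_def pd_var)
  then show ?case using Cons pol_foldr_Dd[OF assms(1), of r "is"] by (simp add: Dd_mult pol_simps)
qed simp

section \<open>Integration by parts against face polynomials\<close>

lemma Lag_ibp0:
  assumes "finite C" "\<forall>i\<in>C. e i > -1" "i \<in> C" "e i = 0" "pol f"
  shows "Lag C e (pd i (\<lambda>x. x i * f x)) = Lag C e (\<lambda>x. x i * f x)"
  using Lag_ibp[OF assms(1,2,3,5)] assms(4) by simp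

text \<open>Assumption f stands for the vanishing of the boundary term at \<open>x_i = 0\<close>. As
  \<open>e i = 0\<close>, the weight contributes only its exponential, which produces the
  undifferentiated K.\<close>

lemma Lag_move_pd:
  assumes C: "finite C" "\<forall>i\<in>C. e i > -1" "i \<in> C" "e i = 0" and p: "pol K" "pol H" "pol R"
    and f: "(\<lambda>x. K x * H x) = (\<lambda>x. x i * R x)"
  shows "Lag C e (\<lambda>x. K x * pd i H x) = Lag C e (\<lambda>x. (K x - pd i K x) * H x)"
proof -
  have "Lag C e (\<lambda>x. K x * pd i H x) = Lag C e (\<lambda>x. pd i (\<lambda>x. x i * R x) x - pd i K x * H x)"
    by (simp add: f[symmetric] pd_mult p)
  also have "\<dots> = Lag C e (\<lambda>x. x i * R x) - Lag C e (\<lambda>x. pd i K x * H x)"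
    using p by (simp add: Lag_diff[OF C(1,2)] pol_simps Lag_ibp0[OF C p(3)])
  also have "\<dots> = Lag C e (\<lambda>x. K x * H x - pd i K x * H x)"
    using p by (simp add: f[symmetric] Lag_diff[OF C(1,2)] pol_simps)
  finally show ?thesis by (simp add: left_diff_distrib)
qed

text \<open>The undifferentiated terms of the two exponentials cancel, so the degree of the
  multiplier drops by one; the price is that both x_i and x_r must divide the product.\<close>

lemma Lag_move_Dd:
  assumes C: "finite C" "\<forall>i\<in>C. e i > -1" "i \<in> C" "e i = 0" "r \<in> C" "e r = 0" "i \<noteq> r"
    and p: "pol K" "pol H" "pol R" and f: "(\<lambda>x. K x * H x) = (\<lambda>x. x i * (x r * R x))"
  shows "Lag C e (\<lambda>x. K x * Dd r i H x) = Lag C e (\<lambda>x. - Dd r i K x * H x)"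
proof -
  have f': "(\<lambda>x. K x * H x) = (\<lambda>x. x r * (x i * R x))" using f by (simp add: mult.left_commute)
  have 1: "Lag C e (\<lambda>x. K x * pd i H x) = Lag C e (\<lambda>x. (K x - pd i K x) * H x)"
    by (rule Lag_move_pd[OF C(1-4) p(1,2) _ f]) (use p in \<open>auto intro!: pol_intros\<close>)
  have 2: "Lag C e (\<lambda>x. K x * pd r H x) = Lag C e (\<lambda>x. (K x - pd r K x) * H x)"
    by (rule Lag_move_pd[OF C(1,2,5,6) p(1,2) _ f']) (use p in \<open>auto intro!: pol_intros\<close>)
  have "Lag C e (\<lambda>x. K x * Dd r i H x) = Lag C e (\<lambda>x. K x * pd i H x) - Lag C e (\<lambda>x. K x * pd r H x)"
    unfolding Dd_def right_diff_distrib using p by (simp add: Lag_diff[OF C(1,2)] pol_simps)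
  also have "\<dots> = Lag C e (\<lambda>x. (K x - pd i K x) * H x - (K x - pd r K x) * H x)"
    unfolding 1 2 using p by (simp add: Lag_diff[OF C(1,2)] pol_simps)
  finally show ?thesis by (simp add: Dd_def algebra_simps)
qed

text \<open>The face polynomial does not involve the variable r, so the derivatives can be
  moved one variable at a time.\<close>

lemma Lag_move_foldr_pd:
  assumes C: "finite C" "\<forall>i\<in>C. e i > -1" and J: "C' \<subseteq> C" "J \<subseteq> C'" "\<forall>i\<in>J. e i = 0" "r \<notin> C'"
    and q: "q \<in> hp C' UNIV" and L: "distinct is" "set is \<subseteq> J" and K: "K \<in> hp C {..<b}"
  shows "\<exists>K'\<in>hp C {..<b}. Lag C e (\<lambda>x. K x * foldr (Dd r) is (\<lambda>x. (\<Prod>i\<in>J. x i) * q x) x) =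
    Lag C e (\<lambda>x. K' x * ((\<Prod>i\<in>J. x i) * q x))"
  using L K
proof (induction "is" arbitrary: K)
  case Nil
  then show ?case by (intro bexI[of _ K]) auto
next
  case (Cons i "is")
  let ?F = "\<lambda>x. (\<Prod>i\<in>J. x i) * q x" and ?F' = "\<lambda>x. (\<Prod>i\<in>J - {i}. x i) * q x"
  have fin: "finite C'" "finite J"
    using finite_subset[OF J(1) C(1)] finite_subset[OF J(2)] by auto
  have i: "i \<in> J" "i \<in> C" "e i = 0" "i \<noteq> r" "i \<notin> set is" using Cons.prems J by auto
  have pq: "pol q" by (rule hp_imp_pol[OF q])
  have pF': "pol ?F'" using pq by (intro pol_intros)
  have F: "?F = (\<lambda>x. x i * ?F' x)" using i fin by (simp add: prod.remove mult.assoc)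
  let ?H = "foldr (Dd r) is ?F"
  have H: "?H = (\<lambda>x. x i * foldr (Dd r) is ?F' x)"
    unfolding F by (rule foldr_Dd_var_mult[OF pF' i(5,4)])
  have FC: "?F \<in> hp C' UNIV"
    by (rule hp_mult[OF hp_prod_vars[OF fin(1) J(2)] q]) simp
  have "?H \<in> hp C' UNIV" by (rule hp_foldr_Dd_UNIV[OF FC fin(1)])
  then have "pd r ?H = (\<lambda>x. 0)" by (rule pd_hp_indep[OF _ J(4)])
  then have D: "Dd r i ?H = pd i ?H" by (simp add: Dd_def)
  have pK: "pol K" by (rule hp_imp_pol[OF Cons.prems(3)])
  have pH: "pol ?H" using pq by (intro pol_foldr_Dd pol_intros)
  have "Lag C e (\<lambda>x. K x * pd i ?H x) = Lag C e (\<lambda>x. (K x - pd i K x) * ?H x)"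
    by (rule Lag_move_pd[OF C i(2,3) pK pH, of "\<lambda>x. K x * foldr (Dd r) is ?F' x"])
      (use pK pF' H in \<open>auto intro!: pol_foldr_Dd pol_mult simp: mult.left_commute\<close>)
  moreover have "(\<lambda>x. K x - pd i K x) \<in> hp C {..<b}"
    by (rule hp_diff[OF Cons.prems(3) hp_pd[OF Cons.prems(3) C(1)]]) auto
  ultimately show ?case using Cons.IH[of "\<lambda>x. K x - pd i K x"] Cons.prems D by simp
qed

text \<open>The derivatives are moved from the outermost inwards, and each but the innermost spends
  one power of x_r on its boundary term; the innermost uses the factor x_r of the product, as r lies
  in J. For i in J the exponentials cancel and the multiplier that remains beside the power of x_r
  keeps its bound b. For i outside J the polynomial is free of x_i, \<open>Dd r i\<close> is
  \<open>- pd r\<close>, its exponential term stays and the bound grows by one. At the innermost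
  step, where no power of x_r is left to be lowered, the two outcomes are \<open>b - 1\<close> and
  b; this is the final \<open>- 1\<close>.\<close>

lemma Lag_move_foldr_Dd:
  assumes C: "finite C" "\<forall>i\<in>C. e i > -1" and r: "r \<in> C" "e r = 0" "r \<in> J"
    and J: "C' \<subseteq> C" "J \<subseteq> C'" and q: "q \<in> hp C' UNIV"
    and L: "is \<noteq> []" "distinct is" "set is \<subseteq> C - {r}" "\<forall>i\<in>set is. e i = 0 \<and> (i \<in> C' \<longrightarrow> i \<in> J)"
    and K: "K \<in> hp C {..<b}"
  shows "\<exists>K'\<in>hp C {..<b + card (set is - J) - 1}.
    Lag C e (\<lambda>x. x r ^ (length is - 1) * K x * foldr (Dd r) is (\<lambda>x. (\<Prod>i\<in>J. x i) * q x) x) =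
    Lag C e (\<lambda>x. K' x * ((\<Prod>i\<in>J. x i) * q x))"
  using L K
proof (induction "is" arbitrary: K b)
  case Nil
  then show ?case by simp
next
  case (Cons i "is")
  let ?F = "\<lambda>x. (\<Prod>i\<in>J. x i) * q x"
  let ?H = "foldr (Dd r) is ?F" and ?s = "length is"
  have fin: "finite C'" "finite J"
    using finite_subset[OF J(1) C(1)] finite_subset[OF J(2)] by auto
  have i: "i \<in> C" "e i = 0" "i \<noteq> r" "i \<notin> set is" "i \<in> C' \<longrightarrow> i \<in> J" using Cons.prems by auto
  have pq: "pol q" by (rule hp_imp_pol[OF q])
  have pK: "pol K" by (rule hp_imp_pol[OF Cons.prems(5)])
  have pH: "pol ?H" using pq by (intro pol_foldr_Dd pol_intros)
  have xr: "(\<lambda>x. x r) \<in> hp C {1}" using C r by (intro hp_var) auto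
  have K1: "(\<lambda>x. x r * K x) \<in> hp C {..<b + 1}"
    by (rule hp_mult[OF xr Cons.prems(5)]) auto
  have "?F \<in> hp C' UNIV" by (rule hp_mult[OF hp_prod_vars[OF fin(1) J(2)] q]) simp
  then have HC: "?H \<in> hp C' UNIV" by (rule hp_foldr_Dd_UNIV[OF _ fin(1)])
  have iH: "\<exists>R. pol R \<and> ?H = (\<lambda>x. x i * R x)" if "i \<in> J"
  proof -
    let ?F' = "\<lambda>x. (\<Prod>i\<in>J - {i}. x i) * q x"
    have pF': "pol ?F'" using pq by (intro pol_intros)
    have F: "?F = (\<lambda>x. x i * ?F' x)" using that fin by (simp add: prod.remove mult.assoc)
    show ?thesis unfolding F foldr_Dd_var_mult[OF pF' i(4,3)] using pol_foldr_Dd[OF pF'] by blast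
  qed
  have Dneg: "Dd r i ?H = (\<lambda>x. - pd r ?H x)" if "i \<notin> J"
    using pd_hp_indep[OF HC, of i] that i(5) by (simp add: Dd_def)
  show ?case
  proof (cases "is = []")
    case True
    have H: "?H = ?F" using True by simp
    have F: "?F x = x r * ((\<Prod>i\<in>J - {r}. x i) * q x)" for x
      using r fin by (simp add: prod.remove mult.assoc)
    show ?thesis
    proof (cases "i \<in> J")
      case iJ: True
      have F2: "?F x = x i * (x r * ((\<Prod>i\<in>J - {r} - {i}. x i) * q x))" for x
      proof -
        have "i \<in> J - {r}" using iJ i by simp
        then show ?thesis using r fin by (simp add: prod.remove mult.left_commute mult.assoc)
      qed
      have "Lag C e (\<lambda>x. K x * Dd r i ?F x) = Lag C e (\<lambda>x. - Dd r i K x * ?F x)"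
        by (rule Lag_move_Dd[OF C i(1,2) r(1,2) i(3) pK, of _ "\<lambda>x. K x * ((\<Prod>i\<in>J - {r} - {i}. x i) * q x)"])
          (use pK pq in \<open>auto intro!: pol_intros simp only: F2 mult.left_commute\<close>)
      moreover have "(\<lambda>x. - Dd r i K x) \<in> hp C {..<b - 1}"
        by (rule hp_uminus[OF hp_Dd[OF Cons.prems(5) C(1)]]) auto
      moreover have "set (i # is) - J = {}" using True iJ by simp
      ultimately show ?thesis using True by (intro bexI[of _ "\<lambda>x. - Dd r i K x"]) auto
    next
      case iJ: False
      have "Lag C e (\<lambda>x. K x * pd r ?F x) = Lag C e (\<lambda>x. (K x - pd r K x) * ?F x)"
        by (rule Lag_move_pd[OF C r(1,2) pK, of _ "\<lambda>x. K x * ((\<Prod>i\<in>J - {r}. x i) * q x)"])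
          (use pK pq in \<open>auto intro!: pol_intros simp only: F mult.left_commute\<close>)
      then have "Lag C e (\<lambda>x. K x * Dd r i ?F x) = Lag C e (\<lambda>x. (pd r K x - K x) * ?F x)"
        using Dneg[OF iJ] H Lag_uminus[of C e "\<lambda>x. K x * pd r ?F x"] Lag_uminus[of C e "\<lambda>x. (K x - pd r K x) * ?F x"]
        by (simp add: algebra_simps)
      moreover have "(\<lambda>x. pd r K x - K x) \<in> hp C {..<b}"
        by (rule hp_diff[OF hp_pd[OF Cons.prems(5) C(1)] Cons.prems(5)]) auto
      moreover have "set (i # is) - J = {i}" using True iJ by auto
      ultimately show ?thesis using True by (intro bexI[of _ "\<lambda>x. pd r K x - K x"]) auto
    qed
  next
    case False
    then obtain s where s: "?s = Suc s" by (cases "is") auto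
    let ?Z = "\<lambda>x. x r ^ Suc s * K x"
    have pZ: "pol ?Z" using pK by (intro pol_intros)
    have prZ: "pd r ?Z = (\<lambda>x. x r ^ s * (real (Suc s) * K x + x r * pd r K x))"
      using pK by (simp only: pd_mult pol_power pol_var pd_power_var) (simp add: algebra_simps)
    have piZ: "pd i ?Z = (\<lambda>x. x r ^ s * (x r * pd i K x))"
    proof -
      have "pd i (\<lambda>x. x r ^ Suc s) = (\<lambda>x. 0)" using i by (intro pd_indep) auto
      then show ?thesis using pK by (simp only: pd_mult pol_power pol_var) (simp add: algebra_simps)
    qed
    have IHs: "\<exists>K'\<in>hp C {..<b' + card (set is - J) - 1}.
       Lag C e (\<lambda>x. x r ^ s * K1 x * ?H x) = Lag C e (\<lambda>x. K' x * ?F x)" if "K1 \<in> hp C {..<b'}" for K1 b'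
      using Cons.IH[OF False _ _ _ that] Cons.prems s by simp
    have len: "length (i # is) - 1 = Suc s" using s by simp
    show ?thesis
    proof (cases "i \<in> J")
      case iJ: True
      obtain R where R: "pol R" "?H = (\<lambda>x. x i * R x)" using iH[OF iJ] by blast
      let ?K1 = "\<lambda>x. real (Suc s) * K x - x r * Dd r i K x"
      have "(\<lambda>x. x r * Dd r i K x) \<in> hp C {..<b}"
        by (rule hp_mult[OF xr hp_Dd[OF Cons.prems(5) C(1), of "{..<b - 1}"]]) auto
      then have K1: "?K1 \<in> hp C {..<b}" by (intro hp_diff hp_scale Cons.prems(5))
      have "Lag C e (\<lambda>x. ?Z x * Dd r i ?H x) = Lag C e (\<lambda>x. - Dd r i ?Z x * ?H x)"
        by (rule Lag_move_Dd[OF C i(1,2) r(1,2) i(3) pZ pH, of "\<lambda>x. x r ^ s * K x * R x"])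
          (use pK R in \<open>auto intro!: pol_intros simp: mult_ac\<close>)
      also have "(\<lambda>x. - Dd r i ?Z x * ?H x) = (\<lambda>x. x r ^ s * ?K1 x * ?H x)"
        unfolding Dd_def prZ piZ by (auto simp: algebra_simps)
      finally have eq: "Lag C e (\<lambda>x. ?Z x * Dd r i ?H x) = Lag C e (\<lambda>x. x r ^ s * ?K1 x * ?H x)" .
      have "set (i # is) - J = set is - J" using iJ by auto
      then show ?thesis using IHs[OF K1] eq unfolding len by simp
    next
      case iJ: False
      let ?K1 = "\<lambda>x. (real (Suc s) * K x + x r * pd r K x) - x r * K x"
      have "(\<lambda>x. x r * pd r K x) \<in> hp C {..<b + 1}"
        by (rule hp_mult[OF xr hp_pd[OF Cons.prems(5) C(1), of "{..<b}"]]) auto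
      moreover have "K \<in> hp C {..<b + 1}" by (rule hp_mono[OF Cons.prems(5)]) auto
      ultimately have K1: "?K1 \<in> hp C {..<b + 1}"
        by (intro hp_diff[OF hp_add[OF hp_scale]] K1)
      have "Lag C e (\<lambda>x. ?Z x * pd r ?H x) = Lag C e (\<lambda>x. (?Z x - pd r ?Z x) * ?H x)"
        by (rule Lag_move_pd[OF C r(1,2) pZ pH, of "\<lambda>x. x r ^ s * K x * ?H x"])
          (use pK pH in \<open>auto intro!: pol_mult pol_power pol_var simp: mult_ac\<close>)
      then have "Lag C e (\<lambda>x. ?Z x * Dd r i ?H x) = Lag C e (\<lambda>x. - ((?Z x - pd r ?Z x) * ?H x))"
        unfolding Dneg[OF iJ] Lag_uminus mult_minus_right by simp
      also have "(\<lambda>x. - ((?Z x - pd r ?Z x) * ?H x)) = (\<lambda>x. x r ^ s * ?K1 x * ?H x)"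
        unfolding prZ by (auto simp: algebra_simps)
      finally have eq: "Lag C e (\<lambda>x. ?Z x * Dd r i ?H x) = Lag C e (\<lambda>x. x r ^ s * ?K1 x * ?H x)" .
      have "set (i # is) - J = insert i (set is - J)" using iJ by auto
      then have "card (set (i # is) - J) = Suc (card (set is - J))" using i(4) by simp
      then show ?thesis using IHs[OF K1] eq unfolding len by simp
    qed
  qed
qed

context jacobi
begin

definition B :: "nat set" where "B = M \<union> {d+1}"
definition eJ :: "nat set \<Rightarrow> nat \<Rightarrow> real" where "eJ J = epsJ d k \<gamma> J"
text \<open>Split because \<open>n - card J\<close> is truncated: for \<open>card J > n\<close> the
  index is negative and the space is zero.\<close>

definition H_hom :: "nat set \<Rightarrow> nat \<Rightarrow> fn set" where
  "H_hom J n = (if card J \<le> n then Hp (N \<union> J) (eJ J) (n - card J) else {\<lambda>x. 0})"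

lemma B_props: "finite B" "B \<subseteq> V" "N \<inter> B = {}" "N \<union> B = V" "card B = k"
  using NM k1 by (auto simp: B_def)

lemma e0B: "i \<in> B \<Longrightarrow> e0 i = 0"
  using B_props by (auto simp: e0_def gz_def)

text \<open>The weight with exponents \<open>eJ J\<close> is that of \<open>e0\<close> times x_J, so
  pairing x_J q in the weight \<open>e0\<close> is pairing q in its own weight.\<close>

lemma eJ_shift: "J \<subseteq> B \<Longrightarrow> i \<in> V \<Longrightarrow> eJ J i = (if i \<in> J then e0 i + 1 else e0 i)"
proof -
  assume J: "J \<subseteq> B" and i: "i \<in> V"
  have "i \<in> N \<longleftrightarrow> i \<le> d + 1 - k" using i by (auto simp: N_def)
  then show ?thesis using e0B[of i] J B_props by (auto simp: eJ_def epsJ_def e0_def gz_def)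
qed

lemma eJ_gt: "J \<subseteq> B \<Longrightarrow> i \<in> V \<Longrightarrow> eJ J i > -1"
  using e0[of i] by (simp add: eJ_shift)

text \<open>The end point of all the orthogonality arguments: x_J is absorbed into the weight and q
  meets a multiplier of too small degree on a larger face. Outside \<open>N \<union> J\<close> the
  exponents may differ from \<open>e0\<close>, which leaves room for a power of x_{d+1} kept in the
  weight.\<close>

lemma Lag_face_orth:
  assumes C: "C \<subseteq> V" "N \<union> J \<subseteq> C" and J: "J \<subseteq> B" and q: "q \<in> Hp (N \<union> J) (eJ J) l"
    and K: "K \<in> hp C {..<l}" and e: "\<forall>i\<in>C. e i > -1" "\<forall>i\<in>N \<union> J. e i = e0 i"
  shows "Lag C e (\<lambda>x. K x * ((\<Prod>i\<in>J. x i) * q x)) = 0"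
proof -
  have fC: "finite C" using C finite_subset by blast
  let ?e = "\<lambda>i. if i \<in> J then e i + 1 else e i"
  have "Hp (N \<union> J) (eJ J) l = Hp (N \<union> J) ?e l"
    by (rule Hp_cong_exp) (use eJ_shift[OF J] C e(2) in auto)
  then have q': "q \<in> Hp (N \<union> J) ?e l" using q by simp
  have "Lag C e (\<lambda>x. K x * ((\<Prod>i\<in>J. x i) * q x)) = Lag C e (\<lambda>x. (\<Prod>i\<in>J. x i) * (q x * K x))"
    by (simp add: mult_ac)
  also have "\<dots> = Lag C ?e (\<lambda>x. q x * K x)"
    by (rule Lag_shift[OF fC]) (use C in auto)
  also have "\<dots> = 0"
    by (rule Hp_orth_ext[OF fC _ C(2) q' K]) (use e(1) in \<open>auto intro: less_trans\<close>)
  finally show ?thesis .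
qed

lemma prod_res_zero:
  assumes "finite J" "i \<in> J" "i \<notin> C"
  shows "(\<Prod>i\<in>J. res C x i) = 0"
  using assms by (auto simp: res_def intro!: prod_zero)

text \<open>If J has a vertex outside the face, x_J vanishes on it. If the polynomial involves
  neither x_{d+1} nor some x_i with i in I, the derivative in direction i kills it. Otherwise all
  derivatives are moved to G, and the resulting multiplier has degree below
  \<open>n - card J\<close>.\<close>

lemma T1_orth:
  assumes I: "I \<subseteq> M" "I \<noteq> {}" and J: "J \<subseteq> B" "card J \<le> n" and q: "q \<in> Hp (N \<union> J) (eJ J) (n - card J)"
    and G: "G \<in> hp V {m}" "m < n"
  shows "T1 I (\<lambda>x. (\<Prod>i\<in>J. x i) * q x) G = 0"
proof -
  let ?C = "N \<union> I \<union> {d+1}" and ?F = "\<lambda>x. (\<Prod>i\<in>J. x i) * q x" and ?L = "sorted_list_of_set I"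
  let ?K = "\<lambda>x. DI I G (res ?C x)"
  have CV: "?C \<subseteq> V" using NM(7) I by blast
  have fin: "finite I" "finite J" "finite ?C"
    using finite_subset[OF I(1) NM(2)] finite_subset[OF J(1) B_props(1)] finI[OF I(1)] by auto
  have L: "set ?L = I" "distinct ?L" "length ?L = card I" using fin by auto
  have "DI I G \<in> hp V {a. a + card I = m}"
    unfolding DI_def using hp_foldr_Dd_exact[OF G(1), of "d+1" ?L] L(3) by simp
  then have K: "?K \<in> hp ?C {a. a + card I = m}" by (rule hp_res) (use fin in auto)
  have T: "T1 I ?F G = Lag ?C e0 (\<lambda>x. x (d+1) ^ (card I - 1) * ?K x * DI I ?F x)"
    unfolding T1_def by (rule Lag_cong) (simp add: res_res mult_ac)
  show ?thesis
  proof (cases "J \<subseteq> I \<union> {d+1}")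
    case False
    then obtain i where i: "i \<in> J" "i \<notin> I \<union> {d+1}" by blast
    then have "i \<notin> ?C" using J B_props by auto
    then have "(\<lambda>x. ?F (res ?C x)) = (\<lambda>x. 0)" using prod_res_zero[OF fin(2) i(1)] by simp
    moreover have "foldr (Dd (d+1)) ?L (\<lambda>x. ?F (res ?C x)) = (\<lambda>x. DI I ?F (res ?C x))"
      unfolding DI_def by (rule foldr_Dd_res) (use L in auto)
    ultimately have "foldr (Dd (d+1)) ?L (\<lambda>x. 0) = (\<lambda>x. DI I ?F (res ?C x))" by simp
    moreover have "foldr (Dd (d+1)) L (\<lambda>x. 0) = (\<lambda>x. 0)" for L
      by (induction L) (simp_all add: Dd_const)
    ultimately have "DI I ?F (res ?C x) = 0" for x by metis
    then have "T1 I ?F G = Lag ?C e0 (\<lambda>x. 0)" unfolding T by (intro Lag_cong) simp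
    then show ?thesis by (simp add: Lag_zero)
  next
    case JI: True
    have NJ: "N \<union> J \<subseteq> ?C" using JI by auto
    have qh: "q \<in> hp (N \<union> J) UNIV" by (rule hp_mono[OF Hp_hp[OF q]]) auto
    have fNJ: "finite (N \<union> J)" using fin NM by auto
    have FJ: "?F \<in> hp (N \<union> J) UNIV"
      by (rule hp_mult[OF hp_prod_vars[OF fNJ] qh, of J]) auto
    have eC: "\<forall>i\<in>?C. e0 i > -1" using e0 by blast
    have e0I: "e0 i = 0" if "i \<in> I \<union> {d+1}" for i using that I by (intro e0B) (auto simp: B_def)
    show ?thesis
    proof (cases "d + 1 \<in> J")
      case uJ: False
      have uNJ: "d + 1 \<notin> N \<union> J" using uJ NM by auto
      show ?thesis
      proof (cases "J = I")
        case False
        then obtain i where i: "i \<in> I" "i \<notin> J" using JI uJ by blast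
        then have "i \<notin> N \<union> J" using I NM by auto
        then have "DI I ?F = (\<lambda>x. 0)"
          unfolding DI_def using foldr_Dd_indep[OF FJ fNJ uNJ] i L by auto
        then show ?thesis unfolding T by (simp add: Lag_zero)
      next
        case JeqI: True
        \<comment> \<open>x_J q is free of x_{d+1}, so the power of x_{d+1} stays in the weight
          while only the variables in I are integrated by parts.\<close>
        let ?e = "e0(d+1 := e0 (d+1) + real (card I - 1))"
        have ee: "\<forall>i\<in>?C. ?e i > -1"
        proof
          fix i show "?e i > -1" using e0[of i] e0[of "d+1"] by auto
        qed
        have K': "?K \<in> hp ?C {..<m + 1 - card I}" by (rule hp_mono[OF K]) auto
        have eJ0: "\<forall>i\<in>J. ?e i = 0" using e0I JeqI uJ by auto
        have LJ: "set ?L \<subseteq> J" using L(1) JeqI by simp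
        obtain K2 where K2: "K2 \<in> hp ?C {..<m + 1 - card I}"
          "Lag ?C ?e (\<lambda>x. ?K x * DI I ?F x) = Lag ?C ?e (\<lambda>x. K2 x * ?F x)"
          using Lag_move_foldr_pd[OF fin(3) ee NJ Un_upper2 eJ0 uNJ qh L(2) LJ K'] unfolding DI_def
          by blast
        have "T1 I ?F G = Lag ?C ?e (\<lambda>x. ?K x * DI I ?F x)"
          unfolding T using Lag_pow_var[OF fin(3), of "d+1" e0 "card I - 1" "\<lambda>x. ?K x * DI I ?F x"]
          by (simp add: mult.assoc)
        also note K2(2)
        also have "Lag ?C ?e (\<lambda>x. K2 x * ?F x) = 0"
        proof (rule Lag_face_orth[OF CV NJ J(1) q _ ee])
          show "K2 \<in> hp ?C {..<n - card J}"
            by (rule hp_mono[OF K2(1)]) (use G(2) JeqI in auto)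
          show "\<forall>i\<in>N \<union> J. ?e i = e0 i" using uNJ by auto
        qed
        finally show ?thesis .
      qed
    next
      case uJ: True
      show ?thesis
      proof (cases "card I \<le> m")
        case False
        then have "{a. a + card I = m} = {}" by auto
        then have "?K = (\<lambda>x. 0)" using K hp_empty_degrees by auto
        then have "DI I G (res ?C x) = 0" for x by metis
        then show ?thesis unfolding T by (simp add: Lag_zero)
      next
        case Im: True
        have K': "?K \<in> hp ?C {..<m + 1 - card I}" by (rule hp_mono[OF K]) auto
        have "I \<noteq> {}" by (rule I(2))
        then have Lne: "?L \<noteq> []" using L(1) by auto
        have LC: "set ?L \<subseteq> ?C - {d+1}" using L(1) I NM by auto
        have LJ: "\<forall>i\<in>set ?L. e0 i = 0 \<and> (i \<in> N \<union> J \<longrightarrow> i \<in> J)"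
          using L(1) e0I I NM by auto
        obtain K2 where K2: "K2 \<in> hp ?C {..<m + 1 - card I + card (set ?L - J) - 1}"
          "Lag ?C e0 (\<lambda>x. x (d+1) ^ (length ?L - 1) * ?K x * foldr (Dd (d+1)) ?L ?F x) = Lag ?C e0 (\<lambda>x. K2 x * ?F x)"
          using Lag_move_foldr_Dd[OF fin(3) eC _ e0I uJ NJ _ qh Lne L(2) LC LJ K'] by auto
        \<comment> \<open>As J consists of \<open>d + 1\<close> and elements of I, the number of
          derivatives outside J is \<open>card I - card J + 1\<close>. The bound becomes
          \<open>m + 1 - card J\<close>, and \<open>m < n\<close> is just enough.\<close>
        have "m + 1 - card I + card (set ?L - J) - 1 \<le> n - card J"
        proof -
          have "J - {d+1} \<subseteq> I" using JI by auto
          then have "card (I - (J - {d+1})) = card I - card (J - {d+1})"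
            using fin by (intro card_Diff_subset) auto
          moreover have "I - (J - {d+1}) = I - J" using I NM by auto
          moreover have "card (J - {d+1}) = card J - 1" "card J \<ge> 1"
            using uJ fin by (auto simp: Suc_le_eq card_gt_0_iff)
          moreover have "card (J - {d+1}) \<le> card I" using \<open>J - {d+1} \<subseteq> I\<close> fin card_mono by blast
          ultimately show ?thesis using L(1) Im G(2) by simp
        qed
        then have "K2 \<in> hp ?C {..<n - card J}" using K2(1) by (auto elim: hp_mono)
        from Lag_face_orth[OF CV NJ J(1) q this eC] K2(2) L(3) show ?thesis unfolding T DI_def by simp
      qed
    qed
  qed
qed

end

section \<open>The differential equation of the face spaces\<close>

lemma euler_hp:
  assumes "finite C" "F \<in> hp C {n}"
  shows "(\<Sum>i\<in>C. x i * pd i F x) = real n * F x"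
  using assms(2)
proof induction
  case zero
  then show ?case by (simp add: pd_const)
next
  case (step f a c)
  have pf: "pol f" by (rule hp_imp_pol[OF step(1)])
  have m: "x i * pd i (mon C a) x = real (a i) * mon C a x" if "i \<in> C" for i
  proof -
    have "mon (C - {i}) (a(i := a i - 1)) x = mon (C - {i}) a x"
      unfolding mon_def by (rule prod.cong) auto
    then have "x i * mon C (a(i := a i - 1)) x = mon C a x" if "a i > 0"
      using mon_split[OF assms(1) \<open>i \<in> C\<close>] that by (simp add: power_eq_if)
    then show ?thesis by (cases "a i = 0") (auto simp: pd_mon[OF assms(1) that])
  qed
  have "(\<Sum>i\<in>C. x i * pd i (\<lambda>x. f x + c * mon C a x) x) =
    (\<Sum>i\<in>C. x i * pd i f x) + c * (\<Sum>i\<in>C. x i * pd i (mon C a) x)"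
    by (simp add: pd_add pd_scale pf pol_simps sum.distrib sum_distrib_left algebra_simps)
  also have "(\<Sum>i\<in>C. x i * pd i (mon C a) x) = (\<Sum>i\<in>C. real (a i) * mon C a x)"
    by (rule sum.cong) (auto simp: m)
  also have "\<dots> = real n * mon C a x"
    using step(2) by (auto simp: sum_distrib_right[symmetric])
  finally show ?case using step(3) by (simp add: distrib_left)
qed

text \<open>The left-hand side R has degree \<open>n - 1\<close>. Against any S of this degree,
  integration by parts turns the second-order operator into the Euler operator, so R pairs with S
  like \<open>n * Q\<close>, which gives 0; then S = R.\<close>

lemma Hp_harmonic:
  assumes C: "finite C" "\<forall>i\<in>C. e i > -1" and Q: "Q \<in> Hp C e n"
  shows "(\<Sum>i\<in>C. (e i + 1) * pd i Q x + x i * pd i (pd i Q) x) = 0"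
proof -
  let ?R = "\<lambda>x. \<Sum>i\<in>C. (e i + 1) * pd i Q x + x i * pd i (pd i Q) x"
  let ?E = "{a. a + 1 = n}"
  have Qh: "Q \<in> hp C {n}" by (rule Hp_hp[OF Q])
  have pQ: "pol Q" by (rule hp_imp_pol[OF Qh])
  have xi: "(\<lambda>x. x i) \<in> hp C {1}" if "i \<in> C" for i using C that by (intro hp_var) auto
  have p1: "pd i Q \<in> hp C ?E" for i by (rule hp_pd[OF Qh C(1)]) auto
  have p2: "pd i (pd i Q) \<in> hp C {a. a + 2 = n}" for i by (rule hp_pd[OF p1 C(1)]) auto
  have R: "?R \<in> hp C ?E"
  proof (intro hp_sum hp_add hp_scale p1)
    fix i assume "i \<in> C"
    show "(\<lambda>x. x i * pd i (pd i Q) x) \<in> hp C ?E"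
      by (rule hp_mult[OF xi[OF \<open>i \<in> C\<close>] p2]) auto
  qed
  have z: "Lag C e (\<lambda>x. Q x * S x) = 0" if "S \<in> hp C ?E" for S
  proof -
    have "S \<in> hp C {..<n}" by (rule hp_mono[OF that]) auto
    then show ?thesis using Q by (simp add: Hp_def)
  qed
  have "Lag C e (\<lambda>x. ?R x * S x) = 0" if S: "S \<in> hp C ?E" for S
  proof -
    have pS: "pol S" by (rule hp_imp_pol[OF S])
    \<comment> \<open>Two integrations by parts: the first leaves a term with
      \<open>pd i Q * pd i S\<close>, the second shows that this term pairs Q with degree below n
      only and hence vanishes.\<close>
    have A: "Lag C e (\<lambda>x. ((e i + 1) * pd i Q x + x i * pd i (pd i Q) x) * S x) =
        Lag C e (\<lambda>x. x i * pd i Q x * S x)" if i: "i \<in> C" for i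
    proof -
      have "Lag C e (\<lambda>x. pd i (\<lambda>x. x i * (pd i Q x * S x)) x) = Lag C e (\<lambda>x. (x i - e i) * (pd i Q x * S x))"
        by (rule Lag_ibp[OF C i]) (intro pol_mult pol_pd pQ pS)
      moreover have "(\<lambda>x. ((e i + 1) * pd i Q x + x i * pd i (pd i Q) x) * S x) =
         (\<lambda>x. (pd i (\<lambda>x. x i * (pd i Q x * S x)) x + e i * (pd i Q x * S x)) - x i * (pd i Q x * pd i S x))"
        using pQ pS by (simp add: pd_mult pd_var pol_simps algebra_simps)
      moreover have "(\<lambda>x. pd i (\<lambda>x. x i * (Q x * pd i S x)) x) =
         (\<lambda>x. x i * (pd i Q x * pd i S x) + Q x * (pd i S x + x i * pd i (pd i S) x))"
        using pQ pS by (simp add: pd_mult pd_var pol_simps algebra_simps)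
      moreover have "Lag C e (\<lambda>x. pd i (\<lambda>x. x i * (Q x * pd i S x)) x) = Lag C e (\<lambda>x. (x i - e i) * (Q x * pd i S x))"
        by (rule Lag_ibp[OF C i]) (intro pol_mult pol_pd pQ pS)
      moreover have "Lag C e (\<lambda>x. (x i - e i) * (Q x * pd i S x)) = 0"
      proof -
        have d: "pd i S \<in> hp C {..<n - 1}" by (rule hp_pd[OF S C(1)]) auto
        have "(\<lambda>x. (x i - e i) * pd i S x) \<in> hp C {..<n}"
        proof -
          have "(\<lambda>x. x i * pd i S x) \<in> hp C {..<n}" by (rule hp_mult[OF xi[OF i] d]) auto
          moreover have "(\<lambda>x. e i * pd i S x) \<in> hp C {..<n}" by (rule hp_scale[OF hp_mono[OF d]]) auto
          ultimately show ?thesis unfolding left_diff_distrib by (rule hp_diff)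
        qed
        then show ?thesis using Q by (simp add: Hp_def mult.left_commute)
      qed
      moreover have "Lag C e (\<lambda>x. Q x * (pd i S x + x i * pd i (pd i S) x)) = 0"
      proof -
        have d: "pd i S \<in> hp C {..<n - 1}" by (rule hp_pd[OF S C(1)]) auto
        have d2: "pd i (pd i S) \<in> hp C {..<n - 1}" by (rule hp_pd[OF d C(1)]) auto
        have "(\<lambda>x. x i * pd i (pd i S) x) \<in> hp C {..<n}" by (rule hp_mult[OF xi[OF i] d2]) auto
        moreover have "pd i S \<in> hp C {..<n}" by (rule hp_mono[OF d]) auto
        ultimately have "(\<lambda>x. pd i S x + x i * pd i (pd i S) x) \<in> hp C {..<n}" by (intro hp_add)
        then show ?thesis using Q by (simp add: Hp_def)
      qed
      ultimately have e1: "Lag C e (\<lambda>x. x i * (pd i Q x * pd i S x)) = 0"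
        using Lag_add[OF C, of "\<lambda>x. x i * (pd i Q x * pd i S x)" "\<lambda>x. Q x * (pd i S x + x i * pd i (pd i S) x)"] pQ pS
        by (simp add: pol_simps)
      have "Lag C e (\<lambda>x. ((e i + 1) * pd i Q x + x i * pd i (pd i Q) x) * S x) =
          Lag C e (\<lambda>x. pd i (\<lambda>x. x i * (pd i Q x * S x)) x) + Lag C e (\<lambda>x. e i * (pd i Q x * S x))"
        using \<open>(\<lambda>x. ((e i + 1) * pd i Q x + x i * pd i (pd i Q) x) * S x) = _\<close> e1 pQ pS
        by (simp add: Lag_diff[OF C] Lag_add[OF C] pol_simps)
      also have "\<dots> = Lag C e (\<lambda>x. (x i - e i) * (pd i Q x * S x)) + Lag C e (\<lambda>x. e i * (pd i Q x * S x))"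
        using \<open>Lag C e (\<lambda>x. pd i (\<lambda>x. x i * (pd i Q x * S x)) x) = _\<close> by simp
      also have "\<dots> = Lag C e (\<lambda>x. (x i - e i) * (pd i Q x * S x) + e i * (pd i Q x * S x))"
        using pQ pS by (simp add: Lag_add[OF C] pol_simps)
      finally show ?thesis by (simp add: algebra_simps)
    qed
    have "Lag C e (\<lambda>x. ?R x * S x) = (\<Sum>i\<in>C. Lag C e (\<lambda>x. ((e i + 1) * pd i Q x + x i * pd i (pd i Q) x) * S x))"
      unfolding sum_distrib_right using pQ pS by (intro Lag_sum[OF C]) (simp add: pol_simps)
    also have "\<dots> = (\<Sum>i\<in>C. Lag C e (\<lambda>x. x i * pd i Q x * S x))"
      by (rule sum.cong) (auto simp: A)
    also have "\<dots> = Lag C e (\<lambda>x. (\<Sum>i\<in>C. x i * pd i Q x) * S x)"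
      unfolding sum_distrib_right using pQ pS by (intro Lag_sum[OF C, symmetric]) (simp add: pol_simps)
    also have "\<dots> = real n * Lag C e (\<lambda>x. Q x * S x)"
      unfolding euler_hp[OF C(1) Qh] mult.assoc by (rule Lag_scale)
    finally show ?thesis using z[OF S] by simp
  qed
  from this[OF R] have "?R (res C x) = 0" by (rule Lag_square_pos[OF C hp_imp_pol[OF R]])
  then show ?thesis using hp_res_same[OF R] by simp
qed

context jacobi
begin

text \<open>The factor x_i and the weight remove the boundary term at \<open>x_i = 0\<close>, the
  factor x_{d+1} the one at \<open>x_{d+1} = 0\<close>. The exponentials cancel and only
  \<open>- \<gamma> i\<close> remains of the weight, so no degree is lost.\<close>

lemma T2_apex:
  assumes i: "i \<in> N" and p: "pol q" "pol K"
  shows "Lag (N \<union> {d+1}) e0 (\<lambda>x. x i * (Dd (d+1) i (\<lambda>x. x (d+1) * q x) x * K x)) =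
    Lag (N \<union> {d+1}) e0 (\<lambda>x. (- \<gamma> i * K x - Dd (d+1) i (\<lambda>x. x i * K x) x) * (x (d+1) * q x))"
proof -
  let ?u = "d + 1" and ?C = "N \<union> {d+1}"
  let ?F = "\<lambda>x. x (d+1) * q x"
  have C: "finite ?C" "\<forall>i\<in>?C. e0 i > -1" using NM e0 by auto
  have iu: "i \<noteq> ?u" "?u \<noteq> i" using i NM by auto
  have g: "e0 i = \<gamma> i" "e0 ?u = 0" using i NM by (auto simp: e0_def gz_def)
  let ?P = "\<lambda>x. x i * (?F x * K x)"
  have pP: "pol ?P" using p by (intro pol_intros)
  have "Lag ?C e0 (pd i ?P) = Lag ?C e0 (\<lambda>x. (x i - \<gamma> i) * (?F x * K x))"
    using Lag_ibp[OF C, of i "\<lambda>x. ?F x * K x"] i p g by (simp add: pol_intros)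
  moreover have "Lag ?C e0 (pd ?u ?P) = Lag ?C e0 ?P"
  proof -
    have "?P = (\<lambda>x. x ?u * (x i * (q x * K x)))" by (auto simp: mult_ac)
    then show ?thesis using Lag_ibp0[OF C, of ?u "\<lambda>x. x i * (q x * K x)"] p g by (simp add: pol_intros)
  qed
  ultimately have "Lag ?C e0 (Dd ?u i ?P) = Lag ?C e0 (\<lambda>x. (x i - \<gamma> i) * (?F x * K x)) - Lag ?C e0 ?P"
    unfolding Dd_def by (simp only: Lag_diff[OF C pol_pd[OF pP] pol_pd[OF pP]])
  also have "\<dots> = Lag ?C e0 (\<lambda>x. (x i - \<gamma> i) * (?F x * K x) - ?P x)"
    by (rule Lag_diff[OF C, symmetric]) (use p in \<open>auto intro!: pol_intros\<close>)
  also have "\<dots> = Lag ?C e0 (\<lambda>x. - \<gamma> i * (?F x * K x))"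
    by (simp add: algebra_simps)
  finally have 1: "Lag ?C e0 (Dd ?u i ?P) = Lag ?C e0 (\<lambda>x. - \<gamma> i * (?F x * K x))" .
  have pF: "pol ?F" and pxK: "pol (\<lambda>x. x i * K x)" using p by (auto intro!: pol_intros)
  have "?P = (\<lambda>x. ?F x * (x i * K x))" by (auto simp: mult_ac)
  then have D: "Dd ?u i ?P = (\<lambda>x. Dd ?u i ?F x * (x i * K x) + ?F x * Dd ?u i (\<lambda>x. x i * K x) x)"
    using Dd_mult[OF pF pxK] by simp
  have "Lag ?C e0 (\<lambda>x. x i * (Dd ?u i ?F x * K x)) =
     Lag ?C e0 (\<lambda>x. Dd ?u i ?P x - ?F x * Dd ?u i (\<lambda>x. x i * K x) x)"
    unfolding D by (simp add: mult_ac)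
  also have "\<dots> = Lag ?C e0 (Dd ?u i ?P) - Lag ?C e0 (\<lambda>x. ?F x * Dd ?u i (\<lambda>x. x i * K x) x)"
    by (rule Lag_diff[OF C]) (use pP pF pxK in \<open>auto intro!: pol_Dd pol_mult pol_var p\<close>)
  also have "\<dots> = Lag ?C e0 (\<lambda>x. - \<gamma> i * (?F x * K x) - ?F x * Dd ?u i (\<lambda>x. x i * K x) x)"
    unfolding 1 by (rule Lag_diff[OF C, symmetric]) (use p pF pxK in \<open>auto intro!: pol_Dd pol_intros\<close>)
  also have "(\<lambda>x. - \<gamma> i * (?F x * K x) - ?F x * Dd ?u i (\<lambda>x. x i * K x) x) =
    (\<lambda>x. (- \<gamma> i * K x - Dd ?u i (\<lambda>x. x i * K x) x) * ?F x)"
    by (auto simp: algebra_simps)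
  finally show ?thesis .
qed

text \<open>On the face with vertices N and \<open>d + 1\<close> the factor x_J survives only for J
  empty or J = {d+1}.\<close>

lemma T2_orth:
  assumes i: "i \<in> N" and J: "J \<subseteq> B" "card J \<le> n" and q: "q \<in> Hp (N \<union> J) (eJ J) (n - card J)"
    and G: "G \<in> hp V {m}" "m < n"
  shows "T2 i (\<lambda>x. (\<Prod>i\<in>J. x i) * q x) G = 0"
proof -
  let ?u = "d + 1" and ?C = "N \<union> {d+1}" and ?F = "\<lambda>x. (\<Prod>i\<in>J. x i) * q x"
  let ?K = "\<lambda>x. Dd (d+1) i G (res (N \<union> {d+1}) x)"
  have CV: "?C \<subseteq> V" using NM by auto
  have C: "finite ?C" "\<forall>i\<in>?C. e0 i > -1" using NM e0 by auto
  have fJ: "finite J" using finite_subset[OF J(1) B_props(1)] .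
  have iu: "i \<noteq> ?u" and iC: "i \<in> ?C" using i NM by auto
  have "Dd ?u i G \<in> hp V {a. a + 1 = m}" by (rule hp_Dd[OF G(1)]) auto
  then have K: "?K \<in> hp ?C {a. a + 1 = m}" by (rule hp_res) (use C in auto)
  have pK: "pol ?K" by (rule hp_imp_pol[OF K])
  have xi: "(\<lambda>x. x i) \<in> hp ?C {1}" using C iC by (intro hp_var) auto
  have T: "T2 i ?F G = Lag ?C e0 (\<lambda>x. x i * (Dd ?u i ?F x * ?K x))"
    unfolding T2_def by (rule Lag_cong) (simp add: res_res)
  have pq: "pol q" by (rule hp_imp_pol[OF Hp_hp[OF q]])
  consider "J = {}" | "J = {?u}" | "\<not> J \<subseteq> {?u}" by blast
  then show ?thesis
  proof cases
    case 1
    have qN: "q \<in> Hp N (eJ {}) n" using q 1 by simp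
    \<comment> \<open>q is free of x_{d+1}, only \<open>pd i\<close> acts, and its exponential term
      gives a multiplier of degree m. For J empty the bound is n, so this is still low
      enough.\<close>
    have "pd ?u q = (\<lambda>x. 0)" by (rule pd_hp_indep[OF Hp_hp[OF qN]]) (use NM in auto)
    then have D: "Dd ?u i ?F = pd i q" using 1 by (simp add: Dd_def)
    let ?P = "\<lambda>x. x i * (q x * ?K x)"
    have ibp: "Lag ?C e0 (pd i ?P) = Lag ?C e0 (\<lambda>x. (x i - e0 i) * (q x * ?K x))"
      by (rule Lag_ibp[OF C iC]) (intro pol_mult pq pK)
    let ?Q = "\<lambda>x. (x i * ?K x - e0 i * ?K x) - pd i (\<lambda>x. x i * ?K x) x"
    have pd: "pd i ?P = (\<lambda>x. x i * (pd i q x * ?K x) + q x * pd i (\<lambda>x. x i * ?K x) x)"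
      using pq pK by (simp add: pd_mult pd_var pol_simps algebra_simps)
    have "T2 i ?F G = Lag ?C e0 (\<lambda>x. pd i ?P x - q x * pd i (\<lambda>x. x i * ?K x) x)"
      unfolding T D pd by simp
    also have "\<dots> = Lag ?C e0 (pd i ?P) - Lag ?C e0 (\<lambda>x. q x * pd i (\<lambda>x. x i * ?K x) x)"
      by (rule Lag_diff[OF C]) (use pq pK in \<open>auto intro!: pol_pd pol_mult pol_var\<close>)
    also have "\<dots> = Lag ?C e0 (\<lambda>x. (x i - e0 i) * (q x * ?K x) - q x * pd i (\<lambda>x. x i * ?K x) x)"
      unfolding ibp
      by (rule Lag_diff[OF C, symmetric]) (use pq pK in \<open>auto intro!: pol_pd pol_mult pol_var pol_diff pol_const\<close>)
    also have "(\<lambda>x. (x i - e0 i) * (q x * ?K x) - q x * pd i (\<lambda>x. x i * ?K x) x) = (\<lambda>x. ?Q x * ((\<Prod>i\<in>{}. x i) * q x))"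
      by (auto simp: algebra_simps)
    also have "Lag ?C e0 \<dots> = 0"
    proof (rule Lag_face_orth[OF CV _ _ _ _ C(2)])
      show "q \<in> Hp (N \<union> {}) (eJ {}) n" using qN by simp
      have xK: "(\<lambda>x. x i * ?K x) \<in> hp ?C {m}" by (rule hp_mult[OF xi K]) auto
      have "(\<lambda>x. x i * ?K x) \<in> hp ?C {..<n}" by (rule hp_mono[OF xK]) (use G in auto)
      moreover have "(\<lambda>x. e0 i * ?K x) \<in> hp ?C {..<n}" by (rule hp_scale[OF hp_mono[OF K]]) (use G in auto)
      moreover have "pd i (\<lambda>x. x i * ?K x) \<in> hp ?C {..<n}" by (rule hp_pd[OF xK C(1)]) (use G in auto)
      ultimately show "?Q \<in> hp ?C {..<n}" by (intro hp_diff)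
    qed auto
    finally show ?thesis .
  next
    case 2
    \<comment> \<open>Now the bound is \<open>n - 1\<close>; it is met because the exponentials
      cancel in \<open>T2_apex\<close> and the multiplier has degree \<open>m - 1\<close>.\<close>
    have F: "?F = (\<lambda>x. x ?u * q x)" using 2 by simp
    let ?Q = "\<lambda>x. - \<gamma> i * ?K x - Dd (d+1) i (\<lambda>x. x i * ?K x) x"
    have "T2 i ?F G = Lag ?C e0 (\<lambda>x. ?Q x * (x ?u * q x))"
      unfolding T unfolding F by (rule T2_apex[OF i pq pK])
    also have "\<dots> = Lag ?C e0 (\<lambda>x. ?Q x * ((\<Prod>i\<in>J. x i) * q x))" using 2 by simp
    also have "\<dots> = 0"
    proof (rule Lag_face_orth[OF CV _ J(1) q _ C(2)])
      show "N \<union> J \<subseteq> ?C" using 2 by auto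
      have xK: "(\<lambda>x. x i * ?K x) \<in> hp ?C {m}" by (rule hp_mult[OF xi K]) auto
      have "(\<lambda>x. - \<gamma> i * ?K x) \<in> hp ?C {..<n - card J}"
        by (rule hp_scale[OF hp_mono[OF K]]) (use G 2 in auto)
      moreover have "Dd (d+1) i (\<lambda>x. x i * ?K x) \<in> hp ?C {..<n - card J}"
        by (rule hp_Dd[OF xK C(1)]) (use G 2 in auto)
      ultimately show "?Q \<in> hp ?C {..<n - card J}" by (rule hp_diff)
    qed auto
    finally show ?thesis .
  next
    case 3
    then obtain j where j: "j \<in> J" "j \<noteq> ?u" by blast
    then have "j \<notin> ?C" using J B_props by auto
    then have z: "(\<lambda>x. ?F (res ?C x)) = (\<lambda>x. 0)" using prod_res_zero[OF fJ j(1)] by simp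
    have "(\<lambda>x. Dd ?u i ?F (res ?C x)) = Dd ?u i (\<lambda>x. ?F (res ?C x))"
      by (rule Dd_res[symmetric]) (use iC in auto)
    also have "\<dots> = (\<lambda>x. 0)" unfolding z by (rule Dd_const)
    finally have "Dd ?u i ?F (res ?C x) = 0" for x by metis
    then have "T2 i ?F G = Lag ?C e0 (\<lambda>x. 0)" unfolding T by (intro Lag_cong) simp
    then show ?thesis by (simp add: Lag_zero)
  qed
qed

lemma T3_orth:
  assumes J: "J \<subseteq> B" "card J \<le> n" and q: "q \<in> Hp (N \<union> J) (eJ J) (n - card J)"
    and G: "G \<in> hp V {m}" "m < n"
  shows "T3 (\<lambda>x. (\<Prod>i\<in>J. x i) * q x) G = 0"
proof -
  have fJ: "finite J" using finite_subset[OF J(1) B_props(1)] .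
  let ?K = "\<lambda>x. G (res N x)"
  have K: "?K \<in> hp N {..<n}" by (rule hp_mono[OF hp_res[OF G(1)]]) (use NM G in auto)
  have T: "T3 (\<lambda>x. (\<Prod>i\<in>J. x i) * q x) G = Lag N e0 (\<lambda>x. ?K x * ((\<Prod>i\<in>J. x i) * q x))"
    unfolding T3_def by (rule Lag_cong) (simp add: res_res mult_ac)
  show ?thesis
  proof (cases "J = {}")
    case True
    show ?thesis unfolding T
      by (rule Lag_face_orth[OF _ _ J(1) q]) (use True NM K e0 in auto)
  next
    case False
    then obtain j where j: "j \<in> J" "j \<notin> N" using J B_props by blast
    have "T3 (\<lambda>x. (\<Prod>i\<in>J. x i) * q x) G = Lag N e0 (\<lambda>x. 0)"
      unfolding T by (rule Lag_cong) (simp add: prod_res_zero[OF fJ j])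
    then show ?thesis by (simp add: Lag_zero)
  qed
qed

end

section \<open>The spaces of orthogonal polynomials\<close>

lemma xx_imageI: "W \<in> A \<Longrightarrow> f = (\<lambda>x. W (xx d x)) \<Longrightarrow> f \<in> (\<lambda>P x. P (xx d x)) ` A"
  by auto

lemma xx_imageE: "f \<in> (\<lambda>P x. P (xx d x)) ` A \<Longrightarrow> \<exists>W. W \<in> A \<and> f = (\<lambda>x. W (xx d x))"
  by auto

lemma hp_xx_deg: "P \<in> hp {1..d+1} {m} \<Longrightarrow> (\<lambda>x. P (xx d x)) \<in> hp {1..d} {..m}"
  unfolding polys_deg_eq_hp[symmetric] polys_deg_iff by (rule bexI[of _ P]) auto

context jacobi
begin

text \<open>The space U in homogeneous barycentric coordinates. For k = d + 1 and n at least 2 the summands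
  with card J at most 1, absent from the paper, are {0}.\<close>

definition U_hom :: "nat \<Rightarrow> fn set" where
  "U_hom n = {F. \<exists>q. (\<forall>J\<in>Pow B. q J \<in> H_hom J n) \<and> F = (\<lambda>x. \<Sum>J\<in>Pow B. (\<Prod>i\<in>J. x i) * q J x)}"

lemma NJ_fin: "J \<subseteq> B \<Longrightarrow> finite (N \<union> J)" "J \<subseteq> B \<Longrightarrow> N \<union> J \<subseteq> V" "J \<subseteq> B \<Longrightarrow> finite J"
  using B_props NM(1) finite_subset[of J B] by auto

lemma eJ_pos: "J \<subseteq> B \<Longrightarrow> \<forall>i\<in>N \<union> J. eJ J i > -1"
  using eJ_gt[of J] NJ_fin(2)[of J] by blast

lemma H_hom_zero: "(\<lambda>x. 0) \<in> H_hom J n"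
  by (simp add: H_hom_def Hp_zero)

lemma H_hom_add: "J \<subseteq> B \<Longrightarrow> f \<in> H_hom J n \<Longrightarrow> g \<in> H_hom J n \<Longrightarrow> (\<lambda>x. f x + g x) \<in> H_hom J n"
  using Hp_add[OF NJ_fin(1) eJ_pos, of J f "n - card J" g] by (auto simp: H_hom_def split: if_splits)

lemma H_hom_scale: "f \<in> H_hom J n \<Longrightarrow> (\<lambda>x. c * f x) \<in> H_hom J n"
  by (auto simp: H_hom_def Hp_scale split: if_splits)

lemma H_hom_hp: "q \<in> H_hom J n \<Longrightarrow> q \<in> hp (N \<union> J) {a. a + card J = n}"
  by (auto simp: H_hom_def hp.zero split: if_splits intro: hp_mono[OF Hp_hp])

lemma xJ_hp:
  assumes "J \<subseteq> B" "q \<in> hp (N \<union> J) {a. a + card J = n}"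
  shows "(\<lambda>x. (\<Prod>i\<in>J. x i) * q x) \<in> hp V {n}"
  by (rule hp_mult[OF hp_prod_vars hp_superset[OF assms(2)]]) (use assms(1) B_props NJ_fin in auto)

lemma U_hom_hp:
  assumes "F \<in> U_hom n"
  shows "F \<in> hp V {n}"
proof -
  obtain q where q: "\<forall>J\<in>Pow B. q J \<in> H_hom J n" "F = (\<lambda>x. \<Sum>J\<in>Pow B. (\<Prod>i\<in>J. x i) * q J x)"
    using assms unfolding U_hom_def by blast
  show ?thesis unfolding q(2) by (intro hp_sum xJ_hp H_hom_hp) (use q(1) in auto)
qed

lemma U_hom_zero: "(\<lambda>x. 0) \<in> U_hom n"
  unfolding U_hom_def by (intro CollectI exI[of _ "\<lambda>J x. 0"]) (simp add: H_hom_zero)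

lemma U_hom_add:
  assumes "F \<in> U_hom n" "G \<in> U_hom n"
  shows "(\<lambda>x. F x + G x) \<in> U_hom n"
proof -
  obtain q q' where "\<forall>J\<in>Pow B. q J \<in> H_hom J n" "F = (\<lambda>x. \<Sum>J\<in>Pow B. (\<Prod>i\<in>J. x i) * q J x)"
    "\<forall>J\<in>Pow B. q' J \<in> H_hom J n" "G = (\<lambda>x. \<Sum>J\<in>Pow B. (\<Prod>i\<in>J. x i) * q' J x)"
    using assms unfolding U_hom_def by blast
  then show ?thesis unfolding U_hom_def
    by (intro CollectI exI[of _ "\<lambda>J x. q J x + q' J x"]) (auto simp: H_hom_add distrib_left sum.distrib)
qed

lemma U_hom_scale:
  assumes "F \<in> U_hom n"
  shows "(\<lambda>x. c * F x) \<in> U_hom n"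
proof -
  obtain q where "\<forall>J\<in>Pow B. q J \<in> H_hom J n" "F = (\<lambda>x. \<Sum>J\<in>Pow B. (\<Prod>i\<in>J. x i) * q J x)"
    using assms unfolding U_hom_def by blast
  then show ?thesis unfolding U_hom_def
    by (intro CollectI exI[of _ "\<lambda>J x. c * q J x"]) (auto simp: H_hom_scale sum_distrib_left mult.left_commute)
qed

lemma U_hom_single:
  assumes J: "J \<subseteq> B" and q: "q \<in> H_hom J n"
  shows "(\<lambda>x. (\<Prod>i\<in>J. x i) * q x) \<in> U_hom n"
proof -
  let ?q = "\<lambda>K. if K = J then q else (\<lambda>x. 0)"
  have "(\<Sum>K\<in>Pow B. (\<Prod>i\<in>K. x i) * ?q K x) = (\<Prod>i\<in>J. x i) * q x" for x
  proof -
    have "(\<Sum>K\<in>Pow B. (\<Prod>i\<in>K. x i) * ?q K x) = (\<Sum>K\<in>Pow B. if K = J then (\<Prod>i\<in>J. x i) * q x else 0)"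
      by (rule sum.cong) auto
    then show ?thesis using J B_props(1) by simp
  qed
  then show ?thesis unfolding U_hom_def
    by (intro CollectI exI[of _ ?q]) (use q H_hom_zero in auto)
qed

definition U_plus_lower :: "nat \<Rightarrow> fn set" where
  "U_plus_lower m = {f. \<exists>W\<in>U_hom (Suc m). \<exists>r\<in>hp {1..d} {..m}. f = (\<lambda>x. W (xx d x) + r x)}"

lemma U_plus_lowerI: "W \<in> U_hom (Suc m) \<Longrightarrow> r \<in> hp {1..d} {..m} \<Longrightarrow> (\<lambda>x. W (xx d x) + r x) \<in> U_plus_lower m"
  unfolding U_plus_lower_def by blast

lemma U_plus_lower_zero: "(\<lambda>x. 0) \<in> U_plus_lower m"
  using U_plus_lowerI[OF U_hom_zero hp.zero] by simp

lemma U_plus_lower_add: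
  assumes "f \<in> U_plus_lower m" "g \<in> U_plus_lower m"
  shows "(\<lambda>x. f x + g x) \<in> U_plus_lower m"
proof -
  obtain W r W' r' where "W \<in> U_hom (Suc m)" "r \<in> hp {1..d} {..m}" "f = (\<lambda>x. W (xx d x) + r x)"
    "W' \<in> U_hom (Suc m)" "r' \<in> hp {1..d} {..m}" "g = (\<lambda>x. W' (xx d x) + r' x)"
    using assms unfolding U_plus_lower_def by blast
  then show ?thesis using U_plus_lowerI[OF U_hom_add[of W "Suc m" W'] hp_add[of r "{1..d}" "{..m}" r']]
    by (simp add: add_ac)
qed

lemma U_plus_lower_scale:
  assumes "f \<in> U_plus_lower m"
  shows "(\<lambda>x. c * f x) \<in> U_plus_lower m"
proof -
  obtain W r where "W \<in> U_hom (Suc m)" "r \<in> hp {1..d} {..m}" "f = (\<lambda>x. W (xx d x) + r x)"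
    using assms unfolding U_plus_lower_def by blast
  then show ?thesis using U_plus_lowerI[OF U_hom_scale[of W "Suc m" c] hp_scale[of r "{1..d}" "{..m}" c]]
    by (simp add: distrib_left)
qed

lemma U_plus_lower_sum: "(\<And>s. s \<in> S \<Longrightarrow> f s \<in> U_plus_lower m) \<Longrightarrow> (\<lambda>x. \<Sum>s\<in>S. f s x) \<in> U_plus_lower m"
  by (induction S rule: infinite_finite_induct) (simp_all add: U_plus_lower_zero U_plus_lower_add)

text \<open>The remainder of the Gram-Schmidt step carries the factor
  1 minus the sum of the variables in B - J, which has lower degree or belongs to a larger J.\<close>

lemma face_poly_U_plus_lower:
  assumes "J \<subseteq> B" "P \<in> hp (N \<union> J) {a. a + card J = Suc m}"
  shows "(\<lambda>x. (\<Prod>i\<in>J. xx d x i) * P (xx d x)) \<in> U_plus_lower m"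
  using assms
proof (induction "card (B - J)" arbitrary: J P rule: less_induct)
  case less
  note J = less.prems(1) and P = less.prems(2)
  show ?case
  proof (cases "card J \<le> Suc m")
    case False
    then have "{a. a + card J = Suc m} = {}" by auto
    then have "P = (\<lambda>x. 0)" using P hp_empty_degrees by auto
    then show ?thesis by (simp add: U_plus_lower_zero)
  next
    case True
    define l where "l = Suc m - card J"
    have l: "{a. a + card J = Suc m} = {l}" using True by (auto simp: l_def)
    obtain q R where q: "q \<in> Hp (N \<union> J) (eJ J) l" and R: "R \<in> hp (N \<union> J) {k. Suc k = l}"
      and PqR: "P = (\<lambda>x. q x + (\<Sum>i\<in>N \<union> J. x i) * R x)"
      using Hp_decomp[OF NJ_fin(1)[OF J] eJ_pos[OF J] P[unfolded l]] by blast
    have qH: "q \<in> H_hom J (Suc m)" using q True by (simp add: H_hom_def l_def)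
    have R': "R \<in> hp (N \<union> J) {a. a + card J = m}" by (rule hp_mono[OF R]) (use True in \<open>auto simp: l_def\<close>)
    have sum: "(\<Sum>i\<in>N \<union> J. xx d x i) = 1 - (\<Sum>i\<in>B - J. xx d x i)" for x
    proof -
      have "V = (N \<union> J) \<union> (B - J)" "(N \<union> J) \<inter> (B - J) = {}" using J B_props by auto
      then have "(\<Sum>i\<in>V. xx d x i) = (\<Sum>i\<in>N \<union> J. xx d x i) + (\<Sum>i\<in>B - J. xx d x i)"
        using NJ_fin(1)[OF J] B_props(1) by (simp add: sum.union_disjoint)
      then show ?thesis using sum_xx[of d x] by simp
    qed
    have 1: "(\<lambda>x. (\<Prod>i\<in>J. xx d x i) * q (xx d x)) \<in> U_plus_lower m"
      using U_plus_lowerI[OF U_hom_single[OF J qH] hp.zero] by simp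
    have "(\<lambda>x. (\<Prod>i\<in>J. xx d x i) * R (xx d x)) \<in> hp {1..d} {..m}"
      by (rule hp_xx_deg[OF xJ_hp[OF J R']])
    from U_plus_lowerI[OF U_hom_zero this] have 2: "(\<lambda>x. (\<Prod>i\<in>J. xx d x i) * R (xx d x)) \<in> U_plus_lower m" by simp
    \<comment> \<open>R has one degree less than P, and J gains one element: the total
      \<open>Suc m\<close> is restored and the induction hypothesis for the larger set
      applies.\<close>
    have 3: "(\<lambda>x. (\<Prod>j\<in>insert i J. xx d x j) * R (xx d x)) \<in> U_plus_lower m" if i: "i \<in> B - J" for i
    proof (rule less.hyps)
      show "card (B - insert i J) < card (B - J)"
        by (rule psubset_card_mono) (use i B_props(1) in auto)
      show "insert i J \<subseteq> B" using i J by auto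
      have c: "card (insert i J) = Suc (card J)" using i NJ_fin(3)[OF J] by simp
      show "R \<in> hp (N \<union> insert i J) {a. a + card (insert i J) = Suc m}"
        unfolding c by (rule hp_superset[OF hp_mono[OF R']]) (use NJ_fin(1)[OF J] in auto)
    qed
    have eq: "(\<lambda>x. (\<Prod>i\<in>J. xx d x i) * P (xx d x)) =
      (\<lambda>x. ((\<Prod>i\<in>J. xx d x i) * q (xx d x) + (\<Prod>i\<in>J. xx d x i) * R (xx d x)) +
        (-1) * (\<Sum>i\<in>B - J. (\<Prod>j\<in>insert i J. xx d x j) * R (xx d x)))"
    proof
      fix x
      have "(\<Sum>i\<in>B - J. (\<Prod>j\<in>insert i J. xx d x j) * R (xx d x)) =
        (\<Sum>i\<in>B - J. xx d x i * ((\<Prod>j\<in>J. xx d x j) * R (xx d x)))"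
        by (rule sum.cong) (use NJ_fin(3)[OF J] in auto)
      also have "\<dots> = (\<Sum>i\<in>B - J. xx d x i) * ((\<Prod>j\<in>J. xx d x j) * R (xx d x))"
        by (rule sum_distrib_right[symmetric])
      finally have s: "(\<Sum>i\<in>B - J. (\<Prod>j\<in>insert i J. xx d x j) * R (xx d x)) = \<dots>" .
      show "(\<Prod>i\<in>J. xx d x i) * P (xx d x) =
        ((\<Prod>i\<in>J. xx d x i) * q (xx d x) + (\<Prod>i\<in>J. xx d x i) * R (xx d x)) +
        (-1) * (\<Sum>i\<in>B - J. (\<Prod>j\<in>insert i J. xx d x j) * R (xx d x))"
        unfolding s PqR sum by (simp add: algebra_simps)
    qed
    show ?thesis unfolding eq by (rule U_plus_lower_add[OF U_plus_lower_add[OF 1 2] U_plus_lower_scale[OF U_plus_lower_sum]]) (rule 3)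
  qed
qed

lemma hp_U_plus_lower:
  assumes "F \<in> hp V {Suc m}"
  shows "(\<lambda>x. F (xx d x)) \<in> U_plus_lower m"
  using assms
proof induction
  case zero
  then show ?case by (rule U_plus_lower_zero)
next
  case (step f a c)
  \<comment> \<open>J is the set of variables of B that occur in the monomial, so that x_J divides
    it and the quotient has variables in \<open>N \<union> J\<close> only.\<close>
  define J where "J = {i\<in>B. a i > 0}"
  have J: "J \<subseteq> B" by (auto simp: J_def)
  note fJ = NJ_fin[OF J]
  define a' where "a' = (\<lambda>i. if i \<in> J then a i - 1 else a i)"
  have V: "V - (N \<union> J) \<subseteq> {i. a i = 0}" using B_props(4) by (auto simp: J_def)
  have "mon V a x = (\<Prod>i\<in>J. x i) * mon (N \<union> J) a' x" for x
  proof -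
    have "mon V a x = mon (N \<union> J) a x"
      unfolding mon_def by (rule prod.mono_neutral_right) (use V fJ in auto)
    also have "\<dots> = (\<Prod>i\<in>N \<union> J. (if i \<in> J then x i else 1) * x i ^ a' i)"
      unfolding mon_def by (rule prod.cong) (auto simp: a'_def J_def power_eq_if)
    also have "\<dots> = (\<Prod>i\<in>J. x i) * mon (N \<union> J) a' x"
      using fJ by (simp add: prod.distrib mon_def prod.If_cases Int_absorb1)
    finally show ?thesis .
  qed
  moreover have "sum a' (N \<union> J) + card J = Suc m"
  proof -
    have "sum a V = sum a (N \<union> J)"
      by (rule sum.mono_neutral_right) (use V fJ in auto)
    also have "\<dots> = (\<Sum>i\<in>N \<union> J. a' i + (if i \<in> J then 1 else 0))"
      by (rule sum.cong) (auto simp: a'_def J_def)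
    also have "\<dots> = sum a' (N \<union> J) + card J"
      using fJ by (simp add: sum.distrib sum.If_cases Int_absorb1)
    finally show ?thesis using step(2) by simp
  qed
  then have "mon (N \<union> J) a' \<in> hp (N \<union> J) {a. a + card J = Suc m}"
    using hp_monomial[of a' "N \<union> J" "{a. a + card J = Suc m}" 1] by simp
  from face_poly_U_plus_lower[OF J this] have "(\<lambda>x. (\<Prod>i\<in>J. xx d x i) * mon (N \<union> J) a' (xx d x)) \<in> U_plus_lower m" .
  ultimately show ?case using U_plus_lower_add[OF step(3) U_plus_lower_scale[of _ m c]] by simp
qed

section \<open>Comparison of the homogeneous description with \<open>Usp\<close>\<close>

lemma H_hom_trivial:
  assumes "J \<subseteq> B" "card (N \<union> J) \<le> 1" "card J < n"
  shows "H_hom J n = {\<lambda>x. 0}"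
  using Hp_trivial[OF NJ_fin(1)[OF assms(1)] assms(2) _ eJ_pos[OF assms(1)], of "n - card J"] assms(3)
  by (simp add: H_hom_def)

text \<open>When the face has at most one vertex, \<open>Hsp\<close> is zero by convention.
  \<open>H_hom\<close> is then zero too, except in degree \<open>n = card J\<close>, where it would
  contain the constants; condition c excludes this.\<close>

lemma Hsp_H_hom:
  assumes J: "J \<subseteq> B" and c: "card (B - J) < d \<or> card J < n"
  shows "Hsp d (B - J) (eJ J) (int n - int (card J)) = (\<lambda>P x. P (xx d x)) ` H_hom J n"
proof (cases "n < card J")
  case True
  then show ?thesis by (simp add: Hsp_def H_hom_def)
next
  case n: False
  have VJ: "V - (B - J) = N \<union> J" using B_props J by auto
  show ?thesis
  proof (cases "card (B - J) < d")
    case True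
    have i: "int n - int (card J) = int (n - card J)" using n by simp
    have "Hsp d (B - J) (eJ J) (int (n - card J)) = (\<lambda>P x. P (xx d x)) ` Hp (V - (B - J)) (eJ J) (n - card J)"
      by (rule Hsp_eq[OF _ True]) (use B_props eJ_gt[OF J] in auto)
    then show ?thesis unfolding i VJ using n by (simp add: H_hom_def)
  next
    case False
    then have cJ: "card J < n" using c by simp
    have "card V = card (N \<union> J) + card (B - J)"
    proof -
      have "V = (N \<union> J) \<union> (B - J)" "(N \<union> J) \<inter> (B - J) = {}" using J B_props by auto
      then show ?thesis using card_Un_disjoint[of "N \<union> J" "B - J"] NJ_fin(1)[OF J] B_props(1) by simp
    qed
    then have "card (N \<union> J) \<le> 1" using False by simp
    then have "H_hom J n = {\<lambda>x. 0}" by (rule H_hom_trivial[OF J _ cJ])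
    then show ?thesis using False by (simp add: Hsp_def)
  qed
qed

lemma Vsp_H_hom: "Vsp d (eJ B) (int n - int k) = (\<lambda>P x. P (xx d x)) ` H_hom B n"
proof (cases "n < k")
  case True
  then show ?thesis using B_props(5) by (simp add: Vsp_def H_hom_def)
next
  case False
  then have i: "int n - int k = int (n - k)" by simp
  show ?thesis unfolding i
    using Vsp_eq[of d "eJ B" "n - k"] eJ_gt[of B] B_props False by (simp add: H_hom_def)
qed

lemma sum_Pow_B:
  fixes g :: "nat set \<Rightarrow> real"
  shows "(\<Sum>J\<in>Pow B. g J) = g B + (\<Sum>J\<in>{J. J \<subseteq> B \<and> 1 \<le> card J \<and> card J \<le> k - 1}. g J) + g {}"
proof -
  let ?Js = "{J. J \<subseteq> B \<and> 1 \<le> card J \<and> card J \<le> k - 1}"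
  have ne: "B \<noteq> {}" using B_props(5) k1 by auto
  have "Pow B = insert B (insert {} ?Js)"
  proof (intro set_eqI iffI)
    fix J assume J: "J \<in> Pow B"
    then have fJ: "finite J" using B_props(1) finite_subset by auto
    have "card J \<le> k" "card J = k \<Longrightarrow> J = B"
      using J card_mono[OF B_props(1), of J] card_subset_eq[OF B_props(1), of J] B_props(5) by auto
    moreover have "J = {} \<or> card J \<ge> 1" using fJ by (auto simp: Suc_le_eq card_gt_0_iff)
    ultimately show "J \<in> insert B (insert {} ?Js)" using J by fastforce
  qed auto
  moreover have "finite ?Js" using B_props(1) by simp
  moreover have "B \<notin> insert {} ?Js" using ne B_props(5) k1 by auto
  ultimately show ?thesis by (simp add: add_ac)
qed

lemma U_hom_I:
  assumes "\<And>J. J \<subseteq> B \<Longrightarrow> q J \<in> H_hom J n"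
  shows "(\<lambda>x. \<Sum>J\<in>Pow B. (\<Prod>i\<in>J. x i) * q J x) \<in> U_hom n"
  using assms unfolding U_hom_def by auto

lemma Usp_eq_k_le:
  assumes k: "k \<le> d" and n: "n \<ge> 1"
  shows "Usp d k \<gamma> n = (\<lambda>P x. P (xx d x)) ` U_hom n"
proof -
  have "d - k + 2 = d + 2 - k" using k by linarith
  then have Bs: "Bset d k = B" using k1 k by (auto simp: Bset_def B_def M_def)
  let ?Js = "{J. J \<subseteq> B \<and> 1 \<le> card J \<and> card J \<le> k - 1}"
  have c: "card (B - J) \<le> k - card J" if "J \<subseteq> B" for J
    using card_Diff_subset[OF NJ_fin(3)[OF that] that] B_props(5) by simp
  have H: "Hsp d (B - J) (eJ J) (int n - int (card J)) = (\<lambda>P x. P (xx d x)) ` H_hom J n"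
    if "J \<in> insert {} ?Js" for J
  proof (rule Hsp_H_hom)
    show "J \<subseteq> B" using that by auto
    then show "card (B - J) < d \<or> card J < n" using c[of J] that k n by auto
  qed
  have H0: "Hsp d B (eJ {}) (int n) = (\<lambda>P x. P (xx d x)) ` H_hom {} n" using H[of "{}"] by simp
  have U: "Usp d k \<gamma> n = {f. \<exists>v hs h. v \<in> Vsp d (eJ B) (int n - int k)
              \<and> (\<forall>J\<in>?Js. hs J \<in> Hsp d (B - J) (eJ J) (int n - int (card J)))
              \<and> h \<in> Hsp d B (eJ {}) (int n)
              \<and> f = (\<lambda>x. xprod d B x * v x + (\<Sum>J\<in>?Js. xprod d J x * hs J x) + h x)}"
    unfolding Usp_def Let_def Bs eJ_def using k n by simp
  show ?thesis
  proof
    show "Usp d k \<gamma> n \<subseteq> (\<lambda>P x. P (xx d x)) ` U_hom n"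
    proof
      fix f assume "f \<in> Usp d k \<gamma> n"
      then obtain v hs h where v: "v \<in> Vsp d (eJ B) (int n - int k)"
        and hs: "\<forall>J\<in>?Js. hs J \<in> Hsp d (B - J) (eJ J) (int n - int (card J))"
        and h: "h \<in> Hsp d B (eJ {}) (int n)"
        and f: "f = (\<lambda>x. xprod d B x * v x + (\<Sum>J\<in>?Js. xprod d J x * hs J x) + h x)"
        unfolding U mem_Collect_eq by (elim exE conjE) (rule that; assumption)
      obtain qB where qB: "qB \<in> H_hom B n" "v = (\<lambda>x. qB (xx d x))" using xx_imageE[OF v[unfolded Vsp_H_hom]] by auto
      obtain q0 where q0: "q0 \<in> H_hom {} n" "h = (\<lambda>x. q0 (xx d x))" using xx_imageE[OF h[unfolded H0]] by auto
      have "\<forall>J\<in>?Js. \<exists>q. q \<in> H_hom J n \<and> hs J = (\<lambda>x. q (xx d x))"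
      proof
        fix J assume J: "J \<in> ?Js"
        then have "hs J \<in> (\<lambda>P x. P (xx d x)) ` H_hom J n" using bspec[OF hs J] H[OF insertI2[OF J]] by simp
        then show "\<exists>q. q \<in> H_hom J n \<and> hs J = (\<lambda>x. q (xx d x))" by (rule xx_imageE)
      qed
      then obtain qs where qs: "\<And>J. J \<in> ?Js \<Longrightarrow> qs J \<in> H_hom J n \<and> hs J = (\<lambda>x. qs J (xx d x))"
        by metis
      define q where "q = (\<lambda>J. if J \<in> ?Js then qs J else if J = B then qB else if J = {} then q0 else (\<lambda>x. 0))"
      have BJs: "B \<notin> ?Js" "{} \<notin> ?Js" "B \<noteq> {}" using B_props(5) k1 by auto
      have "q J \<in> H_hom J n" for J using qs qB q0 H_hom_zero by (auto simp: q_def)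
      then have "(\<lambda>x. \<Sum>J\<in>Pow B. (\<Prod>i\<in>J. x i) * q J x) \<in> U_hom n" by (intro U_hom_I)
      moreover have "f = (\<lambda>x. \<Sum>J\<in>Pow B. (\<Prod>i\<in>J. xx d x i) * q J (xx d x))"
      proof
        fix x
        have s: "(\<Sum>J\<in>?Js. xprod d J x * hs J x) = (\<Sum>J\<in>?Js. (\<Prod>i\<in>J. xx d x i) * q J (xx d x))"
        proof (rule sum.cong[OF refl])
          fix J assume J: "J \<in> ?Js"
          have "q J = qs J" using J by (simp only: q_def if_True)
          then show "xprod d J x * hs J x = (\<Prod>i\<in>J. xx d x i) * q J (xx d x)"
            using qs[OF J] by (simp add: xprod_def)
        qed
        have "q B = qB" "q {} = q0" using BJs by (simp_all only: q_def if_False if_True not_sym refl) auto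
        then show "f x = (\<Sum>J\<in>Pow B. (\<Prod>i\<in>J. xx d x i) * q J (xx d x))"
          unfolding sum_Pow_B f s using qB q0 by (simp add: xprod_def)
      qed
      ultimately show "f \<in> (\<lambda>P x. P (xx d x)) ` U_hom n" by (rule xx_imageI)
    qed
    show "(\<lambda>P x. P (xx d x)) ` U_hom n \<subseteq> Usp d k \<gamma> n"
    proof
      fix f assume "f \<in> (\<lambda>P x. P (xx d x)) ` U_hom n"
      then obtain W where W: "W \<in> U_hom n" "f = (\<lambda>x. W (xx d x))" using xx_imageE by metis
      then obtain q where q: "\<forall>J\<in>Pow B. q J \<in> H_hom J n" and Wq: "W = (\<lambda>x. \<Sum>J\<in>Pow B. (\<Prod>i\<in>J. x i) * q J x)"
        unfolding U_hom_def by auto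
      have f': "f = (\<lambda>x. xprod d B x * q B (xx d x) + (\<Sum>J\<in>?Js. xprod d J x * q J (xx d x)) + q {} (xx d x))"
        unfolding W(2) Wq sum_Pow_B by (simp add: xprod_def)
      have qJ: "(\<lambda>x. q J (xx d x)) \<in> (\<lambda>P x. P (xx d x)) ` H_hom J n" if "J \<subseteq> B" for J
        by (rule xx_imageI[OF _ refl]) (use q that in auto)
      have "(\<lambda>x. q B (xx d x)) \<in> Vsp d (eJ B) (int n - int k)" unfolding Vsp_H_hom by (rule qJ) simp
      moreover have "(\<lambda>x. q {} (xx d x)) \<in> Hsp d B (eJ {}) (int n)" unfolding H0 by (rule qJ) simp
      moreover have "\<forall>J\<in>?Js. (\<lambda>x. q J (xx d x)) \<in> Hsp d (B - J) (eJ J) (int n - int (card J))"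
      proof
        fix J assume J: "J \<in> ?Js"
        show "(\<lambda>x. q J (xx d x)) \<in> Hsp d (B - J) (eJ J) (int n - int (card J))"
          unfolding H[OF insertI2[OF J]] by (rule qJ) (use J in simp)
      qed
      ultimately show "f \<in> Usp d k \<gamma> n"
        unfolding U using f' by (intro CollectI exI[of _ "\<lambda>x. q B (xx d x)"] exI[of _ "\<lambda>J x. q J (xx d x)"]
            exI[of _ "\<lambda>x. q {} (xx d x)"] conjI)
    qed
  qed
qed

end

lemma hp0_const:
  assumes "finite C" "f \<in> hp C D" "D \<subseteq> {0}"
  shows "\<exists>c. f = (\<lambda>x. c)"
  using assms(2)
proof induction
  case zero
  then show ?case by auto
next
  case (step f a c)
  then have "\<forall>i\<in>C. a i = 0" using assms(1,3) by (auto simp: sum_eq_0_iff)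
  then have "mon C a = (\<lambda>x. 1)" by (auto simp: mon_def)
  then show ?case using step(3) by auto
qed

context jacobi
begin

text \<open>For \<open>n >= 2\<close> the sets J with at most one element contribute nothing,
  because their faces have at most one vertex and the degree is positive. For \<open>n = 1\<close>
  singletons would contribute every x_i, whence the separate treatment of degree 1.\<close>

lemma Usp_eq_top:
  assumes k: "k = d + 1" and n: "n \<ge> 2"
  shows "Usp d k \<gamma> n = (\<lambda>P x. P (xx d x)) ` U_hom n"
proof -
  have N: "N = {}" unfolding N_def using k by simp
  have BV: "{1..d+1} = B" using B_props(4) N by simp
  let ?Js = "{J. J \<subseteq> B \<and> 2 \<le> card J \<and> card J \<le> d}"
  have sub: "J \<subseteq> B" if "J \<in> ?Js" for J using that by simp
  have triv: "q = (\<lambda>x. 0)" if "J \<subseteq> B" "card J \<le> 1" "q \<in> H_hom J n" for q J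
    using H_hom_trivial[of J n] that N n by auto
  have H: "Hsp d (B - J) (eJ J) (int n - int (card J)) = (\<lambda>P x. P (xx d x)) ` H_hom J n"
    if "J \<in> ?Js" for J
  proof (rule Hsp_H_hom[OF sub[OF that]])
    show "card (B - J) < d \<or> card J < n"
      using card_Diff_subset[OF NJ_fin(3)[OF sub[OF that]] sub[OF that]] B_props(5) that k by auto
  qed
  have split: "(\<Sum>J\<in>Pow B. g J) = g B + (\<Sum>J\<in>?Js. g J)"
    if "\<And>J. J \<subseteq> B \<Longrightarrow> card J \<le> 1 \<Longrightarrow> g J = 0" for g :: "nat set \<Rightarrow> real"
  proof -
    have "(\<Sum>J\<in>{J. J \<subseteq> B \<and> 1 \<le> card J \<and> card J \<le> k - 1}. g J) = (\<Sum>J\<in>?Js. g J)"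
    proof (rule sum.mono_neutral_right)
      show "finite {J. J \<subseteq> B \<and> 1 \<le> card J \<and> card J \<le> k - 1}" using B_props(1) by simp
      show "?Js \<subseteq> {J. J \<subseteq> B \<and> 1 \<le> card J \<and> card J \<le> k - 1}" using k by auto
      show "\<forall>J\<in>{J. J \<subseteq> B \<and> 1 \<le> card J \<and> card J \<le> k - 1} - ?Js. g J = 0"
      proof
        fix J assume J: "J \<in> {J. J \<subseteq> B \<and> 1 \<le> card J \<and> card J \<le> k - 1} - ?Js"
        then have "J \<subseteq> B" "card J \<le> d" "\<not> (2 \<le> card J \<and> card J \<le> d)" unfolding k by auto
        then show "g J = 0" by (intro that) linarith+
      qed
    qed
    moreover have "g {} = 0" by (rule that) auto
    ultimately show ?thesis unfolding sum_Pow_B by simp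
  qed
  have iv: "int n - int d - 1 = int n - int k" using k by simp
  have U: "Usp d k \<gamma> n = {f. \<exists>v hs. v \<in> Vsp d (eJ B) (int n - int k)
              \<and> (\<forall>J\<in>?Js. hs J \<in> Hsp d (B - J) (eJ J) (int n - int (card J)))
              \<and> f = (\<lambda>x. xprod d B x * v x + (\<Sum>J\<in>?Js. xprod d J x * hs J x))}"
    unfolding Usp_def Let_def BV eJ_def iv using k n by simp
  show ?thesis
  proof
    show "Usp d k \<gamma> n \<subseteq> (\<lambda>P x. P (xx d x)) ` U_hom n"
    proof
      fix f assume "f \<in> Usp d k \<gamma> n"
      then obtain v hs where v: "v \<in> Vsp d (eJ B) (int n - int k)"
        and hs: "\<forall>J\<in>?Js. hs J \<in> Hsp d (B - J) (eJ J) (int n - int (card J))"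
        and f: "f = (\<lambda>x. xprod d B x * v x + (\<Sum>J\<in>?Js. xprod d J x * hs J x))"
        unfolding U mem_Collect_eq by (elim exE conjE) (rule that; assumption)
      obtain qB where qB: "qB \<in> H_hom B n" "v = (\<lambda>x. qB (xx d x))" using xx_imageE[OF v[unfolded Vsp_H_hom]] by auto
      have "\<forall>J\<in>?Js. \<exists>q. q \<in> H_hom J n \<and> hs J = (\<lambda>x. q (xx d x))"
      proof
        fix J assume J: "J \<in> ?Js"
        then have "hs J \<in> (\<lambda>P x. P (xx d x)) ` H_hom J n" using bspec[OF hs J] H[OF J] by simp
        then show "\<exists>q. q \<in> H_hom J n \<and> hs J = (\<lambda>x. q (xx d x))" by (rule xx_imageE)
      qed
      then obtain qs where qs: "\<And>J. J \<in> ?Js \<Longrightarrow> qs J \<in> H_hom J n \<and> hs J = (\<lambda>x. qs J (xx d x))"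
        by metis
      define q where "q = (\<lambda>J. if J \<in> ?Js then qs J else if J = B then qB else (\<lambda>x. 0))"
      have BJs: "B \<notin> ?Js" using B_props(5) k by auto
      have qH: "q J \<in> H_hom J n" for J using qs qB H_hom_zero by (auto simp: q_def)
      then have "(\<lambda>x. \<Sum>J\<in>Pow B. (\<Prod>i\<in>J. x i) * q J x) \<in> U_hom n" by (intro U_hom_I)
      moreover have "f = (\<lambda>x. \<Sum>J\<in>Pow B. (\<Prod>i\<in>J. xx d x i) * q J (xx d x))"
      proof
        fix x
        have s: "(\<Sum>J\<in>?Js. xprod d J x * hs J x) = (\<Sum>J\<in>?Js. (\<Prod>i\<in>J. xx d x i) * q J (xx d x))"
        proof (rule sum.cong[OF refl])
          fix J assume J: "J \<in> ?Js"
          have "q J = qs J" using J by (simp only: q_def if_True)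
          then show "xprod d J x * hs J x = (\<Prod>i\<in>J. xx d x i) * q J (xx d x)"
            using qs[OF J] by (simp add: xprod_def)
        qed
        have "q B = qB" using BJs by (simp only: q_def if_False if_True refl)
        moreover have "(\<Sum>J\<in>Pow B. (\<Prod>i\<in>J. xx d x i) * q J (xx d x)) =
            (\<Prod>i\<in>B. xx d x i) * q B (xx d x) + (\<Sum>J\<in>?Js. (\<Prod>i\<in>J. xx d x i) * q J (xx d x))"
        proof (rule split)
          fix J assume "J \<subseteq> B" "card J \<le> 1"
          then have "q J = (\<lambda>x. 0)" by (rule triv[OF _ _ qH])
          then show "(\<Prod>i\<in>J. xx d x i) * q J (xx d x) = 0" by simp
        qed
        ultimately show "f x = (\<Sum>J\<in>Pow B. (\<Prod>i\<in>J. xx d x i) * q J (xx d x))"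
          unfolding f s using qB by (simp add: xprod_def)
      qed
      ultimately show "f \<in> (\<lambda>P x. P (xx d x)) ` U_hom n" by (rule xx_imageI)
    qed
    show "(\<lambda>P x. P (xx d x)) ` U_hom n \<subseteq> Usp d k \<gamma> n"
    proof
      fix f assume "f \<in> (\<lambda>P x. P (xx d x)) ` U_hom n"
      then obtain W where W: "W \<in> U_hom n" "f = (\<lambda>x. W (xx d x))" using xx_imageE by metis
      then obtain q where q: "\<forall>J\<in>Pow B. q J \<in> H_hom J n" and Wq: "W = (\<lambda>x. \<Sum>J\<in>Pow B. (\<Prod>i\<in>J. x i) * q J x)"
        unfolding U_hom_def by auto
      have f': "f = (\<lambda>x. xprod d B x * q B (xx d x) + (\<Sum>J\<in>?Js. xprod d J x * q J (xx d x)))"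
      proof
        fix x
        have "(\<Sum>J\<in>Pow B. (\<Prod>i\<in>J. xx d x i) * q J (xx d x)) =
            (\<Prod>i\<in>B. xx d x i) * q B (xx d x) + (\<Sum>J\<in>?Js. (\<Prod>i\<in>J. xx d x i) * q J (xx d x))"
        proof (rule split)
          fix J assume J: "J \<subseteq> B" "card J \<le> 1"
          then have "q J = (\<lambda>x. 0)" by (rule triv) (use q J in auto)
          then show "(\<Prod>i\<in>J. xx d x i) * q J (xx d x) = 0" by simp
        qed
        then show "f x = xprod d B x * q B (xx d x) + (\<Sum>J\<in>?Js. xprod d J x * q J (xx d x))"
          unfolding W(2) Wq by (simp add: xprod_def)
      qed
      have qJ: "(\<lambda>x. q J (xx d x)) \<in> (\<lambda>P x. P (xx d x)) ` H_hom J n" if "J \<subseteq> B" for J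
        by (rule xx_imageI[OF _ refl]) (use q that in auto)
      have "(\<lambda>x. q B (xx d x)) \<in> Vsp d (eJ B) (int n - int k)" unfolding Vsp_H_hom by (rule qJ) simp
      moreover have "\<forall>J\<in>?Js. (\<lambda>x. q J (xx d x)) \<in> Hsp d (B - J) (eJ J) (int n - int (card J))"
      proof
        fix J assume J: "J \<in> ?Js"
        show "(\<lambda>x. q J (xx d x)) \<in> Hsp d (B - J) (eJ J) (int n - int (card J))"
          unfolding H[OF J] by (rule qJ) (use J in simp)
      qed
      ultimately show "f \<in> Usp d k \<gamma> n"
        unfolding U using f' by (intro CollectI exI[of _ "\<lambda>x. q B (xx d x)"] exI[of _ "\<lambda>J x. q J (xx d x)"] conjI)
    qed
  qed
qed

section \<open>Orthogonality and completeness of U, degrees 0 and 1, and the case k = 1\<close>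

lemma sob_ip_zero:
  assumes "G \<in> hp V {m}"
  shows "sob_ip d k \<gamma> lam lami lamI lam0 (\<lambda>x. 0) (\<lambda>x. G (xx d x)) = 0"
  using sob_ip_linear[OF hp.zero[of V "{0}"] hp.zero[of V "{0}"] assms, of lam lami lamI lam0 0 0] by simp

lemma xprod_vertex_zero:
  assumes J: "J \<subseteq> V" "card J \<ge> 2" and j: "j \<in> {0..d}"
  shows "(\<Prod>i\<in>J. xx d (ebas j) i) = 0"
proof -
  have fJ: "finite J" using J(1) finite_subset by blast
  \<comment> \<open>The barycentric index of the vertex e_j; the origin e_0 has index
    \<open>d + 1\<close>. It is the only index in \<open>V\<close> whose coordinate is nonzero
    there.\<close>
  define v where "v = (if j = 0 then d + 1 else j)"
  have "\<not> J \<subseteq> {v}" using J(2) card_mono[of "{v}" J] by auto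
  then obtain i where i: "i \<in> J" "i \<noteq> v" by blast
  have "xx d (ebas j) i = 0"
  proof (cases "j = 0")
    case True
    then show ?thesis using i J(1) by (auto simp: xx_ebas v_def)
  next
    case False
    then show ?thesis using i j xx_ebas(1)[of j] by (auto simp: v_def)
  qed
  then show ?thesis using fJ i(1) by (intro prod_zero) auto
qed

text \<open>The excluded case is the one where a summand x_i with a single factor does not vanish at
  the vertices, so that the vertex terms of the form need not vanish.\<close>

lemma U_hom_orth:
  assumes n: "n \<ge> 1" "\<not> (k = d + 1 \<and> n = 1)" and F: "F \<in> U_hom n" and G: "G \<in> hp V {m}" "m < n"
  shows "sob_ip d k \<gamma> lam lami lamI lam0 (\<lambda>x. F (xx d x)) (\<lambda>x. G (xx d x)) = 0"
proof -
  let ?B = "sob_ip d k \<gamma> lam lami lamI lam0"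
  obtain q where q: "\<forall>J\<in>Pow B. q J \<in> H_hom J n" "F = (\<lambda>x. \<Sum>J\<in>Pow B. (\<Prod>i\<in>J. x i) * q J x)"
    using F unfolding U_hom_def by auto
  let ?F = "\<lambda>J x. (\<Prod>i\<in>J. x i) * q J x"
  have Fh: "?F J \<in> hp V {n}" if "J \<subseteq> B" for J
    by (rule xJ_hp[OF that H_hom_hp]) (use q that in auto)
  have single: "?B (\<lambda>x. ?F J (xx d x)) (\<lambda>x. G (xx d x)) = 0" if J: "J \<subseteq> B" for J
  proof (cases "q J = (\<lambda>x. 0)")
    case True
    then show ?thesis using sob_ip_zero[OF G(1)] by simp
  next
    case False
    then have c: "card J \<le> n" and qH: "q J \<in> Hp (N \<union> J) (eJ J) (n - card J)"
      using q(1) J unfolding H_hom_def by (auto split: if_splits)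
    have 1: "T1 I (?F J) G = 0" if "I \<in> Pow M - {{}}" for I
      by (rule T1_orth[OF _ _ J c qH G]) (use that in auto)
    have 2: "T2 i (?F J) G = 0" if "i \<in> N" for i by (rule T2_orth[OF that J c qH G])
    have 3: "T3 (?F J) G = 0" by (rule T3_orth[OF J c qH G])
    \<comment> \<open>The vertex terms vanish because two barycentric coordinates cannot both be
      nonzero at a vertex; for smaller J the polynomial \<open>q J\<close> would be zero.\<close>
    have 4: "?F J (xx d (ebas j)) = 0" if j: "j \<in> {0..d}" and k: "k = d + 1" for j
    proof -
      have N: "N = {}" unfolding N_def using k by simp
      have "card J \<ge> 2"
      proof (rule ccontr)
        assume "\<not> card J \<ge> 2"
        then have "H_hom J n = {\<lambda>x. 0}" using H_hom_trivial[OF J, of n] N n k by simp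
        then show False using q(1) J False by auto
      qed
      then show ?thesis using xprod_vertex_zero[OF _ _ j, of J] J B_props(2) by auto
    qed
    have s4: "(\<Sum>j\<in>{0..d}. lam0 j * ?F J (xx d (ebas j)) * G (xx d (ebas j))) = 0" if k: "k = d + 1"
    proof (rule sum.neutral, rule ballI)
      fix j assume "j \<in> {0..d}"
      show "lam0 j * ?F J (xx d (ebas j)) * G (xx d (ebas j)) = 0"
        unfolding 4[OF \<open>j \<in> {0..d}\<close> k] by simp
    qed
    have s1: "(\<Sum>I\<in>Pow M - {{}}. lI lamI I * a1 n m I * T1 I (?F J) G) = 0"
    proof (rule sum.neutral, rule ballI)
      fix I assume "I \<in> Pow M - {{}}"
      show "lI lamI I * a1 n m I * T1 I (?F J) G = 0" unfolding 1[OF \<open>I \<in> Pow M - {{}}\<close>] by simp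
    qed
    have s2: "(\<Sum>i\<in>N. (if k = 1 then 1 else lami i) * a2 n m * T2 i (?F J) G) = 0"
    proof (rule sum.neutral, rule ballI)
      fix i assume "i \<in> N"
      show "(if k = 1 then 1 else lami i) * a2 n m * T2 i (?F J) G = 0" unfolding 2[OF \<open>i \<in> N\<close>] by simp
    qed
    show ?thesis
    proof (cases "k \<le> d")
      case True
      then show ?thesis unfolding sob_ip_eq[OF Fh[OF J] G(1)] s1 s2 3 by simp
    next
      case False
      then have "k = d + 1" using kd by simp
      then show ?thesis unfolding sob_ip_eq[OF Fh[OF J] G(1)] s1 if_not_P[OF False] using s4 by simp
    qed
  qed
  have "?B (\<lambda>x. \<Sum>J\<in>S. ?F J (xx d x)) (\<lambda>x. G (xx d x)) = 0" if "finite S" "S \<subseteq> Pow B" for S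
    using that
  proof (induction S)
    case empty
    then show ?case using sob_ip_zero[OF G(1)] by simp
  next
    case (insert J S)
    have S: "(\<lambda>x. \<Sum>J\<in>S. ?F J x) \<in> hp V {n}" by (intro hp_sum Fh) (use insert in auto)
    have J: "J \<subseteq> B" using insert by auto
    from sob_ip_linear[OF Fh[OF J] S G(1), of lam lami lamI lam0 1 1] single[OF J] insert
    show ?case by simp
  qed
  from this[of "Pow B"] show ?thesis unfolding q(2) using B_props(1) by simp
qed

text \<open>For completeness p is written as W + r with W in U and r of lower degree. Both p and W
  are orthogonal to lower degrees, hence r is orthogonal to itself and vanishes.\<close>

lemma orth_polys_eq_U_hom:
  assumes n: "n \<ge> 1" "\<not> (k = d + 1 \<and> n = 1)"
    and pos: "\<And>F m. F \<in> hp V {m} \<Longrightarrow>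
      sob_ip d k \<gamma> lam lami lamI lam0 (\<lambda>x. F (xx d x)) (\<lambda>x. F (xx d x)) \<le> 0 \<Longrightarrow> F = (\<lambda>x. 0)"
  shows "(\<lambda>P x. P (xx d x)) ` U_hom n = orth_polys d (sob_ip d k \<gamma> lam lami lamI lam0) n"
proof -
  let ?B = "sob_ip d k \<gamma> lam lami lamI lam0"
  obtain m where m: "n = Suc m" using n(1) by (cases n) auto
  have O: "orth_polys d ?B n = {p \<in> polys_deg d (int n). \<forall>q \<in> polys_deg d (int m). ?B p q = 0}"
    by (simp add: orth_polys_def m)
  have sub: "(\<lambda>x. W (xx d x)) \<in> orth_polys d ?B n" if W: "W \<in> U_hom n" for W
  proof -
    have "(\<lambda>x. W (xx d x)) \<in> polys_deg d (int n)" using U_hom_hp[OF W] polys_deg_iff by blast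
    moreover have "?B (\<lambda>x. W (xx d x)) q = 0" if q: "q \<in> polys_deg d (int m)" for q
    proof -
      obtain G where G: "G \<in> hp V {m}" "q = (\<lambda>x. G (xx d x))" using q polys_deg_iff by blast
      show ?thesis unfolding G(2) by (rule U_hom_orth[OF n W G(1)]) (simp add: m)
    qed
    ultimately show ?thesis unfolding O by blast
  qed
  show ?thesis
  proof
    show "(\<lambda>P x. P (xx d x)) ` U_hom n \<subseteq> orth_polys d ?B n" using sub by auto
    show "orth_polys d ?B n \<subseteq> (\<lambda>P x. P (xx d x)) ` U_hom n"
    proof
      fix p assume p: "p \<in> orth_polys d ?B n"
      then obtain F where F: "F \<in> hp V {n}" "p = (\<lambda>x. F (xx d x))"
        unfolding O using polys_deg_iff by blast
      obtain W r where W: "W \<in> U_hom n" and r: "r \<in> hp {1..d} {..m}" "p = (\<lambda>x. W (xx d x) + r x)"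
        using hp_U_plus_lower[of F m] F m unfolding U_plus_lower_def by auto
      have rm: "r \<in> polys_deg d (int m)" using r(1) by (simp only: polys_deg_eq_hp)
      then obtain R where R: "R \<in> hp V {m}" "r = (\<lambda>x. R (xx d x))" using polys_deg_iff by blast
      have pr: "?B p r = 0" and Wr: "?B (\<lambda>x. W (xx d x)) r = 0"
        using p sub[OF W] rm unfolding O by auto
      have "r = (\<lambda>x. 1 * F (xx d x) + (-1) * W (xx d x))"
        using fun_cong[OF r(2)] fun_cong[OF F(2)] by auto
      then have "?B r r = ?B (\<lambda>x. 1 * F (xx d x) + (-1) * W (xx d x)) (\<lambda>x. R (xx d x))" using R(2) by simp
      also have "\<dots> = 1 * ?B (\<lambda>x. F (xx d x)) (\<lambda>x. R (xx d x)) + (-1) * ?B (\<lambda>x. W (xx d x)) (\<lambda>x. R (xx d x))"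
        by (rule sob_ip_linear[OF F(1) U_hom_hp[OF W] R(1)])
      also have "\<dots> = 0" using pr Wr F(2) R(2) by simp
      finally have "?B r r = 0" .
      then have "R = (\<lambda>x. 0)" using pos[OF R(1)] R(2) by simp
      then have "p = (\<lambda>x. W (xx d x))" using r(2) R(2) by simp
      then show "p \<in> (\<lambda>P x. P (xx d x)) ` U_hom n" by (rule xx_imageI[OF W])
    qed
  qed
qed

lemma orth_polys_0: "orth_polys d (sob_ip d k \<gamma> lam lami lamI lam0) 0 = {f. \<exists>c. f = (\<lambda>x. c)}"
proof -
  let ?B = "sob_ip d k \<gamma> lam lami lamI lam0"
  have "?B p (\<lambda>x. 0) = 0" if p: "p \<in> polys_deg d (int 0)" for p
  proof -
    obtain F where F: "F \<in> hp V {0}" "p = (\<lambda>x. F (xx d x))" using p polys_deg_iff by blast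
    show ?thesis using sob_ip_symmetric[OF F(1) hp.zero] sob_ip_zero[OF F(1)] F(2) by simp
  qed
  then have "orth_polys d ?B 0 = polys_deg d (int 0)"
    by (auto simp: orth_polys_def polys_deg_neg)
  also have "\<dots> = {f. \<exists>c. f = (\<lambda>x. c)}"
    unfolding polys_deg_eq_hp using hp0_const[of "{1..d}" _ "{..0}"] hp_const[of "{..0}" _ "{1..d}"] by auto
  finally show ?thesis .
qed

text \<open>Against constants all derivative terms vanish, and orthogonality means that the weighted
  sum of the vertex values is 0. For an affine polynomial this fixes the constant term, which yields
  the constants \<open>- lam0 j / sum\<close>.\<close>

lemma orth_polys_1_top:
  assumes k: "k = d + 1" and L: "(\<Sum>i\<in>{0..d}. lam0 i) \<noteq> 0"
  shows "orth_polys d (sob_ip d k \<gamma> lam lami lamI lam0) 1 =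
    {f. \<exists>a::nat \<Rightarrow> real. f = (\<lambda>x. \<Sum>j\<in>{1..d}. a j * (x j - lam0 j / (\<Sum>i\<in>{0..d}. lam0 i)))}"
proof -
  let ?B = "sob_ip d k \<gamma> lam lami lamI lam0" and ?L = "\<Sum>i\<in>{0..d}. lam0 i"
  have Bc: "?B (\<lambda>x. F (xx d x)) (\<lambda>x. c) = c * (\<Sum>j\<in>{0..d}. lam0 j * F (xx d (ebas j)))"
    if F: "F \<in> hp V {1}" for F c
  proof -
    have C: "(\<lambda>x. c) \<in> hp V {0}" by (rule hp_const) simp
    have "T1 I F (\<lambda>x. c) = 0" if I: "I \<in> Pow M - {{}}" for I
    proof -
      have "finite I" using I NM(2) finite_subset by auto
      then have "sorted_list_of_set I \<noteq> []" using I by auto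
      moreover have "foldr (Dd (d+1)) L (\<lambda>x. c) = (\<lambda>x. 0)" if "L \<noteq> []" for L
        using that
      proof (induction L)
        case (Cons i L)
        then show ?case by (cases "L = []") (simp_all add: Dd_const)
      qed simp
      ultimately have z: "DI I (\<lambda>x. c) x = 0" for x unfolding DI_def by metis
      show ?thesis unfolding T1_def z by (simp add: Lag_zero)
    qed
    then have "?B (\<lambda>x. F (xx d x)) (\<lambda>x. c) = (\<Sum>j\<in>{0..d}. lam0 j * F (xx d (ebas j)) * c)"
      using sob_ip_eq[OF F C] k by simp
    then show ?thesis by (simp add: sum_distrib_left mult_ac)
  qed
  \<comment> \<open>At e_j the affine polynomial takes the value \<open>b + a j\<close>, and at e_0
    the value b.\<close>
  have e: "(\<Sum>j\<in>{0..d}. lam0 j * (b + (\<Sum>i\<in>{1..d}. a i * ebas j i))) = b * ?L + (\<Sum>j\<in>{1..d}. lam0 j * a j)"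
    for a and b :: real
  proof -
    have "(\<Sum>i\<in>{1..d}. a i * ebas j i) = (if j \<in> {1..d} then a j else 0)" for j
    proof -
      have "(\<Sum>i\<in>{1..d}. a i * ebas j i) = (\<Sum>i\<in>{1..d}. if i = j then a i else 0)"
        by (rule sum.cong) (auto simp: ebas_def)
      then show ?thesis by simp
    qed
    then have "(\<Sum>j\<in>{0..d}. lam0 j * (b + (\<Sum>i\<in>{1..d}. a i * ebas j i))) =
        b * ?L + (\<Sum>j\<in>{0..d}. lam0 j * (if j \<in> {1..d} then a j else 0))"
      by (simp only: distrib_left sum.distrib sum_distrib_left mult.commute[of b])
    also have "(\<Sum>j\<in>{0..d}. lam0 j * (if j \<in> {1..d} then a j else 0)) = (\<Sum>j\<in>{1..d}. lam0 j * a j)"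
      by (rule sum.mono_neutral_cong_right) auto
    finally show ?thesis .
  qed
  have const: "{f. \<exists>c. f = (\<lambda>x. c)} = polys_deg d (int 0)"
    unfolding polys_deg_eq_hp using hp0_const[of "{1..d}" _ "{..0}"] hp_const[of "{..0}" _ "{1..d}"] by auto
  have O: "orth_polys d ?B 1 = {p \<in> polys_deg d (int 1). \<forall>c. ?B p (\<lambda>x. c) = 0}"
  proof -
    have "int 1 - 1 = int 0" by simp
    then have "orth_polys d ?B 1 = {p \<in> polys_deg d (int 1). \<forall>q\<in>{f. \<exists>c. f = (\<lambda>x. c)}. ?B p q = 0}"
      unfolding orth_polys_def const by simp
    then show ?thesis by auto
  qed
  show ?thesis
  proof (intro set_eqI iffI)
    fix f assume "f \<in> orth_polys d ?B 1"
    then have f: "f \<in> polys_deg d (int 1)" "?B f (\<lambda>x. 1) = 0" unfolding O by auto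
    obtain F where F: "F \<in> hp V {1}" "f = (\<lambda>x. F (xx d x))" using f(1) polys_deg_iff by blast
    have "\<exists>c. pd i F = (\<lambda>x. c)" for i
      by (rule hp0_const[of V _ "{0}"], simp, rule hp_pd[OF F(1)]) auto
    then obtain c where c: "\<And>i. pd i F = (\<lambda>x. c i)" by metis
    have Fx: "F y = (\<Sum>i\<in>V. y i * c i)" for y
      using euler_hp[OF _ F(1), of y] by (simp add: c)
    \<comment> \<open>The coefficient of x_{d+1} in the linear form F is the value at e_0, hence the
      constant term of f.\<close>
    let ?b = "c (d+1)"
    have fx: "f x = ?b + (\<Sum>i\<in>{1..d}. (c i - ?b) * x i)" for x
    proof -
      have "(\<Sum>i\<in>{1..d}. xx d x i * c i) = (\<Sum>i\<in>{1..d}. x i * c i)"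
        by (rule sum.cong) (auto simp: xx_def)
      then have "f x = (\<Sum>i\<in>{1..d}. x i * c i) + (1 - (\<Sum>i\<in>{1..d}. x i)) * ?b"
        unfolding F(2) Fx by (simp add: xx_def)
      then show ?thesis by (simp add: algebra_simps sum_subtractf sum_distrib_left)
    qed
    have "(\<Sum>j\<in>{0..d}. lam0 j * f (ebas j)) = 0" using f(2) Bc[OF F(1), of 1] F(2) by simp
    then have "?b * ?L + (\<Sum>j\<in>{1..d}. lam0 j * (c j - ?b)) = 0" unfolding fx e .
    then have b: "?b = - (\<Sum>j\<in>{1..d}. lam0 j * (c j - ?b)) / ?L" using L by (simp add: field_simps)
    have "f = (\<lambda>x. \<Sum>j\<in>{1..d}. (c j - ?b) * (x j - lam0 j / ?L))"
    proof
      fix x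
      have "(\<Sum>j\<in>{1..d}. (c j - ?b) * (x j - lam0 j / ?L)) =
          (\<Sum>j\<in>{1..d}. (c j - ?b) * x j) - (\<Sum>j\<in>{1..d}. (c j - ?b) * (lam0 j / ?L))"
        by (simp only: right_diff_distrib sum_subtractf)
      also have "(\<Sum>j\<in>{1..d}. (c j - ?b) * (lam0 j / ?L)) = (\<Sum>j\<in>{1..d}. lam0 j * (c j - ?b)) / ?L"
        by (simp only: sum_divide_distrib times_divide_eq_right mult.commute)
      also have "(\<Sum>j\<in>{1..d}. (c j - ?b) * x j) - \<dots> = (\<Sum>j\<in>{1..d}. (c j - ?b) * x j) + ?b" using b by simp
      finally show "f x = (\<Sum>j\<in>{1..d}. (c j - ?b) * (x j - lam0 j / ?L))" unfolding fx by simp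
    qed
    then show "f \<in> {f. \<exists>a::nat \<Rightarrow> real. f = (\<lambda>x. \<Sum>j\<in>{1..d}. a j * (x j - lam0 j / ?L))}"
      by (intro CollectI exI[of _ "\<lambda>j. c j - ?b"])
  next
    fix f assume "f \<in> {f. \<exists>a::nat \<Rightarrow> real. f = (\<lambda>x. \<Sum>j\<in>{1..d}. a j * (x j - lam0 j / ?L))}"
    then obtain a where f: "f = (\<lambda>x. \<Sum>j\<in>{1..d}. a j * (x j - lam0 j / ?L))"
      unfolding mem_Collect_eq by (elim exE) (rule that)
    have "f \<in> hp {1..d} {..1}"
      unfolding f by (intro hp_sum hp_scale hp_diff hp_var hp_const) auto
    then have f1: "f \<in> polys_deg d (int 1)" by (simp only: polys_deg_eq_hp)
    then obtain F where F: "F \<in> hp V {1}" "f = (\<lambda>x. F (xx d x))" using polys_deg_iff by blast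
    define b where "b = - (\<Sum>j\<in>{1..d}. lam0 j * a j) / ?L"
    have fx: "f x = b + (\<Sum>i\<in>{1..d}. a i * x i)" for x
    proof -
      have "f x = (\<Sum>j\<in>{1..d}. a j * x j) - (\<Sum>j\<in>{1..d}. a j * (lam0 j / ?L))"
        unfolding f by (simp only: right_diff_distrib sum_subtractf)
      also have "(\<Sum>j\<in>{1..d}. a j * (lam0 j / ?L)) = (\<Sum>j\<in>{1..d}. lam0 j * a j) / ?L"
        by (simp only: sum_divide_distrib times_divide_eq_right mult.commute)
      finally show ?thesis by (simp add: b_def)
    qed
    have "(\<Sum>j\<in>{0..d}. lam0 j * f (ebas j)) = 0"
      unfolding fx e using L by (simp add: b_def)
    then have "?B f (\<lambda>x. c) = 0" for c using Bc[OF F(1), of c] F(2) by simp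
    then show "f \<in> orth_polys d ?B 1" unfolding O using f1 by blast
  qed
qed

text \<open>Both polynomials now have the same degree, so degree counting gives nothing.
  \<open>T2_apex\<close> moves the derivatives to Q, and summed over i they form the operator of
  \<open>Hp_harmonic\<close>, which annihilates Q. The last term of the form vanishes because of the
  factor x_{d+1}.\<close>

lemma k1_orth:
  assumes k: "k = 1" and v: "v \<in> Vsp d (epsJ d k \<gamma> {d+1}) (int n - 1)" and q: "q \<in> Hsp d {d+1} (epsJ d k \<gamma> {}) (int n)"
  shows "sob_ip d k \<gamma> lam lami lamI lam0 (\<lambda>x. xx d x (d+1) * v x) q = 0"
proof -
  let ?B = "sob_ip d k \<gamma> lam lami lamI lam0" and ?u = "d + 1" and ?C = "N \<union> {d+1}"
  have M: "M = {}" unfolding M_def using k by simp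
  have Bu: "B = {d+1}" by (simp add: B_def M)
  have "Hsp d (B - {}) (eJ {}) (int n - int (card ({} :: nat set))) = (\<lambda>P x. P (xx d x)) ` H_hom {} n"
    by (rule Hsp_H_hom) (use Bu d2 in auto)
  then have "q \<in> (\<lambda>P x. P (xx d x)) ` H_hom {} n" using q by (simp add: Bu eJ_def)
  then obtain Q where Q: "Q \<in> H_hom {} n" "q = (\<lambda>x. Q (xx d x))" using xx_imageE by metis
  then have QH: "Q \<in> Hp N (eJ {}) n" by (simp add: H_hom_def)
  have "v \<in> (\<lambda>P x. P (xx d x)) ` H_hom B n"
  proof -
    have i: "int n - int k = int n - 1" using k by simp
    have "v \<in> Vsp d (eJ B) (int n - int k)" unfolding i eJ_def Bu by (rule v)
    then show ?thesis unfolding Vsp_H_hom .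
  qed
  then obtain W where W: "W \<in> H_hom B n" "v = (\<lambda>x. W (xx d x))" using xx_imageE by metis
  let ?F = "\<lambda>x. x ?u * W x"
  have F: "?F \<in> hp V {n}" using xJ_hp[OF order_refl H_hom_hp[OF W(1)]] by (simp add: Bu)
  have Qh: "Q \<in> hp V {n}" by (rule hp_superset[OF Hp_hp[OF QH]]) (use NM in auto)
  have C: "finite ?C" "\<forall>i\<in>?C. e0 i > -1" using NM e0 by auto
  have pW: "pol W" and pQ: "pol Q" using H_hom_hp[OF W(1)] Qh hp_imp_pol by blast+
  have Qu: "pd ?u Q = (\<lambda>x. 0)" by (rule pd_hp_indep[OF Hp_hp[OF QH]]) (use NM in auto)
  have "pd i Q \<in> hp N UNIV" for i
    by (rule hp_pd[OF hp_mono[OF Hp_hp[OF QH], of UNIV] NM(1)]) auto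
  then have Qiu: "pd ?u (pd i Q) = (\<lambda>x. 0)" for i by (rule pd_hp_indep) (use NM in auto)
  have T2: "T2 i ?F Q = Lag ?C e0 (\<lambda>x. - (((\<gamma> i + 1) * pd i Q x + x i * pd i (pd i Q) x) * ?F x))"
    if i: "i \<in> N" for i
  proof -
    have iu: "?u \<noteq> i" using i NM by auto
    have D: "Dd ?u i Q = pd i Q" unfolding Dd_def Qu by simp
    have "Dd ?u i (\<lambda>x. x i * pd i Q x) = (\<lambda>x. pd i Q x + x i * pd i (pd i Q) x)"
    proof -
      have "pd ?u (\<lambda>x. x i * pd i Q x) = (\<lambda>x. 0)"
        using Qiu[of i] pQ iu by (simp only: pd_mult[OF pol_var pol_pd] pd_var if_False) simp
      moreover have "pd i (\<lambda>x. x i * pd i Q x) = (\<lambda>x. pd i Q x + x i * pd i (pd i Q) x)"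
        using pQ by (simp add: pd_mult pd_var pol_simps)
      ultimately show ?thesis by (simp only: Dd_def diff_zero)
    qed
    then have "T2 i ?F Q = Lag ?C e0 (\<lambda>x. (- \<gamma> i * pd i Q x - (pd i Q x + x i * pd i (pd i Q) x)) * ?F x)"
      unfolding T2_def D using T2_apex[OF i pW pol_pd[OF pQ], of i] by simp
    moreover have "(\<lambda>x. (- \<gamma> i * pd i Q x - (pd i Q x + x i * pd i (pd i Q) x)) * ?F x) =
        (\<lambda>x. - (((\<gamma> i + 1) * pd i Q x + x i * pd i (pd i Q) x) * ?F x))"
      by (rule ext) (simp add: algebra_simps)
    ultimately show ?thesis by simp
  qed
  have "(\<Sum>i\<in>N. T2 i ?F Q) = (\<Sum>i\<in>N. Lag ?C e0 (\<lambda>x. - (((\<gamma> i + 1) * pd i Q x + x i * pd i (pd i Q) x) * ?F x)))"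
    by (rule sum.cong[OF refl]) (rule T2)
  also have "\<dots> = Lag ?C e0 (\<lambda>x. \<Sum>i\<in>N. - (((\<gamma> i + 1) * pd i Q x + x i * pd i (pd i Q) x) * ?F x))"
    by (rule Lag_sum[OF C, symmetric]) (use pQ pW in \<open>intro pol_uminus pol_mult pol_add pol_const pol_pd pol_var\<close>)
  also have "(\<lambda>x. \<Sum>i\<in>N. - (((\<gamma> i + 1) * pd i Q x + x i * pd i (pd i Q) x) * ?F x)) = (\<lambda>x. 0)"
  proof
    fix x
    have "(\<Sum>i\<in>N. (\<gamma> i + 1) * pd i Q x + x i * pd i (pd i Q) x) = 0"
    proof -
      have e: "eJ {} i = \<gamma> i" if "i \<in> N" for i
        using eJ_shift[of "{}" i] that NM by (auto simp: e0_def gz_def)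
      have "(\<Sum>i\<in>N. (eJ {} i + 1) * pd i Q x + x i * pd i (pd i Q) x) = 0"
        by (rule Hp_harmonic[OF NM(1) _ QH]) (use eJ_pos[of "{}"] in simp)
      then show ?thesis using e by simp
    qed
    then show "(\<Sum>i\<in>N. - (((\<gamma> i + 1) * pd i Q x + x i * pd i (pd i Q) x) * ?F x)) = 0"
      unfolding sum_negf sum_distrib_right[symmetric] by simp
  qed
  finally have s2: "(\<Sum>i\<in>N. T2 i ?F Q) = 0" by (simp add: Lag_zero)
  have s3: "T3 ?F Q = 0"
  proof -
    have "T3 ?F Q = Lag N e0 (\<lambda>x. 0)"
      unfolding T3_def by (rule Lag_cong) (use NM in \<open>auto simp: res_def\<close>)
    then show ?thesis by (simp add: Lag_zero)
  qed
  have "(\<Sum>i\<in>N. (if k = 1 then 1 else lami i) * a2 n n * T2 i ?F Q) = a2 n n * (\<Sum>i\<in>N. T2 i ?F Q)"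
    unfolding sum_distrib_left using k by simp
  moreover have "(\<Sum>I\<in>Pow M - {{}}. lI lamI I * a1 n n I * T1 I ?F Q) = 0" using M by simp
  moreover have "k \<le> d" using k d2 by simp
  ultimately have "?B (\<lambda>x. ?F (xx d x)) (\<lambda>x. Q (xx d x)) = 0"
    using sob_ip_eq[OF F Qh] s2 s3 by simp
  then show ?thesis using W(2) Q(2) by simp
qed

end

theorem theorem3p7:
  fixes d k :: nat and \<gamma> :: "nat \<Rightarrow> real"
    and lam :: real and lami :: "nat \<Rightarrow> real" and lamI :: "nat set \<Rightarrow> real"
    and lam0 :: "nat \<Rightarrow> real"
  assumes d: "2 \<le> d"
    and k: "1 \<le> k" "k \<le> d + 1"
    and gam: "\<forall>j\<in>{1..d+1-k}. \<gamma> j > -1"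
    and nonneg: "lam \<ge> 0" "\<forall>i. lami i \<ge> 0" "\<forall>I. lamI I \<ge> 0" "\<forall>j. lam0 j \<ge> 0"
  defines "pos \<equiv>
      (if k \<le> d then
         lam > 0 \<and> (\<forall>i\<in>{1..d-k+1}. k \<ge> 2 \<longrightarrow> lami i > 0)
         \<and> (\<forall>I. I \<subseteq> {d-k+2..d} \<and> 1 \<le> card I \<and> card I \<le> k - 2 \<longrightarrow> lamI I > 0)
       else
         (\<forall>I. I \<subseteq> {1..d} \<and> 1 \<le> card I \<and> card I \<le> d - 1 \<longrightarrow> lamI I > 0)
         \<and> (\<exists>j\<in>{0..d}. lam0 j > 0))"
  shows
    "(pos \<longrightarrow> is_inner_product_on (polys d) (sob_ip d k \<gamma> lam lami lamI lam0))
   \<and> (pos \<longrightarrow> (\<forall>n::nat.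
        (if k = d + 1 \<and> n = 1
         then {f. \<exists>a::nat \<Rightarrow> real. f = (\<lambda>x. \<Sum>j\<in>{1..d}.
                 a j * (x j - lam0 j / (\<Sum>i\<in>{0..d}. lam0 i)))}
         else Usp d k \<gamma> n)
        = orth_polys d (sob_ip d k \<gamma> lam lami lamI lam0) n))
   \<and> (k = 1 \<longrightarrow> (\<forall>n::nat. \<forall>p q.
        p \<in> {(\<lambda>x. xx d x (d+1) * v x) | v. v \<in> Vsp d (epsJ d k \<gamma> {d+1}) (int n - 1)}
        \<and> q \<in> Hsp d {d+1} (epsJ d k \<gamma> {}) (int n)
        \<longrightarrow> sob_ip d k \<gamma> lam lami lamI lam0 p q = 0))"
proof -
  interpret jacobi d k \<gamma> by (rule jacobi.intro) (use d k gam in auto)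
  let ?B = "sob_ip d k \<gamma> lam lami lamI lam0"
  have P: "F = (\<lambda>x. 0)"
    if pos: pos and F: "F \<in> hp {1..d+1} {m}" and le: "?B (\<lambda>x. F (xx d x)) (\<lambda>x. F (xx d x)) \<le> 0" for F m
  proof (rule sob_ip_pos[OF F _ _ _ le])
    show "lI lamI I > 0" if I: "I \<subseteq> M" "I \<noteq> {}" for I
    proof (cases "I = M")
      case True
      then show ?thesis by (simp add: lI_def)
    next
      case False
      have "finite I" using I(1) NM(2) finite_subset by blast
      then have "card I \<ge> 1" using I(2) by (simp add: Suc_le_eq card_gt_0_iff)
      moreover have "card I < card M" using I(1) False NM(2) by (intro psubset_card_mono) auto
      then have c: "card I \<le> k - 2" using NM(10) by simp
      moreover have "k \<le> d \<Longrightarrow> M = {d-k+2..d}" "k = d + 1 \<Longrightarrow> M = {1..d}"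
      proof -
        show "M = {d-k+2..d}" if "k \<le> d"
        proof -
          have "d - k + 2 = d + 2 - k" using that by linarith
          then show ?thesis unfolding M_def by simp
        qed
        show "M = {1..d}" if "k = d + 1" unfolding M_def using that by simp
      qed
      moreover have "k \<le> d \<or> k = d + 1" using k by linarith
      ultimately have "lamI I > 0" using pos I(1) unfolding pos_def by auto
      then show ?thesis using False by (simp add: lI_def)
    qed
    show "lam > 0 \<and> (\<forall>i\<in>N. (if k = 1 then 1 else lami i) > 0)" if kd': "k \<le> d"
    proof -
      have "d - k + 1 = d + 1 - k" using kd' by linarith
      then have "N = {1..d-k+1}" unfolding N_def by simp
      then show ?thesis using pos kd' k(1) unfolding pos_def by auto
    qed
    show "(\<forall>j. lam0 j \<ge> 0) \<and> (\<exists>j\<in>{0..d}. lam0 j > 0)" if "k = d + 1"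
      using pos nonneg(4) that unfolding pos_def by auto
  qed
  have i: "is_inner_product_on (polys d) ?B" if pos: pos
    unfolding is_inner_product_on_def
  proof (intro conjI ballI allI impI)
    fix f g assume "f \<in> polys d" "g \<in> polys d"
    then obtain n where "\<forall>f\<in>{f, g}. \<exists>F\<in>hp {1..d+1} {n}. f = (\<lambda>x. F (xx d x))"
      using polys_xxE[of "{f, g}" d] by auto
    then obtain F G where "F \<in> hp {1..d+1} {n}" "f = (\<lambda>x. F (xx d x))" "G \<in> hp {1..d+1} {n}" "g = (\<lambda>x. G (xx d x))"
      by blast
    then show "?B f g = ?B g f" using sob_ip_symmetric by simp
  next
    fix f g h a b assume "f \<in> polys d" "g \<in> polys d" "h \<in> polys d"
    then obtain n where "\<forall>f\<in>{f, g, h}. \<exists>F\<in>hp {1..d+1} {n}. f = (\<lambda>x. F (xx d x))"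
      using polys_xxE[of "{f, g, h}" d] by auto
    then obtain F G H where FGH: "F \<in> hp {1..d+1} {n}" "f = (\<lambda>x. F (xx d x))" "G \<in> hp {1..d+1} {n}" "g = (\<lambda>x. G (xx d x))"
      "H \<in> hp {1..d+1} {n}" "h = (\<lambda>x. H (xx d x))"
      by blast
    show "?B (\<lambda>x. a * f x + b * g x) h = a * ?B f h + b * ?B g h"
      unfolding FGH(2,4,6) by (rule sob_ip_linear[OF FGH(1,3,5)])
  next
    fix f assume "f \<in> polys d" and nz: "f \<noteq> (\<lambda>x. 0)"
    then obtain n where "\<forall>f\<in>{f}. \<exists>F\<in>hp {1..d+1} {n}. f = (\<lambda>x. F (xx d x))"
      using polys_xxE[of "{f}" d] by auto
    then obtain F where F: "F \<in> hp {1..d+1} {n}" "f = (\<lambda>x. F (xx d x))" by blast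
    show "0 < ?B f f"
    proof (rule ccontr)
      assume "\<not> 0 < ?B f f"
      then have "F = (\<lambda>x. 0)" using P[OF pos F(1)] F(2) by simp
      then show False using nz F(2) by simp
    qed
  qed
  have ii: "(if k = d + 1 \<and> n = 1
         then {f. \<exists>a::nat \<Rightarrow> real. f = (\<lambda>x. \<Sum>j\<in>{1..d}.
                 a j * (x j - lam0 j / (\<Sum>i\<in>{0..d}. lam0 i)))}
         else Usp d k \<gamma> n) = orth_polys d ?B n" if pos: pos for n
  proof -
    consider "n = 0" | "k = d + 1" "n = 1" | "n \<ge> 1" "k \<le> d" | "k = d + 1" "n \<ge> 2"
      using k by linarith
    then show ?thesis
    proof cases
      case 1
      then show ?thesis using orth_polys_0 by (simp add: Usp_def)
    next
      case 2
      then obtain j where "j \<in> {0..d}" "lam0 j > 0" using pos unfolding pos_def by auto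
      then have "(\<Sum>i\<in>{0..d}. lam0 i) > 0" using nonneg(4) by (intro sum_pos2[of _ j]) auto
      then have "orth_polys d ?B 1 = {f. \<exists>a::nat \<Rightarrow> real. f = (\<lambda>x. \<Sum>j\<in>{1..d}.
                 a j * (x j - lam0 j / (\<Sum>i\<in>{0..d}. lam0 i)))}"
        by (intro orth_polys_1_top[OF 2(1)]) simp
      then show ?thesis using 2 by simp
    next
      case 3
      then show ?thesis using Usp_eq_k_le[OF 3(2,1)] orth_polys_eq_U_hom[OF 3(1) _ P[OF pos]] by simp
    next
      case 4
      then show ?thesis using Usp_eq_top[OF 4] orth_polys_eq_U_hom[OF _ _ P[OF pos], of n] by simp
    qed
  qed
  have iii: "?B p q = 0"
    if "k = 1" "p \<in> {(\<lambda>x. xx d x (d+1) * v x) | v. v \<in> Vsp d (epsJ d k \<gamma> {d+1}) (int n - 1)}"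
      "q \<in> Hsp d {d+1} (epsJ d k \<gamma> {}) (int n)" for n p q
    using that k1_orth by blast
  show ?thesis using i ii iii by blast
qed

end
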